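(* Let $\mathbf{a}=(a_n)_{n\ge 1}$ and $\mathbf{b}=(b_n)_{n\ge 1}$ be sequences of integers $\geq 2$. For $\mathbf{T}\in\mathcal{T}(\mathbf{a})$ let $\omega_{\mathbf{T}}$ denote the associated product state of the UHF algebra $\mathcal{A}(\mathbf{a})$ and let $\pi_{\mathbf{T}}$ denote its GNS representation (and similarly for other sequences). Then the following holds. (i) For each $\mathbf{T}=(T^{(n)})_{n\ge1}\in\mathcal{T}(\mathbf{a})$ and $\mathbf{R}=(R^{(n)})_{n\ge1}\in\mathcal{T}(\mathbf{b})$, $$\omega_{\mathbf{T}}\otimes_{\varphi}\omega_{\mathbf{R}}=\omega_{\mathbf{T}\boxtimes\mathbf{R}},$$ where $\mathbf{T}\boxtimes\mathbf{R}\in\mathcal{T}(\mathbf{a}\cdot\mathbf{b})$ is defined by $\mathbf{T}\boxtimes\mathbf{R}=(T^{(1)}\boxtimes R^{(1)},T^{(2)}\boxtimes R^{(2)},T^{(3)}\boxtimes R^{(3)},\ldots)$. (ii) For each $\mathbf{T}\in\mathcal{T}(\mathbf{a})$ and $\mathbf{R}\in\mathcal{T}(\mathbf{b})$, the representation $\pi_{\mathbf{T}}\otimes_{\varphi}\pi_{\mathbf{R}}$ of $\mathcal{A}(\mathbf{a}\cdot\mathbf{b})$ is unitarily equivalent to $\pi_{\mathbf{T}\boxtimes\mathbf{R}}$.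
   Context: For $1\le n<\infty$, $M_n$ is the C$^*$-algebra of complex $n\times n$ matrices, with standard matrix units $\{E^{(n)}_{ij}\}_{i,j=1}^n$. For a sequence $\mathbf{a}=(a_n)_{n\ge1}$ of integers $\ge2$, put $\mathcal{A}_n(\mathbf{a})=\bigotimes_{j=1}^n M_{a_j}$, and let $\mathcal{A}(\mathbf{a})$ be the C$^*$-inductive limit (a UHF algebra) of the $\mathcal{A}_n(\mathbf{a})$ along the embeddings $A\mapsto A\otimes I\in\mathcal{A}_n(\mathbf{a})\otimes M_{a_{n+1}}=\mathcal{A}_{n+1}(\mathbf{a})$; each $\mathcal{A}_n(\mathbf{a})$ is regarded as a subalgebra of $\mathcal{A}(\mathbf{a})$. Product states: $M_{n,+,1}$ is the set of positive elements of $M_n$ with trace $1$, and $\mathcal{T}(\mathbf{a})=\prod_{n\ge1}M_{a_n,+,1}$. For $\mathbf{T}=(T^{(n)})_{n\ge1}\in\mathcal{T}(\mathbf{a})$, $\omega_{\mathbf{T}}$ is the state of $\mathcal{A}(\mathbf{a})$ determined by $\omega_{\mathbf{T}}(E^{(a_1)}_{j_1k_1}\otimes\cdots\otimes E^{(a_n)}_{j_nk_n})=T^{(1)}_{k_1,j_1}\cdots T^{(n)}_{k_n,j_n}$ for all indices and all $n\ge1$. Kronecker product: for $A\in M_n$, $B\in M_m$, $A\boxtimes B\in M_{nm}$ is given by $(A\boxtimes B)_{m(i-1)+i',\,m(j-1)+j'}=A_{ij}B_{i'j'}$ for $i,j\in\{1,\ldots,n\}$, $i',j'\in\{1,\ldots,m\}$.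 Isomorphisms: $\mathbf{a}\cdot\mathbf{b}=(a_1b_1,a_2b_2,\ldots)$. The $*$-isomorphism $\varphi_{\mathbf{a},\mathbf{b}}:\mathcal{A}(\mathbf{a}\cdot\mathbf{b})\to\mathcal{A}(\mathbf{a})\otimes\mathcal{A}(\mathbf{b})$ is the one whose restriction to each $\mathcal{A}_n(\mathbf{a}\cdot\mathbf{b})$ is given by $$E^{(a_1b_1)}_{j_1k_1}\otimes\cdots\otimes E^{(a_nb_n)}_{j_nk_n}\mapsto(E^{(a_1)}_{j_1'k_1'}\otimes\cdots\otimes E^{(a_n)}_{j_n'k_n'})\otimes(E^{(b_1)}_{j_1''k_1''}\otimes\cdots\otimes E^{(b_n)}_{j_n''k_n''}),$$ where $j_i=b_i(j_i'-1)+j_i''$, $k_i=b_i(k_i'-1)+k_i''$ with $j_i',k_i'\in\{1,\ldots,a_i\}$ and $j_i'',k_i''\in\{1,\ldots,b_i\}$. Tensor product $\otimes_\varphi$: for representations $\pi_1$ of $\mathcal{A}(\mathbf{a})$ and $\pi_2$ of $\mathcal{A}(\mathbf{b})$, $\pi_1\otimes_\varphi\pi_2=(\pi_1\otimes\pi_2)\circ\varphi_{\mathbf{a},\mathbf{b}}$, a representation of $\mathcal{A}(\mathbf{a}\cdot\mathbf{b})$; for states $\rho_1$ of $\mathcal{A}(\mathbf{a})$ and $\rho_2$ of $\mathcal{A}(\mathbf{b})$, $\rho_1\otimes_\varphi\rho_2=(\rho_1\otimes\rho_2)\circ\varphi_{\mathbf{a},\mathbf{b}}$, a state of $\mathcal{A}(\mathbf{a}\cdot\mathbf{b})$.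 *)

theory Defs
  imports "HOL-Analysis.Analysis" "Jordan_Normal_Form.Schur_Decomposition"
begin

section \<open>Complex vector spaces, Hilbert spaces and C*-algebras\<close>

class scaleC =
  fixes scaleC :: "complex \<Rightarrow> 'a \<Rightarrow> 'a"  (infixr \<open>*\<^sub>C\<close> 75)

class complex_vector = real_vector + scaleC +
  assumes scaleC_add_right: "c *\<^sub>C (x + y) = c *\<^sub>C x + c *\<^sub>C y"
    and scaleC_add_left: "(c + d) *\<^sub>C x = c *\<^sub>C x + d *\<^sub>C x"
    and scaleC_scaleC: "c *\<^sub>C (d *\<^sub>C x) = (c * d) *\<^sub>C x"
    and scaleC_one: "1 *\<^sub>C x = x"
    and scaleR_scaleC: "r *\<^sub>R x = complex_of_real r *\<^sub>C x"

global_interpretation complex_vector: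
  vector_space "scaleC :: complex \<Rightarrow> 'a \<Rightarrow> 'a::complex_vector"
  defines cspan = complex_vector.span
    and cdependent = complex_vector.dependent
  by unfold_locales (simp_all add: scaleC_add_right scaleC_add_left scaleC_scaleC scaleC_one)

abbreviation clinear :: "('a::complex_vector \<Rightarrow> 'b::complex_vector) \<Rightarrow> bool" where
  "clinear \<equiv> Vector_Spaces.linear scaleC scaleC"

definition cbilinear ::
  "('a::complex_vector \<Rightarrow> 'b::complex_vector \<Rightarrow> 'c::complex_vector) \<Rightarrow> bool" where
  "cbilinear t \<longleftrightarrow> (\<forall>x. clinear (t x)) \<and> (\<forall>y. clinear (\<lambda>x. t x y))"

text \<open>The inner product is conjugate-linear in the first argument.\<close>

class chilbert_space = complex_vector + banach +
  fixes cinner :: "'a \<Rightarrow> 'a \<Rightarrow> complex"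
  assumes cinner_add_right: "cinner x (y + z) = cinner x y + cinner x z"
    and cinner_scaleC_right: "cinner x (c *\<^sub>C y) = c * cinner x y"
    and cinner_commute: "cinner x y = cnj (cinner y x)"
    and cinner_norm: "cinner x x = complex_of_real ((norm x)\<^sup>2)"

text \<open>Unital, nonzero C*-algebras (\<^class>\<open>real_normed_algebra_1\<close> includes \<open>0 \<noteq> 1\<close>).\<close>

class cstar_algebra = complex_vector + real_normed_algebra_1 + banach +
  fixes star :: "'a \<Rightarrow> 'a"
  assumes mult_scaleC_left: "(c *\<^sub>C x) * y = c *\<^sub>C (x * y)"
    and mult_scaleC_right: "x * (c *\<^sub>C y) = c *\<^sub>C (x * y)"
    and norm_scaleC: "norm (c *\<^sub>C x) = cmod c * norm x"
    and star_star: "star (star x) = x"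
    and star_add: "star (x + y) = star x + star y"
    and star_scaleC: "star (c *\<^sub>C x) = cnj c *\<^sub>C star x"
    and star_mult: "star (x * y) = star y * star x"
    and cstar_identity: "norm (star x * x) = (norm x)\<^sup>2"

instantiation complex :: cstar_algebra
begin
definition scaleC_complex :: "complex \<Rightarrow> complex \<Rightarrow> complex" where "scaleC_complex = (*)"
definition star_complex :: "complex \<Rightarrow> complex" where "star_complex = cnj"
instance
  by standard
    (simp_all add: scaleC_complex_def star_complex_def algebra_simps scaleR_conv_of_real
      norm_mult power2_eq_square)
end

instantiation complex :: chilbert_space
begin
definition cinner_complex :: "complex \<Rightarrow> complex \<Rightarrow> complex" where "cinner_complex x y = cnj x * y"
instance
  by standard
    (simp_all add: scaleC_complex_def cinner_complex_def algebra_simps complex_norm_square del: of_real_power)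
end

text \<open>Isometry is automatic for a bijective *-homomorphism of C*-algebras.\<close>

definition star_iso :: "('a::cstar_algebra \<Rightarrow> 'b::cstar_algebra) \<Rightarrow> bool" where
  "star_iso f \<longleftrightarrow> clinear f \<and> (\<forall>x y. f (x * y) = f x * f y) \<and> (\<forall>x. f (star x) = star (f x)) \<and> bij f"

text \<open>The inequality uses the order of \<open>HOL-Library.Complex_Order\<close>: \<open>0 \<le> z\<close> says that
  \<open>z\<close> is real and nonnegative.\<close>

definition is_state :: "('a::cstar_algebra \<Rightarrow> complex) \<Rightarrow> bool" where
  "is_state \<omega> \<longleftrightarrow> clinear \<omega> \<and> (\<forall>x. 0 \<le> \<omega> (star x * x)) \<and> \<omega> 1 = 1"

definition is_rep :: "('a::cstar_algebra \<Rightarrow> 'h::chilbert_space \<Rightarrow> 'h) \<Rightarrow> bool" where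
  "is_rep \<pi> \<longleftrightarrow>
     (\<forall>x. clinear (\<pi> x) \<and> bounded_linear (\<pi> x)) \<and>
     (\<forall>\<xi>. clinear (\<lambda>x. \<pi> x \<xi>)) \<and>
     (\<forall>x y \<xi>. \<pi> (x * y) \<xi> = \<pi> x (\<pi> y \<xi>)) \<and>
     (\<forall>x \<xi> \<eta>. cinner (\<pi> (star x) \<xi>) \<eta> = cinner \<xi> (\<pi> x \<eta>))"

text \<open>\<open>\<pi>\<close>, with cyclic vector \<open>\<Omega>\<close>, is a GNS representation of \<open>\<omega>\<close>.  This determines
  \<open>(\<pi>, \<Omega>)\<close> up to a unique unitary equivalence.\<close>

definition is_gns ::
  "('a::cstar_algebra \<Rightarrow> complex) \<Rightarrow> ('a \<Rightarrow> 'h::chilbert_space \<Rightarrow> 'h) \<Rightarrow> 'h \<Rightarrow> bool" where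
  "is_gns \<omega> \<pi> \<Omega> \<longleftrightarrow>
     is_rep \<pi> \<and> (\<forall>x. \<omega> x = cinner \<Omega> (\<pi> x \<Omega>)) \<and> closure (range (\<lambda>x. \<pi> x \<Omega>)) = UNIV"

definition unitarily_equivalent ::
  "('a \<Rightarrow> 'h::chilbert_space \<Rightarrow> 'h) \<Rightarrow> ('a \<Rightarrow> 'k::chilbert_space \<Rightarrow> 'k) \<Rightarrow> bool" where
  "unitarily_equivalent \<pi> \<rho> \<longleftrightarrow>
     (\<exists>U :: 'h \<Rightarrow> 'k. clinear U \<and> bij U \<and> (\<forall>\<xi> \<eta>. cinner (U \<xi>) (U \<eta>) = cinner \<xi> \<eta>) \<and>
        (\<forall>x \<xi>. U (\<pi> x \<xi>) = \<rho> x (U \<xi>)))"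

section \<open>Tensor products\<close>

text \<open>\<open>t\<close> exhibits \<open>'m\<close> as the Hilbert space tensor product of \<open>'h\<close> and \<open>'k\<close>.\<close>

definition hilbert_tensor ::
  "('h::chilbert_space \<Rightarrow> 'k::chilbert_space \<Rightarrow> 'm::chilbert_space) \<Rightarrow> bool" where
  "hilbert_tensor t \<longleftrightarrow>
     cbilinear t \<and>
     (\<forall>\<xi> \<eta> \<xi>' \<eta>'. cinner (t \<xi> \<eta>) (t \<xi>' \<eta>') = cinner \<xi> \<xi>' * cinner \<eta> \<eta>') \<and>
     closure (cspan (range (\<lambda>(\<xi>, \<eta>). t \<xi> \<eta>))) = UNIV"

text \<open>\<open>t\<close> exhibits \<open>'d\<close> as a C*-tensor product of \<open>'a\<close> and \<open>'b\<close>, that is, as the completion of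
  the algebraic tensor product in a C*-norm; the third conjunct says that the algebraic tensor
  product embeds.  If one factor is nuclear, as every UHF algebra is, there is only one C*-norm
  on the algebraic tensor product.\<close>

definition cstar_tensor ::
  "('a::cstar_algebra \<Rightarrow> 'b::cstar_algebra \<Rightarrow> 'd::cstar_algebra) \<Rightarrow> bool" where
  "cstar_tensor t \<longleftrightarrow>
     cbilinear t \<and>
     (\<forall>x y x' y'. t x y * t x' y' = t (x * x') (y * y')) \<and>
     (\<forall>x y. star (t x y) = t (star x) (star y)) \<and>
     (\<forall>S f. finite S \<longrightarrow> \<not> cdependent S \<longrightarrow> (\<Sum>x\<in>S. t x (f x)) = 0 \<longrightarrow> (\<forall>x\<in>S. f x = 0)) \<and>
     closure (cspan (range (\<lambda>(x, y). t x y))) = UNIV"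

definition state_tensor ::
  "('a::cstar_algebra \<Rightarrow> 'b::cstar_algebra \<Rightarrow> 'd::cstar_algebra) \<Rightarrow>
   ('a \<Rightarrow> complex) \<Rightarrow> ('b \<Rightarrow> complex) \<Rightarrow> 'd \<Rightarrow> complex" where
  "state_tensor t \<rho>\<^sub>1 \<rho>\<^sub>2 = (THE \<rho>. is_state \<rho> \<and> (\<forall>x y. \<rho> (t x y) = \<rho>\<^sub>1 x * \<rho>\<^sub>2 y))"

definition rep_tensor ::
  "('a::cstar_algebra \<Rightarrow> 'b::cstar_algebra \<Rightarrow> 'd::cstar_algebra) \<Rightarrow>
   ('h::chilbert_space \<Rightarrow> 'k::chilbert_space \<Rightarrow> 'm::chilbert_space) \<Rightarrow>
   ('a \<Rightarrow> 'h \<Rightarrow> 'h) \<Rightarrow> ('b \<Rightarrow> 'k \<Rightarrow> 'k) \<Rightarrow> 'd \<Rightarrow> 'm \<Rightarrow> 'm" where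
  "rep_tensor t s \<pi>\<^sub>1 \<pi>\<^sub>2 =
     (THE \<pi>. is_rep \<pi> \<and> (\<forall>x y \<xi> \<eta>. \<pi> (t x y) (s \<xi> \<eta>) = s (\<pi>\<^sub>1 x \<xi>) (\<pi>\<^sub>2 y \<eta>)))"

section \<open>Matrices\<close>

text \<open>Rows and columns are numbered from 0, so that the index \<open>m(i-1)+i'\<close> of the 1-based
  convention becomes \<open>m * i + i'\<close>, which \<open>div\<close> and \<open>mod\<close> by \<open>m\<close> decode.\<close>

definition kron :: "complex mat \<Rightarrow> complex mat \<Rightarrow> complex mat" where
  "kron A B = mat (dim_row A * dim_row B) (dim_col A * dim_col B)
     (\<lambda>(i, j). A $$ (i div dim_row B, j div dim_col B) * B $$ (i mod dim_row B, j mod dim_col B))"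

definition mat_unit :: "nat \<Rightarrow> nat \<Rightarrow> nat \<Rightarrow> complex mat" where
  "mat_unit n i j = mat n n (\<lambda>(r, s). if r = i \<and> s = j then 1 else 0)"

definition positive_mat :: "nat \<Rightarrow> complex mat \<Rightarrow> bool" where
  "positive_mat n A \<longleftrightarrow> A \<in> carrier_mat n n \<and> (\<forall>v\<in>carrier_vec n. 0 \<le> (A *\<^sub>v v) \<bullet>c v)"

definition density_mat :: "nat \<Rightarrow> complex mat set" where
  "density_mat n = {A. positive_mat n A \<and> (\<Sum>i<n. A $$ (i, i)) = 1}"

section \<open>UHF algebras\<close>

text \<open>Sequences are indexed from 0: \<open>a 0\<close> is the first member.  The algebra \<open>M\<^bsub>a 0\<^esub> \<otimes> \<dots> \<otimes> M\<^bsub>a (n - 1)\<^esub>\<close>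
  is realised as the algebra of matrices of size \<open>uhf_dim a n\<close>, the tensor product of matrices being
  the Kronecker product.  For \<open>n = 0\<close> it is the algebra of scalars.\<close>

definition uhf_dim :: "(nat \<Rightarrow> nat) \<Rightarrow> nat \<Rightarrow> nat" where
  "uhf_dim a n = (\<Prod>i<n. a i)"

definition uhf_local :: "(nat \<Rightarrow> nat) \<Rightarrow> nat \<Rightarrow> complex mat set" where
  "uhf_local a n = carrier_mat (uhf_dim a n) (uhf_dim a n)"

primrec tensor_upto :: "(nat \<Rightarrow> complex mat) \<Rightarrow> nat \<Rightarrow> complex mat" where
  "tensor_upto X 0 = 1\<^sub>m 1"
| "tensor_upto X (Suc n) = kron (tensor_upto X n) (X n)"

definition unit_tensor ::
  "(nat \<Rightarrow> nat) \<Rightarrow> nat \<Rightarrow> (nat \<Rightarrow> nat) \<Rightarrow> (nat \<Rightarrow> nat) \<Rightarrow> complex mat" where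
  "unit_tensor a n j k = tensor_upto (\<lambda>i. mat_unit (a i) (j i) (k i)) n"

definition mat_star_hom :: "nat \<Rightarrow> (complex mat \<Rightarrow> 'a::cstar_algebra) \<Rightarrow> bool" where
  "mat_star_hom n h \<longleftrightarrow>
     (\<forall>X\<in>carrier_mat n n. \<forall>Y\<in>carrier_mat n n. h (X + Y) = h X + h Y \<and> h (X * Y) = h X * h Y) \<and>
     (\<forall>X\<in>carrier_mat n n. (\<forall>c. h (c \<cdot>\<^sub>m X) = c *\<^sub>C h X) \<and> h (mat_adjoint X) = star (h X)) \<and>
     h (1\<^sub>m n) = 1"

text \<open>The maps \<open>\<iota> n\<close> exhibit \<open>'a\<close> as the C*-inductive limit of the algebras \<open>uhf_local a n\<close> along
  the embeddings \<open>X \<mapsto> X \<otimes> 1\<close>.  The C*-norm on a matrix algebra is unique, so the injective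
  *-homomorphisms \<open>\<iota> n\<close> are isometric.\<close>

definition uhf_algebra :: "(nat \<Rightarrow> nat) \<Rightarrow> (nat \<Rightarrow> complex mat \<Rightarrow> 'a::cstar_algebra) \<Rightarrow> bool" where
  "uhf_algebra a \<iota> \<longleftrightarrow>
     (\<forall>n. mat_star_hom (uhf_dim a n) (\<iota> n) \<and> inj_on (\<iota> n) (uhf_local a n)) \<and>
     (\<forall>n. \<forall>X\<in>uhf_local a n. \<iota> (Suc n) (kron X (1\<^sub>m (a n))) = \<iota> n X) \<and>
     closure (\<Union>n. \<iota> n ` uhf_local a n) = UNIV"

definition density_seqs :: "(nat \<Rightarrow> nat) \<Rightarrow> (nat \<Rightarrow> complex mat) set" where
  "density_seqs a = {T. \<forall>n. T n \<in> density_mat (a n)}"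

definition product_state ::
  "(nat \<Rightarrow> nat) \<Rightarrow> (nat \<Rightarrow> complex mat \<Rightarrow> 'a::cstar_algebra) \<Rightarrow> (nat \<Rightarrow> complex mat) \<Rightarrow> 'a \<Rightarrow> complex" where
  "product_state a \<iota> T =
     (THE \<omega>. is_state \<omega> \<and>
        (\<forall>n j k. (\<forall>i<n. j i < a i \<and> k i < a i) \<longrightarrow>
           \<omega> (\<iota> n (unit_tensor a n j k)) = (\<Prod>i<n. T i $$ (k i, j i))))"

text \<open>The *-isomorphism from the UHF algebra of \<open>a \<cdot> b\<close> (with embeddings \<open>\<iota>\<^sub>c\<close>) to the tensor
  product (via \<open>t\<close>) of those of \<open>a\<close> and \<open>b\<close>.\<close>

definition uhf_iso ::
  "(nat \<Rightarrow> nat) \<Rightarrow> (nat \<Rightarrow> nat) \<Rightarrow> (nat \<Rightarrow> complex mat \<Rightarrow> 'a::cstar_algebra) \<Rightarrow>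
   (nat \<Rightarrow> complex mat \<Rightarrow> 'b::cstar_algebra) \<Rightarrow> (nat \<Rightarrow> complex mat \<Rightarrow> 'c::cstar_algebra) \<Rightarrow>
   ('a \<Rightarrow> 'b \<Rightarrow> 'd::cstar_algebra) \<Rightarrow> 'c \<Rightarrow> 'd" where
  "uhf_iso a b \<iota>\<^sub>a \<iota>\<^sub>b \<iota>\<^sub>c t =
     (THE \<phi>. star_iso \<phi> \<and>
        (\<forall>n j' k' j'' k''.
           (\<forall>i<n. j' i < a i \<and> k' i < a i \<and> j'' i < b i \<and> k'' i < b i) \<longrightarrow>
           \<phi> (\<iota>\<^sub>c n (unit_tensor (\<lambda>i. a i * b i) n (\<lambda>i. b i * j' i + j'' i) (\<lambda>i. b i * k' i + k'' i))) =
           t (\<iota>\<^sub>a n (unit_tensor a n j' k')) (\<iota>\<^sub>b n (unit_tensor b n j'' k''))))"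

definition state_tensor_phi where
  "state_tensor_phi a b \<iota>\<^sub>a \<iota>\<^sub>b \<iota>\<^sub>c t \<rho>\<^sub>1 \<rho>\<^sub>2 = state_tensor t \<rho>\<^sub>1 \<rho>\<^sub>2 \<circ> uhf_iso a b \<iota>\<^sub>a \<iota>\<^sub>b \<iota>\<^sub>c t"

definition rep_tensor_phi where
  "rep_tensor_phi a b \<iota>\<^sub>a \<iota>\<^sub>b \<iota>\<^sub>c t s \<pi>\<^sub>1 \<pi>\<^sub>2 = rep_tensor t s \<pi>\<^sub>1 \<pi>\<^sub>2 \<circ> uhf_iso a b \<iota>\<^sub>a \<iota>\<^sub>b \<iota>\<^sub>c t"

end

theory Submission
  imports Defs
begin

text \<open>
  A UHF algebra is handled through its matrix units \<open>u n j k\<close>, where \<open>j\<close> and \<open>k\<close> are multi-indices of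
  length \<open>n\<close>. A linear functional or homomorphism given on the units extends to the whole algebra as
  soon as it is contractive on each level. For a map \<open>p\<close> with \<open>\<parallel>p x\<parallel>\<^sup>2 \<le> \<parallel>p (star x * x)\<parallel>\<close> this is automatic:
  \<open>p\<close> is bounded because a level is finite-dimensional, and iterating the inequality removes the constant.
  This yields product states (a density matrix is a sum of rank-one matrices, which gives the inequality
  through Cauchy-Schwarz) and isomorphisms between algebras with the same units. The products of the
  units of \<open>\<A>(a)\<close> and \<open>\<A>(b)\<close> are units for the sequence \<open>a \<cdot> b\<close> in any C*-tensor product, whence the
  isomorphism \<open>\<phi>\<close> and part (i).

  Uniqueness of all these objects rests on the contractivity of states, *-homomorphisms and representations,
  which holds because a self-adjoint element \<open>h\<close> of norm less than \<open>1\<close> is \<open>(u + star u) / 2\<close> for the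
  unitary \<open>u = h + \<i> (1 - h\<^sup>2)\<^bsup>1/2\<^esup>\<close>.

  For part (ii), \<open>\<pi>\<^sub>T(x)\<Omega>\<^sub>T \<otimes> \<pi>\<^sub>R(y)\<Omega>\<^sub>R \<mapsto> \<pi>(\<phi>\<^sup>-\<^sup>1(x \<otimes> y))\<Omega>\<close> preserves inner products by part (i)
  and so extends to a unitary \<open>U\<close>. Transporting \<open>\<pi>\<close> along \<open>U\<close> gives a representation with the defining property of
  \<open>\<pi>\<^sub>T \<otimes> \<pi>\<^sub>R\<close>, so the tensor product of the representations need not be constructed separately.
\<close>

section \<open>Complex linear maps, density arguments and extension by continuity\<close>

section \<open>Complex Banach spaces\<close>

text \<open>A common superclass of C*-algebras and Hilbert spaces, so that one extension result
  serves states, *-homomorphisms and unitaries alike.\<close>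

class complex_banach = complex_vector + banach +
  assumes norm_scaleC_eq: "norm (c *\<^sub>C x) = cmod c * norm x"

instance cstar_algebra \<subseteq> complex_banach
  by standard (rule norm_scaleC)

lemma cinner_scaleC_left: "cinner (c *\<^sub>C x) y = cnj c * cinner x (y::'h::chilbert_space)"
  by (subst (1 2) cinner_commute) (simp add: cinner_scaleC_right)

lemma cinner_add_left: "cinner (x + y) z = cinner x z + cinner y (z::'h::chilbert_space)"
  by (subst (1 2 3) cinner_commute) (simp add: cinner_add_right)

instance chilbert_space \<subseteq> complex_banach
proof
  fix c and x :: 'a
  have "complex_of_real ((norm (c *\<^sub>C x))\<^sup>2) = cnj c * c * complex_of_real ((norm x)\<^sup>2)"
    by (simp only: cinner_norm[symmetric] cinner_scaleC_left cinner_scaleC_right mult_ac)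
  also have "\<dots> = complex_of_real ((cmod c * norm x)\<^sup>2)"
    by (simp add: complex_norm_square[symmetric] power_mult_distrib mult.commute)
  finally show "norm (c *\<^sub>C x) = cmod c * norm x"
    by (metis norm_ge_zero of_real_eq_iff power2_eq_imp_eq zero_le_mult_iff)
qed

lemma clinear_iff:
  "clinear f \<longleftrightarrow> (\<forall>x y. f (x + y) = f x + f y) \<and> (\<forall>c x. f (c *\<^sub>C x) = c *\<^sub>C f x)"
  unfolding Vector_Spaces.linear_def Modules.module_hom_def module_hom_axioms_def
  by (simp add: complex_vector.vector_space_axioms complex_vector.module_axioms)

lemma clinear_add: "clinear f \<Longrightarrow> f (x + y) = f x + f y"
  and clinear_scale: "clinear f \<Longrightarrow> f (c *\<^sub>C x) = c *\<^sub>C f x"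
  by (simp_all add: clinear_iff)

lemmas clinear_zero = module_hom.zero[OF Vector_Spaces.linear.axioms(3)]
lemmas clinear_sum = module_hom.sum[OF Vector_Spaces.linear.axioms(3)]

lemma scaleC_minus_one: "(-1) *\<^sub>C x = - (x::'a::complex_vector)"
  by (simp add: complex_vector.scale_minus_left)

lemma bounded_clinear:
  fixes f :: "'a::complex_banach \<Rightarrow> 'b::complex_banach"
  assumes "clinear f" and "\<And>x. norm (f x) \<le> norm x * K"
  shows "bounded_linear f"
  by (rule bounded_linear_intro[where K = K])
     (use assms in \<open>auto simp: clinear_iff scaleR_scaleC\<close>)

lemma bounded_linear_scaleC: "bounded_linear ((*\<^sub>C) c :: 'a::complex_banach \<Rightarrow> 'a)"
  by (rule bounded_clinear[where K = "cmod c"])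
     (auto simp: clinear_iff scaleC_add_right scaleC_scaleC mult.commute norm_scaleC_eq)

lemmas continuous_on_scaleC [continuous_intros] =
  bounded_linear.continuous_on[OF bounded_linear_scaleC]

lemma dense_induct [consumes 2]:
  assumes "closure S = UNIV" "closed {x. P x}" "\<And>x. x \<in> S \<Longrightarrow> P x"
  shows "P x"
proof -
  have "closure S \<subseteq> {x. P x}"
    using assms(2,3) by (intro closure_minimal) auto
  then show ?thesis
    using assms(1) by auto
qed

lemma dense_eqI:
  fixes f g :: "'a::topological_space \<Rightarrow> 'b::t2_space"
  assumes "closure S = UNIV" "continuous_on UNIV f" "continuous_on UNIV g" "\<And>x. x \<in> S \<Longrightarrow> f x = g x"
  shows "f x = g x"
  using assms(1) closed_Collect_eq[OF assms(2,3)] assms(4) by (rule dense_induct)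

text \<open>The relation \<open>G\<close> is the graph of a densely defined map. A relation spares
  its users the choice of representatives: an element may be a combination of vectors in many ways,
  or lie at many levels. Applied to differences, \<open>bound\<close> makes \<open>G\<close>
  single-valued and 1-Lipschitz; uniform continuity extends it, and the identities pass to the
  closure.\<close>

lemma extend_dense_contraction:
  fixes G :: "'a::complex_banach \<Rightarrow> 'b::complex_banach \<Rightarrow> bool"
  assumes add: "\<And>x y x' y'. G x y \<Longrightarrow> G x' y' \<Longrightarrow> G (x + x') (y + y')"
    and scale: "\<And>c x y. G x y \<Longrightarrow> G (c *\<^sub>C x) (c *\<^sub>C y)"
    and bound: "\<And>x y. G x y \<Longrightarrow> norm y \<le> norm x"
    and dense: "closure {x. \<exists>y. G x y} = UNIV"
  obtains f where "clinear f" "\<And>x. norm (f x) \<le> norm x" "\<And>x y. G x y \<Longrightarrow> f x = y"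
proof -
  let ?S = "{x. \<exists>y. G x y}"
  have diff: "G (x - x') (y - y')" if "G x y" "G x' y'" for x x' y y'
    using add[OF that(1) scale[OF that(2), of "-1"]] by (simp add: scaleC_minus_one)
  define g where "g x = (SOME y. G x y)" for x
  have g: "G x (g x)" if "x \<in> ?S" for x
    using that unfolding g_def by (auto intro: someI)
  have "dist (g x) (g x') \<le> dist x x'" if "x \<in> ?S" "x' \<in> ?S" for x x'
    using bound[OF diff[OF g g]] that by (simp add: dist_norm)
  then have "uniformly_continuous_on ?S g"
    unfolding uniformly_continuous_on_def by (meson order_le_less_trans)
  then obtain f where f: "uniformly_continuous_on (closure ?S) f" "\<And>x. x \<in> ?S \<Longrightarrow> g x = f x"
    using uniformly_continuous_on_extension_on_closure by metis
  have cont: "continuous_on UNIV f"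
    using f(1) dense uniformly_continuous_imp_continuous by metis
  have cont': "continuous_on UNIV (\<lambda>x. f (h x))" if "continuous_on UNIV h" for h :: "'a \<Rightarrow> 'a"
    using continuous_on_compose2[OF cont that] by simp
  have val: "f x = y" if "G x y" for x y
  proof -
    have "g x = y"
      using bound[OF diff[OF g[of x] that]] that by auto
    then show ?thesis
      using f(2)[of x] that by (metis mem_Collect_eq)
  qed
  have f_add: "f (x + x') = f x + f x'" for x x'
  proof -
    have *: "f (x + x') = f x + f x'" if x: "x \<in> ?S" and x': "x' \<in> ?S" for x x'
    proof -
      obtain y y' where "G x y" "G x' y'" using x x' by blast
      then show ?thesis by (metis add val)
    qed
    \<comment> \<open>Additivity reaches the closure one variable at a time: the first one here, the
      second one below.\<close>
    have **: "f (x + x') = f x + f x'" if "x' \<in> ?S" for x x'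
    proof (rule dense_eqI[OF dense, where f = "\<lambda>x. f (x + x')"])
      show "continuous_on UNIV (\<lambda>x. f (x + x'))" "continuous_on UNIV (\<lambda>x. f x + f x')"
        by (intro continuous_intros cont' cont)+
    qed (rule *[OF _ that])
    show ?thesis
    proof (rule dense_eqI[OF dense, where f = "\<lambda>x'. f (x + x')"])
      show "continuous_on UNIV (\<lambda>x'. f (x + x'))" "continuous_on UNIV (\<lambda>x'. f x + f x')"
        by (intro continuous_intros cont' cont)+
    qed (rule **)
  qed
  have f_scale: "f (c *\<^sub>C x) = c *\<^sub>C f x" for c x
  proof (rule dense_eqI[OF dense, where f = "\<lambda>x. f (c *\<^sub>C x)"])
    show "continuous_on UNIV (\<lambda>x. f (c *\<^sub>C x))" "continuous_on UNIV (\<lambda>x. c *\<^sub>C f x)"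
      by (intro continuous_intros cont' cont)+
    fix x assume "x \<in> ?S"
    then obtain y where "G x y" by blast
    then show "f (c *\<^sub>C x) = c *\<^sub>C f x" by (metis scale val)
  qed
  have "norm (f x) \<le> norm x" for x
    using dense
  proof (rule dense_induct)
    show "closed {x. norm (f x) \<le> norm x}"
      by (intro closed_Collect_le continuous_intros cont)
  next
    fix x assume "x \<in> ?S"
    then show "norm (f x) \<le> norm x" using bound val by blast
  qed
  then show ?thesis
    using that f_add f_scale val by (auto simp: clinear_iff)
qed

lemma closure_csubspace:
  fixes S :: "'a::complex_banach set"
  assumes "complex_vector.subspace S"
  shows "complex_vector.subspace (closure S)"
proof (rule complex_vector.subspaceI)
  show "0 \<in> closure S"
    using assms complex_vector.subspace_0 closure_subset by blast
next
  fix x y assume "x \<in> closure S" "y \<in> closure S"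
  then obtain f g where "\<forall>n. f n \<in> S" "f \<longlonglongrightarrow> x" "\<forall>n. g n \<in> S" "g \<longlonglongrightarrow> y"
    by (auto simp: closure_sequential)
  then show "x + y \<in> closure S"
    unfolding closure_sequential
    by (intro exI[of _ "\<lambda>n. f n + g n"]) (auto intro: tendsto_add complex_vector.subspace_add[OF assms])
next
  fix c x assume "x \<in> closure S"
  then obtain f where "\<forall>n. f n \<in> S" "f \<longlonglongrightarrow> x"
    by (auto simp: closure_sequential)
  then show "c *\<^sub>C x \<in> closure S"
    unfolding closure_sequential
    by (intro exI[of _ "\<lambda>n. c *\<^sub>C f n"])
       (auto intro: bounded_linear.tendsto[OF bounded_linear_scaleC] complex_vector.subspace_scale[OF assms])
qed

lemma closure_cspan_subset:
  fixes S :: "'a::complex_banach set"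
  assumes "complex_vector.subspace S" and "R \<subseteq> closure S"
  shows "closure (cspan R) \<subseteq> closure S"
  using complex_vector.span_minimal[OF assms(2) closure_csubspace[OF assms(1)]]
  by (simp add: closure_minimal)

lemma clinear_eq_on_dense_span:
  fixes f g :: "'a::complex_banach \<Rightarrow> 'b::complex_banach"
  assumes "clinear f" "clinear g" "continuous_on UNIV f" "continuous_on UNIV g"
    and "closure (cspan S) = UNIV" and "\<And>x. x \<in> S \<Longrightarrow> f x = g x"
  shows "f x = g x"
proof (rule dense_eqI[OF assms(5,3,4)])
  fix x assume "x \<in> cspan S"
  then show "f x = g x"
    by (induction rule: complex_vector.span_induct_alt)
       (use assms(1,2,6) in \<open>auto simp: clinear_zero clinear_add clinear_scale\<close>)
qed

section \<open>Cauchy-Schwarz, and unitaries between families with equal Gram matrices\<close>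

section \<open>Hilbert spaces\<close>

lemma cinner_zero_left [simp]: "cinner 0 (y::'h::chilbert_space) = 0"
  using cinner_scaleC_left[of 0 0 y] by simp

lemma cinner_zero_right [simp]: "cinner (x::'h::chilbert_space) 0 = 0"
  using cinner_scaleC_right[of x 0 0] by simp

lemma cinner_diff_left: "cinner (x - y) z = cinner x z - cinner y (z::'h::chilbert_space)"
  using cinner_add_left[of "x - y" y z] by simp

lemma cinner_diff_right: "cinner x (y - z) = cinner x y - cinner x (z::'h::chilbert_space)"
  using cinner_add_right[of x "y - z" z] by simp

lemma cmod_cinner_le: "cmod (cinner x y) \<le> norm x * norm (y::'h::chilbert_space)"
proof (cases "x = 0")
  case False
  \<comment> \<open>\<open>c *\<^sub>C x\<close> is the orthogonal projection of \<open>y\<close>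
    onto the line through \<open>x\<close>; the inequality says that the squared distance of
    \<open>y\<close> from it is nonnegative.\<close>
  define c where "c = cinner x y / complex_of_real ((norm x)\<^sup>2)"
  have nx: "(norm x)\<^sup>2 > 0" using False by simp
  have cxx: "c * cinner x x = cinner x y"
    using nx False by (simp add: c_def cinner_norm)
  have "complex_of_real ((norm (y - c *\<^sub>C x))\<^sup>2) =
      cinner y y - c * cinner y x - cnj c * (cinner x y - c * cinner x x)"
    unfolding cinner_norm[symmetric]
    by (simp add: cinner_diff_left cinner_diff_right cinner_scaleC_left cinner_scaleC_right algebra_simps)
  also have "\<dots> = cinner y y - cinner x y * cnj (cinner x y) / complex_of_real ((norm x)\<^sup>2)"
    by (simp only: cxx) (simp add: c_def cinner_commute[of y x])
  also have "\<dots> = complex_of_real ((norm y)\<^sup>2 - (cmod (cinner x y))\<^sup>2 / (norm x)\<^sup>2)"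
    by (simp only: cinner_norm complex_norm_square[symmetric] of_real_diff of_real_divide)
  finally have "(norm (y - c *\<^sub>C x))\<^sup>2 = (norm y)\<^sup>2 - (cmod (cinner x y))\<^sup>2 / (norm x)\<^sup>2"
    by (simp only: of_real_eq_iff)
  then have "(cmod (cinner x y))\<^sup>2 / (norm x)\<^sup>2 \<le> (norm y)\<^sup>2"
    by (smt (verit) zero_le_power2)
  then have "(cmod (cinner x y))\<^sup>2 \<le> (norm x * norm y)\<^sup>2"
    using nx by (simp add: power_mult_distrib field_simps)
  then show ?thesis
    by (rule power2_le_imp_le) simp
qed simp

lemma continuous_on_cinner [continuous_intros]:
  fixes f g :: "'a::topological_space \<Rightarrow> 'h::chilbert_space"
  assumes "continuous_on A f" "continuous_on A g"
  shows "continuous_on A (\<lambda>x. cinner (f x) (g x))"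
proof -
  have "bounded_bilinear (cinner :: 'h \<Rightarrow> 'h \<Rightarrow> complex)"
  proof
    show "\<exists>K. \<forall>a b. norm (cinner a b) \<le> norm a * norm (b::'h) * K"
      by (intro exI[of _ 1]) (simp add: cmod_cinner_le)
  qed (simp_all add: cinner_add_left cinner_add_right scaleR_scaleC cinner_scaleC_left
        cinner_scaleC_right scaleC_complex_def)
  then show ?thesis
    using assms by (rule bounded_bilinear.continuous_on)
qed

text \<open>Equal inner products make the passage from a combination of the \<open>f i\<close> to
  the same combination of the \<open>g i\<close> well defined and isometric. This also holds with
  \<open>f\<close> and \<open>g\<close> exchanged, so the two extensions are mutually inverse.
  Combinations are lists of pairs: appending and rescaling lists represent the vector operations,
  with repeated indices allowed.\<close>

lemma unitary_of_gram:
  fixes f :: "'i \<Rightarrow> 'h::chilbert_space" and g :: "'i \<Rightarrow> 'k::chilbert_space"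
  assumes gram: "\<And>i j. cinner (f i) (f j) = cinner (g i) (g j)"
    and f: "closure (cspan (range f)) = UNIV" and g: "closure (cspan (range g)) = UNIV"
  obtains U where "clinear U" "bij U" "\<And>x y. cinner (U x) (U y) = cinner x y" "\<And>i. U (f i) = g i"
proof -
  let ?f = "\<lambda>xs. \<Sum>(c,i)\<leftarrow>xs. c *\<^sub>C f i" and ?g = "\<lambda>xs. \<Sum>(c,i)\<leftarrow>xs. c *\<^sub>C g i"
  have scale: "c *\<^sub>C (\<Sum>(d,i)\<leftarrow>xs. d *\<^sub>C h i) = (\<Sum>(d,i)\<leftarrow>map (\<lambda>(d,i). (c * d, i)) xs. d *\<^sub>C h i)"
    for c xs and h :: "'i \<Rightarrow> 'z::complex_vector"
    by (induction xs) (auto simp: scaleC_add_right scaleC_scaleC)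
  have range_sum: "range (\<lambda>xs. \<Sum>(c,i)\<leftarrow>xs. c *\<^sub>C h i) = cspan (range h)"
    for h :: "'i \<Rightarrow> 'z::complex_vector"
  proof
    have "(\<Sum>(c,i)\<leftarrow>xs. c *\<^sub>C h i) \<in> cspan (range h)" for xs
      by (induction xs) (auto intro!: complex_vector.span_zero complex_vector.span_add
          complex_vector.span_scale intro: complex_vector.span_base)
    then show "range (\<lambda>xs. \<Sum>(c,i)\<leftarrow>xs. c *\<^sub>C h i) \<subseteq> cspan (range h)" by auto
    show "cspan (range h) \<subseteq> range (\<lambda>xs. \<Sum>(c,i)\<leftarrow>xs. c *\<^sub>C h i)"
    proof
      fix x assume "x \<in> cspan (range h)"
      then show "x \<in> range (\<lambda>xs. \<Sum>(c,i)\<leftarrow>xs. c *\<^sub>C h i)"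
      proof (induction rule: complex_vector.span_induct_alt)
        case base
        show ?case by (rule image_eqI[of _ _ "[]"]) auto
      next
        case (step c x y)
        then obtain i xs where "x = h i" "y = (\<Sum>(c,i)\<leftarrow>xs. c *\<^sub>C h i)" by auto
        then show ?case by (intro image_eqI[of _ _ "(c, i) # xs"]) auto
      qed
    qed
  qed
  have gram1: "cinner (?f xs) (f j) = cinner (?g xs) (g j)" for xs j
    by (induction xs) (auto simp: cinner_add_left cinner_scaleC_left gram)
  have gram2: "cinner (?f xs) (?f ys) = cinner (?g xs) (?g ys)" for xs ys
    by (induction ys) (auto simp: cinner_add_right cinner_scaleC_right gram1)
  have norm_eq: "norm (?f xs) = norm (?g xs)" for xs
  proof -
    have "complex_of_real ((norm (?f xs))\<^sup>2) = complex_of_real ((norm (?g xs))\<^sup>2)"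
      using gram2[of xs xs] by (simp only: cinner_norm)
    then show ?thesis by (simp only: of_real_eq_iff) (simp add: power2_eq_iff_nonneg)
  qed
  \<comment> \<open>Stated for two arbitrary families because it serves once in each
    direction.\<close>
  have ext: "\<exists>W. clinear W \<and> (\<forall>x. norm (W x) \<le> norm x) \<and>
      (\<forall>xs. W (\<Sum>(c,i)\<leftarrow>xs. c *\<^sub>C p i) = (\<Sum>(c,i)\<leftarrow>xs. c *\<^sub>C q i))"
    if eq: "\<And>xs. norm (\<Sum>(c,i)\<leftarrow>xs. c *\<^sub>C q i) = norm (\<Sum>(c,i)\<leftarrow>xs. c *\<^sub>C p i)"
      and p: "closure (cspan (range p)) = UNIV"
    for p :: "'i \<Rightarrow> 'x::chilbert_space" and q :: "'i \<Rightarrow> 'y::chilbert_space"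
  proof -
    let ?p = "\<lambda>xs. \<Sum>(c,i)\<leftarrow>xs. c *\<^sub>C p i" and ?q = "\<lambda>xs. \<Sum>(c,i)\<leftarrow>xs. c *\<^sub>C q i"
    have dom: "{x. \<exists>y. \<exists>xs. x = ?p xs \<and> y = ?q xs} = cspan (range p)"
      using range_sum[of p] by auto
    show ?thesis
    proof (rule extend_dense_contraction[of "\<lambda>x y. \<exists>xs. x = ?p xs \<and> y = ?q xs"])
      fix x y x' y' assume "\<exists>xs. x = ?p xs \<and> y = ?q xs" "\<exists>xs. x' = ?p xs \<and> y' = ?q xs"
      then obtain xs xs' where "x = ?p xs \<and> y = ?q xs" "x' = ?p xs' \<and> y' = ?q xs'" by blast
      then show "\<exists>xs. x + x' = ?p xs \<and> y + y' = ?q xs"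
        by (intro exI[of _ "xs @ xs'"]) simp
    next
      fix c x y assume "\<exists>xs. x = ?p xs \<and> y = ?q xs"
      then show "\<exists>xs. c *\<^sub>C x = ?p xs \<and> c *\<^sub>C y = ?q xs"
        using scale by metis
    next
      show "closure {x. \<exists>y. \<exists>xs. x = ?p xs \<and> y = ?q xs} = UNIV"
        unfolding dom by (rule p)
    next
      fix W assume "clinear W" "\<And>x. norm (W x) \<le> norm x"
        and "\<And>x y. \<exists>xs. x = ?p xs \<and> y = ?q xs \<Longrightarrow> W x = y"
      then show ?thesis by blast
    qed (use eq in auto)
  qed
  obtain U where U: "clinear U" "\<And>x. norm (U x) \<le> norm x" "\<And>xs. U (?f xs) = ?g xs"
    using ext[of g f] norm_eq f by metis
  obtain V where V: "clinear V" "\<And>x. norm (V x) \<le> norm x" "\<And>xs. V (?g xs) = ?f xs"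
    using ext[of f g] norm_eq g by metis
  have contU: "continuous_on A U" for A
    by (intro linear_continuous_on bounded_clinear[where K = 1]) (use U in auto)
  have contV: "continuous_on A V" for A
    by (intro linear_continuous_on bounded_clinear[where K = 1]) (use V in auto)
  have VU: "V (U x) = x" for x
    by (rule dense_eqI[OF f])
       (use range_sum[of f, symmetric] U V in
         \<open>auto intro!: continuous_intros continuous_on_compose2[OF contV contU]\<close>)
  have UV: "U (V x) = x" for x
    by (rule dense_eqI[OF g])
       (use range_sum[of g, symmetric] U V in
         \<open>auto intro!: continuous_intros continuous_on_compose2[OF contU contV]\<close>)
  have inner1: "cinner (U x) (U y) = cinner x y" if "y \<in> range ?f" for x y
    by (rule dense_eqI[OF f])
       (use range_sum[of f, symmetric] that U gram2 in \<open>auto intro!: continuous_intros contU\<close>)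
  have inner: "cinner (U x) (U y) = cinner x y" for x y
    by (rule dense_eqI[OF f, where f = "\<lambda>y. cinner (U x) (U y)"])
       (use range_sum[of f, symmetric] inner1 in \<open>auto intro!: continuous_intros contU\<close>)
  have "U (f i) = g i" for i
    using U(3)[of "[(1, i)]"] by (simp add: scaleC_one)
  moreover have "bij U"
    by (rule o_bij[of V]) (auto simp: VU UV)
  ultimately show ?thesis
    using that U(1) inner by blast
qed

section \<open>The involution, square roots by power series, and automatic contractivity\<close>

section \<open>C*-algebras\<close>

text \<open>The C*-identity gives \<open>(norm x)\<^sup>2 \<le> norm (star x) * norm x\<close>;
  cancelling a factor and then replacing \<open>x\<close> by \<open>star x\<close> gives both
  inequalities.\<close>

lemma norm_star [simp]: "norm (star x) = norm (x::'a::cstar_algebra)"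
proof -
  have le: "norm x \<le> norm (star x)" for x :: 'a
  proof (cases "x = 0")
    case False
    have "norm x * norm x \<le> norm (star x) * norm x"
      using cstar_identity[of x] norm_mult_ineq[of "star x" x] by (simp add: power2_eq_square)
    then show ?thesis using False by simp
  qed simp
  show ?thesis using le[of x] le[of "star x"] by (simp add: star_star)
qed

lemma bounded_linear_star: "bounded_linear (star :: 'a::cstar_algebra \<Rightarrow> 'a)"
  by (rule bounded_linear_intro[where K = 1]) (auto simp: star_add star_scaleC scaleR_scaleC)

lemmas continuous_on_star [continuous_intros] = bounded_linear.continuous_on[OF bounded_linear_star]
lemmas star_sum = linear_sum[OF bounded_linear.linear[OF bounded_linear_star]]
lemmas star_zero [simp] = linear_0[OF bounded_linear.linear[OF bounded_linear_star]]

lemma star_one [simp]: "star 1 = (1::'a::cstar_algebra)"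
  by (metis mult_1 mult_1_right star_mult star_star)

lemma star_power: "star (x ^ n) = star x ^ n" for x :: "'a::cstar_algebra"
  by (induction n) (auto simp: star_mult power_commutes)

text \<open>The root is the binomial series for the power 1/2 of \<open>1 - h\<close>, which
  converges absolutely for \<open>norm h < 1\<close>. Being a limit of real polynomials in
  \<open>h\<close>, it is self-adjoint and commutes with whatever commutes with
  \<open>h\<close>.\<close>

lemma sqrt_one_minus:
  fixes h :: "'a::cstar_algebra"
  assumes "norm h < 1" "star h = h"
  obtains y where "star y = y" "y * y = 1 - h" "\<And>z. z * h = h * z \<Longrightarrow> z * y = y * z"
proof -
  define c :: "nat \<Rightarrow> real" where "c n = (1/2) gchoose n" for n
  define f where "f n = c n *\<^sub>R (- h) ^ n" for n
  have "summable (\<lambda>n. norm (c n * norm h ^ n))"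
  proof (rule abs_summable_in_conv_radius)
    show "ereal (norm (norm h)) < conv_radius c"
      unfolding c_def using assms(1) by (auto simp: conv_radius_gchoose)
  qed
  then have sn: "summable (\<lambda>n. norm (f n))"
    by (rule summable_comparison_test'[where N = 0])
       (auto simp: f_def abs_mult intro!: mult_left_mono order.trans[OF norm_power_ineq])
  then have sf: "summable f" by (rule summable_norm_cancel)
  define y where "y = (\<Sum>n. f n)"
  have "star y = (\<Sum>n. star (f n))"
    unfolding y_def by (rule bounded_linear.suminf[OF bounded_linear_star sf])
  also have "\<dots> = y"
    unfolding y_def f_def
    by (intro suminf_cong)
       (simp add: scaleR_scaleC star_scaleC star_power
         linear_neg[OF bounded_linear.linear[OF bounded_linear_star]] assms)
  finally have "star y = y" .
  moreover have "z * y = y * z" if "z * h = h * z" for z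
  proof -
    have "f n * z = z * f n" for n
      using that by (simp add: f_def power_commuting_commutes)
    then show ?thesis
      unfolding y_def using sf by (simp add: suminf_mult[symmetric] suminf_mult2)
  qed
  moreover have "y * y = 1 - h"
  proof -
    \<comment> \<open>By the Vandermonde convolution, read off from formal power series, the squared
      series has the coefficients of the first power, which vanish from index 2 on.\<close>
    have conv: "(\<Sum>i\<le>k. c i * c (k - i)) = (1 gchoose k :: real)" for k
    proof -
      have "fps_binomial (1/2 + 1/2 :: real) = fps_binomial (1/2) * fps_binomial (1/2)"
        by (rule fps_binomial_add_mult)
      then have "fps_nth (fps_binomial (1/2 + 1/2 :: real)) k =
          fps_nth (fps_binomial (1/2) * fps_binomial (1/2)) k"
        by (rule arg_cong)
      then show ?thesis
        by (simp add: fps_mult_nth c_def atLeast0AtMost)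
    qed
    have "(\<lambda>k. \<Sum>i\<le>k. f i * f (k - i)) sums (y * y)"
      unfolding y_def by (rule Cauchy_product_sums[OF sn sn])
    moreover have "(\<Sum>i\<le>k. f i * f (k - i)) = (1 gchoose k :: real) *\<^sub>R (- h) ^ k" for k
      unfolding conv[symmetric] scaleR_sum_left f_def
      by (intro sum.cong refl) (simp add: power_add[symmetric])
    moreover have "(\<lambda>k. (1 gchoose k :: real) *\<^sub>R (- h) ^ k) sums (\<Sum>k<2. (1 gchoose k :: real) *\<^sub>R (- h) ^ k)"
    proof (rule sums_finite)
      fix k assume "k \<notin> {..<2::nat}"
      then have "(1 gchoose k :: real) = 0"
        using binomial_gbinomial[of 1 k, where 'a = real] by (simp add: binomial_eq_0)
      then show "(1 gchoose k :: real) *\<^sub>R (- h) ^ k = 0" by simp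
    qed simp
    ultimately have "y * y = (\<Sum>k<2. (1 gchoose k :: real) *\<^sub>R (- h) ^ k)"
      using sums_unique2 by fastforce
    then show ?thesis by (simp add: numeral_2_eq_2)
  qed
  ultimately show ?thesis using that by blast
qed

text \<open>With \<open>y\<close> the root of \<open>1 - h * h\<close> and
  \<open>u = h + \<i> *\<^sub>C y\<close>, both products of \<open>u\<close> and
  \<open>star u\<close> equal \<open>h * h + y * y = 1\<close>, because \<open>y\<close> is
  self-adjoint and commutes with \<open>h\<close>.\<close>

lemma selfadjoint_avg_unitary:
  fixes h :: "'a::cstar_algebra"
  assumes "norm h < 1" "star h = h"
  obtains u where "star u * u = 1" "u * star u = 1" "(1/2) *\<^sub>C (u + star u) = h"
proof -
  have "norm (h * h) < 1"
    using norm_mult_ineq[of h h] assms(1) mult_strict_mono'[of "norm h" 1 "norm h" 1] by simp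
  then obtain y where y: "star y = y" "y * y = 1 - h * h" "h * y = y * h"
    using sqrt_one_minus[of "h * h"] assms(2) by (metis star_mult mult.assoc)
  let ?u = "h + \<i> *\<^sub>C y"
  have su: "star ?u = h - \<i> *\<^sub>C y"
    by (simp add: star_add star_scaleC assms(2) y(1) complex_vector.scale_minus_left)
  show ?thesis
  proof (rule that)
    show "star ?u * ?u = 1" "?u * star ?u = 1"
      unfolding su
      by (simp_all add: algebra_simps mult_scaleC_left mult_scaleC_right scaleC_scaleC y(2,3)
          complex_vector.scale_minus_left scaleC_one)
    show "(1/2) *\<^sub>C (?u + star ?u) = h"
      unfolding su by (simp add: scaleC_add_right scaleC_add_left[symmetric] scaleC_one)
  qed
qed

text \<open>Linearity turns a bound on unitaries into one on their averages, hence on self-adjoint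
  elements of norm less than 1. In general \<open>h\<close> is divided by any
  \<open>r > norm h\<close>, and \<open>r\<close> then tends to \<open>norm h\<close>.\<close>

lemma selfadjoint_contraction:
  fixes p :: "'a::cstar_algebra \<Rightarrow> 'b::complex_banach"
  assumes "clinear p" and unitary: "\<And>u. star u * u = 1 \<Longrightarrow> norm (p u) \<le> K"
    and "star h = h"
  shows "norm (p h) \<le> K * norm h"
proof -
  have *: "norm (p h) \<le> K" if h: "norm h < 1" "star h = h" for h
  proof -
    obtain u where u: "star u * u = 1" "u * star u = 1" "(1/2) *\<^sub>C (u + star u) = h"
      using selfadjoint_avg_unitary[OF h] by metis
    have "p h = (1/2) *\<^sub>C (p u + p (star u))"
      unfolding u(3)[symmetric] using assms(1) by (simp add: clinear_scale clinear_add)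
    moreover have "norm (p u) \<le> K" "norm (p (star u)) \<le> K"
      using unitary u(1,2) by (auto simp: star_star)
    ultimately show ?thesis
      using norm_triangle_ineq[of "p u" "p (star u)"] by (simp add: norm_scaleC_eq)
  qed
  have K: "0 \<le> K"
    using unitary[of 1] order.trans[OF norm_ge_zero] by simp
  have "norm (p h) \<le> K * r" if r: "norm h < r" for r
  proof -
    have r0: "r > 0" using r norm_ge_zero[of h] by linarith
    let ?c = "complex_of_real (1 / r)"
    have "norm (p (?c *\<^sub>C h)) \<le> K"
      using r r0 by (intro *) (auto simp: norm_scaleC_eq star_scaleC assms(3) norm_divide)
    then show ?thesis
      using r0 by (simp add: clinear_scale[OF assms(1)] norm_scaleC_eq norm_divide field_simps)
  qed
  then have "norm (p h) \<le> K * (norm h + e)" if "e > 0" for e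
    using that by simp
  then show ?thesis
  proof (cases "K = 0")
    case False
    have "norm (p h) \<le> K * norm h + e" if "e > 0" for e
      using \<open>\<And>e. e > 0 \<Longrightarrow> norm (p h) \<le> K * (norm h + e)\<close>[of "e / K"] that K False
      by (simp add: distrib_left)
    then show ?thesis by (rule field_le_epsilon)
  qed (use \<open>\<And>e. e > 0 \<Longrightarrow> norm (p h) \<le> K * (norm h + e)\<close>[of 1] in simp)
qed

lemma star_star_mult_self: "star (star x * x) = star x * (x::'a::cstar_algebra)"
  by (simp add: star_mult star_star)

text \<open>If \<open>star u * u = 1\<close> then \<open>f u\<close> has the same property and so
  has norm 1. The resulting bound on \<open>star x * x\<close> becomes one on \<open>x\<close>
  through the C*-identity in both algebras.\<close>

lemma star_hom_contractive:
  fixes f :: "'a::cstar_algebra \<Rightarrow> 'b::cstar_algebra"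
  assumes "clinear f" and mult: "\<And>x y. f (x * y) = f x * f y"
    and star: "\<And>x. f (star x) = star (f x)" and one: "f 1 = 1"
  shows "norm (f x) \<le> norm x"
proof -
  have "norm (f u) \<le> 1" if "star u * u = 1" for u
  proof -
    have "(norm (f u))\<^sup>2 = 1"
      using cstar_identity[of "f u"] that one by (simp add: mult[symmetric] star[symmetric])
    then show ?thesis by (simp add: power2_eq_1_iff) (use norm_ge_zero[of "f u"] in linarith)
  qed
  then have "norm (f (star x * x)) \<le> 1 * norm (star x * x)"
    by (rule selfadjoint_contraction[OF assms(1)]) (simp_all add: star_star_mult_self)
  then have "(norm (f x))\<^sup>2 \<le> (norm x)\<^sup>2"
    by (simp add: mult star cstar_identity)
  then show ?thesis by (rule power2_le_imp_le) simp
qed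

text \<open>Cauchy-Schwarz against the unit, obtained from positivity at
  \<open>x + c *\<^sub>C 1\<close> for suitable scalars \<open>c\<close>.\<close>

lemma state_square_le:
  assumes "is_state \<omega>"
  shows "(cmod (\<omega> x))\<^sup>2 \<le> Re (\<omega> (star x * x))"
proof -
  have lin: "clinear \<omega>" and pos: "\<And>x. 0 \<le> \<omega> (star x * x)" and one: "\<omega> 1 = 1"
    using assms by (auto simp: is_state_def)
  have exp: "\<omega> (star (x + c *\<^sub>C 1) * (x + c *\<^sub>C 1)) =
    \<omega> (star x * x) + c * \<omega> (star x) + cnj c * \<omega> x + cnj c * c" for c
  proof -
    have "star (x + c *\<^sub>C 1) * (x + c *\<^sub>C 1) = star x * x + c *\<^sub>C star x + cnj c *\<^sub>C x + (cnj c * c) *\<^sub>C 1"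
      by (simp add: star_add star_scaleC algebra_simps mult_scaleC_left mult_scaleC_right scaleC_scaleC)
    then show ?thesis
      by (simp add: clinear_add[OF lin] clinear_scale[OF lin] one scaleC_complex_def)
  qed
  have im: "Im (\<omega> (star x * x) + c * \<omega> (star x) + cnj c * \<omega> x + cnj c * c) = 0" for c
    using pos[of "x + c *\<^sub>C 1"] unfolding exp by (simp add: less_eq_complex_def)
  \<comment> \<open>The values at \<open>c = 0\<close>, \<open>c = 1\<close> and
    \<open>c = \<i>\<close> being real, they determine the real and imaginary parts of
    \<open>\<omega> (star x)\<close>.\<close>
  have hx: "\<omega> (star x) = cnj (\<omega> x)"
    using im[of 0] im[of 1] im[of \<i>] by (auto simp: complex_eq_iff)
  \<comment> \<open>The scalar \<open>c = - \<omega> x\<close> minimises this nonnegative quadratic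
    expression in \<open>c\<close>.\<close>
  have "0 \<le> Re (\<omega> (star x * x) + (- \<omega> x) * cnj (\<omega> x) + cnj (- \<omega> x) * \<omega> x + cnj (- \<omega> x) * (- \<omega> x))"
    using pos[of "x + (- \<omega> x) *\<^sub>C 1"] unfolding exp hx by (simp add: less_eq_complex_def)
  then show ?thesis
    by (simp add: cmod_power2) (simp add: power2_eq_square)
qed

text \<open>The inequality \<open>state_square_le\<close> bounds \<open>\<omega>\<close> by 1 where
  \<open>star u * u = 1\<close>, hence by the norm at \<open>star x * x\<close>; used once more, it
  leads back to \<open>x\<close>.\<close>

lemma state_le_norm:
  assumes "is_state \<omega>"
  shows "cmod (\<omega> x) \<le> norm x"
proof -
  have lin: "clinear \<omega>" and one: "\<omega> 1 = 1"
    using assms by (auto simp: is_state_def)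
  have "norm (\<omega> u) \<le> 1" if "star u * u = 1" for u
    using state_square_le[OF assms, of u] that one by (simp add: power_le_one_iff)
  then have "norm (\<omega> (star x * x)) \<le> 1 * norm (star x * x)"
    by (rule selfadjoint_contraction[OF lin]) (simp_all add: star_star_mult_self)
  then have "(cmod (\<omega> x))\<^sup>2 \<le> (norm x)\<^sup>2"
    using state_square_le[OF assms, of x] complex_Re_le_cmod[of "\<omega> (star x * x)"]
    unfolding cstar_identity by linarith
  then show ?thesis by (rule power2_le_imp_le) simp
qed

text \<open>For a fixed vector, \<open>\<lambda>x. \<pi> x \<xi>\<close> is treated like a
  functional: it is bounded by \<open>norm \<xi>\<close> where \<open>star u * u = 1\<close>, which
  controls \<open>star x * x\<close>, and \<open>sq\<close> leads back to \<open>x\<close>.\<close>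

lemma rep_contractive:
  assumes "is_rep \<pi>"
  shows "norm (\<pi> x \<xi>) \<le> norm x * norm \<xi>"
proof -
  have lin: "clinear (\<lambda>x. \<pi> x \<xi>)" and mult: "\<And>x y \<xi>. \<pi> (x * y) \<xi> = \<pi> x (\<pi> y \<xi>)"
    and adj: "\<And>x \<xi> \<eta>. cinner (\<pi> (star x) \<xi>) \<eta> = cinner \<xi> (\<pi> x \<eta>)"
    using assms by (auto simp: is_rep_def)
  have sq: "(norm (\<pi> x \<xi>))\<^sup>2 \<le> norm \<xi> * norm (\<pi> (star x * x) \<xi>)" for x
  proof -
    have "complex_of_real ((norm (\<pi> x \<xi>))\<^sup>2) = cinner \<xi> (\<pi> (star x * x) \<xi>)"
      unfolding mult adj[of "star x", symmetric] star_star cinner_norm ..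
    then have "cmod (complex_of_real ((norm (\<pi> x \<xi>))\<^sup>2)) \<le> norm \<xi> * norm (\<pi> (star x * x) \<xi>)"
      by (simp only: cmod_cinner_le)
    then show ?thesis by (simp add: norm_power)
  qed
  \<comment> \<open>A representation may be degenerate, so \<open>\<pi> 1\<close> may differ from
    the identity; \<open>sq\<close> at \<open>1\<close> still makes it a contraction.\<close>
  have one: "norm (\<pi> 1 \<xi>) \<le> norm \<xi>"
    using sq[of 1] by (cases "\<pi> 1 \<xi> = 0") (auto simp: power2_eq_square)
  have "norm (\<pi> u \<xi>) \<le> norm \<xi>" if "star u * u = 1" for u
  proof (rule power2_le_imp_le)
    show "(norm (\<pi> u \<xi>))\<^sup>2 \<le> (norm \<xi>)\<^sup>2"
      using sq[of u] mult_left_mono[OF one, of "norm \<xi>"] unfolding that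
      by (simp add: power2_eq_square)
  qed simp
  then have "norm (\<pi> (star x * x) \<xi>) \<le> norm \<xi> * norm (star x * x)"
    by (rule selfadjoint_contraction[OF lin]) (simp_all add: star_star_mult_self)
  then have "(norm (\<pi> x \<xi>))\<^sup>2 \<le> (norm x * norm \<xi>)\<^sup>2"
    using sq[of x] mult_left_mono[of "norm (\<pi> (star x * x) \<xi>)" "norm \<xi> * norm (star x * x)" "norm \<xi>"]
    by (simp add: cstar_identity power_mult_distrib) (simp add: power2_eq_square mult_ac)
  then show ?thesis by (rule power2_le_imp_le) simp
qed

lemma clinear_contraction_continuous:
  fixes f :: "'a::complex_banach \<Rightarrow> 'b::complex_banach"
  assumes "clinear f" "\<And>x. norm (f x) \<le> norm x" "continuous_on A g"
  shows "continuous_on A (\<lambda>x. f (g x))"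
  by (rule bounded_linear.continuous_on[OF bounded_clinear[where K = 1]]) (use assms in auto)

lemma state_continuous:
  assumes "is_state \<omega>" "continuous_on A g"
  shows "continuous_on A (\<lambda>x. \<omega> (g x))"
  using assms state_le_norm[OF assms(1)]
  by (intro clinear_contraction_continuous[where f = \<omega> and g = g]) (auto simp: is_state_def)

lemma rep_continuous_left:
  assumes "is_rep \<pi>"
  shows "continuous_on A (\<lambda>x. \<pi> x \<xi>)"
  by (rule linear_continuous_on, rule bounded_clinear[where K = "norm \<xi>"])
     (use assms rep_contractive in \<open>auto simp: is_rep_def\<close>)

lemma rep_continuous_right:
  assumes "is_rep \<pi>"
  shows "continuous_on A (\<pi> x)"
  using assms by (intro linear_continuous_on) (auto simp: is_rep_def)

text \<open>A preimage \<open>e\<close> of \<open>1\<close> exists by surjectivity, and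
  \<open>\<phi> 1 = \<phi> 1 * \<phi> e = \<phi> e = 1\<close>.\<close>

lemma star_iso_one:
  assumes "star_iso \<phi>"
  shows "\<phi> 1 = 1"
proof -
  obtain e where "\<phi> e = 1"
    using assms by (metis bij_pointE star_iso_def)
  then show ?thesis
    using assms unfolding star_iso_def by (metis mult_1 mult_1_right)
qed

lemma star_iso_continuous:
  assumes "star_iso \<phi>" "continuous_on A g"
  shows "continuous_on A (\<lambda>x. \<phi> (g x))"
  using assms star_hom_contractive[of \<phi>] star_iso_one[OF assms(1)]
  by (intro clinear_contraction_continuous[where f = \<phi> and g = g]) (auto simp: star_iso_def)

lemma is_state_comp_star_iso:
  assumes "is_state \<omega>" "star_iso \<phi>"
  shows "is_state (\<omega> \<circ> \<phi>)"
  using assms star_iso_one[OF assms(2)]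
  by (auto simp: is_state_def star_iso_def clinear_iff)

section \<open>Matrix units: products, coefficients and norm bounds\<close>

section \<open>Systems of matrix units\<close>

text \<open>The family \<open>V\<close> is arbitrary because it stands for the units themselves, for
  their images under a map, or for the scalar values of a functional on them.\<close>

definition unit_comb ::
  "'i set \<Rightarrow> ('i \<Rightarrow> 'i \<Rightarrow> 'b::complex_vector) \<Rightarrow> ('i \<Rightarrow> 'i \<Rightarrow> complex) \<Rightarrow> 'b" where
  "unit_comb I V x = (\<Sum>j\<in>I. \<Sum>k\<in>I. x j k *\<^sub>C V j k)"

definition matrix_units :: "'i set \<Rightarrow> ('i \<Rightarrow> 'i \<Rightarrow> 'a::cstar_algebra) \<Rightarrow> bool" where
  "matrix_units I e \<longleftrightarrow>
     (\<forall>i\<in>I. \<forall>j\<in>I. \<forall>k\<in>I. \<forall>l\<in>I. e i j * e k l = (if j = k then e i l else 0)) \<and>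
     (\<forall>i\<in>I. \<forall>j\<in>I. star (e i j) = e j i) \<and> (\<Sum>i\<in>I. e i i) = 1"

text \<open>The coefficients of \<open>star X * X\<close>, where \<open>X\<close> has coefficients \<open>x\<close>.\<close>

definition gram :: "'i set \<Rightarrow> ('i \<Rightarrow> 'i \<Rightarrow> complex) \<Rightarrow> 'i \<Rightarrow> 'i \<Rightarrow> complex" where
  "gram I x = (\<lambda>i j. \<Sum>k\<in>I. cnj (x k i) * x k j)"

lemma unit_comb_add: "unit_comb I V (\<lambda>j k. x j k + y j k) = unit_comb I V x + unit_comb I V y"
  by (simp add: unit_comb_def scaleC_add_left sum.distrib)

lemma unit_comb_scale: "unit_comb I V (\<lambda>j k. c * x j k) = c *\<^sub>C unit_comb I V x"
  by (simp add: unit_comb_def complex_vector.scale_sum_right)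

lemma unit_comb_delta:
  assumes "finite I" "j \<in> I" "k \<in> I"
  shows "unit_comb I V (\<lambda>p q. if p = j \<and> q = k then 1 else 0) = V j k"
proof -
  have "unit_comb I V (\<lambda>p q. if p = j \<and> q = k then 1 else 0) =
    (\<Sum>p\<in>I. if p = j then \<Sum>q\<in>I. (if q = k then V j q else 0) else 0)"
    unfolding unit_comb_def by (intro sum.cong refl) (auto intro!: sum.cong)
  then show ?thesis
    using assms by simp
qed

lemma clinear_unit_comb:
  assumes "clinear f"
  shows "f (unit_comb I V x) = unit_comb I (\<lambda>j k. f (V j k)) x"
  by (simp add: unit_comb_def clinear_sum[OF assms] clinear_scale[OF assms])

lemma unit_comb_cong:
  assumes "\<And>j k. j \<in> I \<Longrightarrow> k \<in> I \<Longrightarrow> V j k = W j k"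
  shows "unit_comb I V x = unit_comb I W x"
  using assms by (simp add: unit_comb_def cong: sum.cong)

context
  fixes I :: "'i set" and e :: "'i \<Rightarrow> 'i \<Rightarrow> 'a::cstar_algebra"
  assumes fin: "finite I" and mu: "matrix_units I e"
begin

lemma mu_mult: "i \<in> I \<Longrightarrow> j \<in> I \<Longrightarrow> k \<in> I \<Longrightarrow> l \<in> I \<Longrightarrow> e i j * e k l = (if j = k then e i l else 0)"
  and mu_star: "i \<in> I \<Longrightarrow> j \<in> I \<Longrightarrow> star (e i j) = e j i"
  and mu_sum: "(\<Sum>i\<in>I. e i i) = 1"
  using mu by (auto simp: matrix_units_def)

lemma unit_comb_star: "star (unit_comb I e x) = unit_comb I e (\<lambda>j k. cnj (x k j))"
  unfolding unit_comb_def
  by (subst sum.swap) (simp add: star_sum star_scaleC mu_star cong: sum.cong)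

lemma unit_comb_mult:
  "unit_comb I e x * unit_comb I e y = unit_comb I e (\<lambda>i j. \<Sum>k\<in>I. x i k * y k j)"
proof -
  have "unit_comb I e x * unit_comb I e y =
    (\<Sum>i\<in>I. \<Sum>k\<in>I. \<Sum>l\<in>I. \<Sum>j\<in>I. if k = l then (x i k * y l j) *\<^sub>C e i j else 0)"
    unfolding unit_comb_def sum_distrib_right
    unfolding sum_distrib_left
    by (intro sum.cong refl)
       (simp add: mult_scaleC_left mult_scaleC_right scaleC_scaleC mu_mult mult.commute)
  also have "\<dots> = (\<Sum>i\<in>I. \<Sum>k\<in>I. \<Sum>l\<in>I. if k = l then \<Sum>j\<in>I. (x i k * y l j) *\<^sub>C e i j else 0)"
    by (intro sum.cong refl) simp
  also have "\<dots> = (\<Sum>i\<in>I. \<Sum>k\<in>I. \<Sum>j\<in>I. (x i k * y k j) *\<^sub>C e i j)"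
    using fin by simp
  also have "\<dots> = unit_comb I e (\<lambda>i j. \<Sum>k\<in>I. x i k * y k j)"
    unfolding unit_comb_def complex_vector.scale_sum_left
    by (intro sum.cong refl sum.swap)
  finally show ?thesis .
qed

lemma unit_comb_gram: "star (unit_comb I e x) * unit_comb I e x = unit_comb I e (gram I x)"
  by (simp add: unit_comb_star unit_comb_mult gram_def)

text \<open>As the diagonal units add up to \<open>1\<close>, which is nonzero, some
  \<open>e p p\<close> is nonzero. It factors through each \<open>e j j\<close>, so every
  \<open>e j j\<close> is a nonzero projection, of norm 1, and the C*-identity passes this on to
  \<open>e i j\<close>.\<close>

lemma norm_unit:
  assumes ij: "i \<in> I" "j \<in> I"
  shows "norm (e i j) = 1"
proof -
  have "\<not> (\<forall>p\<in>I. e p p = 0)"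
  proof
    assume "\<forall>p\<in>I. e p p = 0"
    then have "(\<Sum>p\<in>I. e p p) = 0" by (intro sum.neutral)
    then show False using mu_sum by simp
  qed
  then obtain p where p: "p \<in> I" "e p p \<noteq> 0" by blast
  have "e p p = e p j * e j j * e j p"
    using p ij by (simp add: mu_mult)
  then have "e j j \<noteq> 0" using p(2) by auto
  moreover have "(norm (e j j))\<^sup>2 = norm (e j j)"
    using cstar_identity[of "e j j"] ij by (simp add: mu_star mu_mult)
  ultimately have "norm (e j j) = 1" by (simp add: power2_eq_square)
  then have "(norm (e i j))\<^sup>2 = 1\<^sup>2"
    using cstar_identity[of "e i j"] ij by (simp add: mu_star mu_mult)
  then show ?thesis
    by (simp only: power2_eq_iff_nonneg norm_ge_zero zero_le_one)
qed

text \<open>Compressing the combination by \<open>e i i\<close> on the left and \<open>e j j\<close>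
  on the right leaves \<open>x i j *\<^sub>C e i j\<close>, and units have norm 1.\<close>

lemma coeff_le_norm:
  assumes ij: "i \<in> I" "j \<in> I"
  shows "cmod (x i j) \<le> norm (unit_comb I e x)"
proof -
  have "e i i * unit_comb I e x = (\<Sum>k\<in>I. if i = k then \<Sum>l\<in>I. x k l *\<^sub>C e i l else 0)"
    unfolding unit_comb_def sum_distrib_left
    by (intro sum.cong refl) (use ij in \<open>auto simp: mult_scaleC_right mu_mult\<close>)
  also have "\<dots> = (\<Sum>l\<in>I. x i l *\<^sub>C e i l)"
    using fin ij by simp
  also have "\<dots> * e j j = (\<Sum>l\<in>I. if l = j then x i l *\<^sub>C e i j else 0)"
    unfolding sum_distrib_right
    by (intro sum.cong refl) (use ij in \<open>auto simp: mult_scaleC_left mu_mult\<close>)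
  also have "\<dots> = x i j *\<^sub>C e i j"
    using fin ij by simp
  finally have "cmod (x i j) = norm (e i i * unit_comb I e x * e j j)"
    using ij by (simp add: norm_scaleC norm_unit)
  also have "\<dots> \<le> norm (e i i) * norm (unit_comb I e x) * norm (e j j)"
    by (intro order.trans[OF norm_mult_ineq] mult_right_mono norm_mult_ineq) auto
  finally show ?thesis
    using ij by (simp add: norm_unit)
qed

text \<open>Iterating the hypothesis bounds the \<open>2\<^sup>m\<close>-th power of the left-hand side by a constant, coming
  from the coefficients, times the \<open>2\<^sup>m\<close>-th power of the right-hand side.\<close>

lemma norm_unit_comb_le:
  fixes V :: "'i \<Rightarrow> 'i \<Rightarrow> 'b::complex_banach"
  assumes V: "\<And>x. (norm (unit_comb I V x))\<^sup>2 \<le> norm (unit_comb I V (gram I x))"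
  shows "norm (unit_comb I V x) \<le> norm (unit_comb I e x)"
proof -
  define K where "K = (\<Sum>j\<in>I. \<Sum>k\<in>I. norm (V j k))"
  have bound: "norm (unit_comb I V x) \<le> norm (unit_comb I e x) * K" for x
    unfolding unit_comb_def[of I V] K_def sum_distrib_left
    by (intro sum_norm_le)
       (auto simp: norm_scaleC_eq intro!: mult_right_mono coeff_le_norm)
  \<comment> \<open>The witness is the \<open>m\<close>-fold iterate of \<open>gram I\<close> at
    \<open>x\<close>; the C*-identity squares the norm of the combination of the
    \<open>e j k\<close> exactly at each step.\<close>
  have iter: "\<exists>z. norm (unit_comb I V x) ^ 2 ^ m \<le> norm (unit_comb I V z) \<and>
      norm (unit_comb I e z) = norm (unit_comb I e x) ^ 2 ^ m" for m
  proof (induction m)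
    case (Suc m)
    then obtain z where z: "norm (unit_comb I V x) ^ 2 ^ m \<le> norm (unit_comb I V z)"
      "norm (unit_comb I e z) = norm (unit_comb I e x) ^ 2 ^ m" by blast
    have "norm (unit_comb I V x) ^ 2 ^ Suc m \<le> (norm (unit_comb I V z))\<^sup>2"
      using power_mono[OF z(1), of 2] by (simp add: power_mult[symmetric] mult.commute)
    moreover have "norm (unit_comb I e (gram I z)) = norm (unit_comb I e x) ^ 2 ^ Suc m"
      unfolding unit_comb_gram[symmetric] cstar_identity z(2)
      by (simp add: power_mult[symmetric] mult.commute)
    ultimately show ?case
      using V[of z] order.trans by blast
  qed (intro exI[of _ x], simp)
  let ?r = "norm (unit_comb I V x)" and ?s = "norm (unit_comb I e x)"
  have power_bound: "?r ^ 2 ^ m \<le> ?s ^ 2 ^ m * K" for m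
    using iter[of m] bound order.trans by metis
  show ?thesis
  proof (rule ccontr)
    assume "\<not> ?thesis"
    then have lt: "?s < ?r" by simp
    have s: "?s > 0"
    proof (rule ccontr)
      assume "\<not> ?s > 0"
      then have "?s = 0" by simp
      then show False using bound[of x] lt by simp
    qed
    obtain m where m: "K < (?r / ?s) ^ m"
      using real_arch_pow[of "?r / ?s" K] lt s by auto
    also have "\<dots> \<le> (?r / ?s) ^ 2 ^ m"
      using lt s by (intro power_increasing) (auto intro: less_imp_le)
    also have "\<dots> \<le> K"
      using power_bound[of m] s by (simp add: power_divide divide_le_eq mult.commute)
    finally show False by simp
  qed
qed

end

section \<open>Multi-indices, levels, and maps determined by their values on units\<close>

section \<open>UHF systems\<close>

text \<open>Digits from position \<open>n\<close> on are \<open>undefined\<close>, so that the set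
  is finite and an index is lengthened by the update \<open>j(n := r)\<close>.\<close>

definition multi_index :: "(nat \<Rightarrow> nat) \<Rightarrow> nat \<Rightarrow> (nat \<Rightarrow> nat) set" where
  "multi_index a n = PiE {..<n} (\<lambda>i. {..<a i})"

text \<open>How the embeddings \<open>X \<mapsto> X \<otimes> 1\<close> act on matrix units.\<close>

definition compatible_units ::
  "(nat \<Rightarrow> nat) \<Rightarrow> (nat \<Rightarrow> (nat \<Rightarrow> nat) \<Rightarrow> (nat \<Rightarrow> nat) \<Rightarrow> 'b::comm_monoid_add) \<Rightarrow> bool" where
  "compatible_units a V \<longleftrightarrow> (\<forall>n. \<forall>j\<in>multi_index a n. \<forall>k\<in>multi_index a n.
     V n j k = (\<Sum>r<a n. V (Suc n) (j(n := r)) (k(n := r))))"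

abbreviation level_comb where
  "level_comb a V n \<equiv> unit_comb (multi_index a n) (V n)"

text \<open>Formulated through units alone, so that it covers an inductive limit of matrix algebras
  as well as a C*-tensor product of two of them.\<close>

definition uhf_units ::
  "(nat \<Rightarrow> nat) \<Rightarrow> (nat \<Rightarrow> (nat \<Rightarrow> nat) \<Rightarrow> (nat \<Rightarrow> nat) \<Rightarrow> 'a::cstar_algebra) \<Rightarrow> bool" where
  "uhf_units a u \<longleftrightarrow> (\<forall>n. matrix_units (multi_index a n) (u n)) \<and> compatible_units a u \<and>
     closure (\<Union>n. range (level_comb a u n)) = UNIV"

lemma finite_multi_index [simp]: "finite (multi_index a n)"
  by (simp add: multi_index_def finite_PiE)

lemma multi_index_undefined: "j \<in> multi_index a n \<Longrightarrow> j n = undefined"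
  by (auto simp: multi_index_def PiE_def extensional_def)

lemma multi_index_less: "j \<in> multi_index a n \<Longrightarrow> i < n \<Longrightarrow> j i < a i"
  by (auto simp: multi_index_def PiE_def Pi_def)

lemma multi_index_upd: "j \<in> multi_index a n \<Longrightarrow> r < a n \<Longrightarrow> j(n := r) \<in> multi_index a (Suc n)"
  unfolding multi_index_def lessThan_Suc by (rule PiE_fun_upd) auto

lemma sum_multi_index_Suc:
  "(\<Sum>j\<in>multi_index a (Suc n). f j) = (\<Sum>j\<in>multi_index a n. \<Sum>r<a n. f (j(n := r)))"
proof -
  have "(\<Sum>j\<in>multi_index a (Suc n). f j) = (\<Sum>(r, j)\<in>{..<a n} \<times> multi_index a n. f (j(n := r)))"
    unfolding multi_index_def lessThan_Suc PiE_insert_eq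
    by (subst sum.reindex[OF inj_combinator]) (auto simp: case_prod_unfold)
  also have "\<dots> = (\<Sum>r<a n. \<Sum>j\<in>multi_index a n. f (j(n := r)))"
    by (simp add: sum.cartesian_product)
  finally show ?thesis
    by (subst sum.swap)
qed

lemma sum_multi_index_prod:
  fixes f :: "nat \<Rightarrow> nat \<Rightarrow> 'r::comm_semiring_1"
  shows "(\<Sum>j\<in>multi_index a n. \<Prod>i<n. f i (j i)) = (\<Prod>i<n. \<Sum>r<a i. f i r)"
proof (induction n)
  case (Suc n)
  have "(\<Sum>j\<in>multi_index a (Suc n). \<Prod>i<Suc n. f i (j i)) =
    (\<Sum>j\<in>multi_index a n. (\<Prod>i<n. f i (j i)) * (\<Sum>r<a n. f n r))"
    unfolding sum_multi_index_Suc sum_distrib_left by (intro sum.cong refl) simp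
  then show ?case
    unfolding sum_distrib_right[symmetric] Suc by simp
qed (simp add: multi_index_def)

text \<open>These are the coefficients of X \<otimes> 1: the last digits must agree, and resetting
  them to \<open>undefined\<close> recovers the indices of length \<open>n\<close>.\<close>

lemma level_comb_Suc:
  assumes "compatible_units a V"
  shows "level_comb a V n x = level_comb a V (Suc n)
    (\<lambda>j k. if j n = k n then x (j(n := undefined)) (k(n := undefined)) else 0)"
    (is "_ = level_comb a V _ ?x'")
proof -
  have upd: "(j(n := r))(n := undefined) = j" if "j \<in> multi_index a n" for j r
    using multi_index_undefined[OF that] by auto
  have "level_comb a V (Suc n) ?x' = (\<Sum>j\<in>multi_index a n. \<Sum>r<a n. \<Sum>k\<in>multi_index a n. \<Sum>s<a n.
      if r = s then x j k *\<^sub>C V (Suc n) (j(n := r)) (k(n := s)) else 0)"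
    unfolding unit_comb_def sum_multi_index_Suc
    by (intro sum.cong refl) (simp add: upd del: fun_upd_upd)
  also have "\<dots> = (\<Sum>j\<in>multi_index a n. \<Sum>r<a n. \<Sum>k\<in>multi_index a n.
      x j k *\<^sub>C V (Suc n) (j(n := r)) (k(n := r)))"
    by (intro sum.cong refl) simp
  also have "\<dots> = (\<Sum>j\<in>multi_index a n. \<Sum>k\<in>multi_index a n. \<Sum>r<a n.
      x j k *\<^sub>C V (Suc n) (j(n := r)) (k(n := r)))"
    by (intro sum.cong refl sum.swap)
  also have "\<dots> = level_comb a V n x"
    unfolding unit_comb_def using assms
    by (intro sum.cong refl) (simp add: compatible_units_def complex_vector.scale_sum_right)
  finally show ?thesis ..
qed

text \<open>The coefficients in \<open>level_comb_Suc\<close> do not depend on the family, so one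
  \<open>y\<close> serves both families. Values assigned at different levels can therefore be
  compared at a common one.\<close>

lemma level_comb_lift:
  assumes "compatible_units a u" "compatible_units a V" "n \<le> m"
  obtains y where "level_comb a u n x = level_comb a u m y" "level_comb a V n x = level_comb a V m y"
proof -
  have "\<exists>y. level_comb a u n x = level_comb a u m y \<and> level_comb a V n x = level_comb a V m y"
    using assms(3)
  proof (induction m rule: dec_induct)
    case (step m)
    then obtain y where "level_comb a u n x = level_comb a u m y" "level_comb a V n x = level_comb a V m y"
      by blast
    then show ?case
      unfolding level_comb_Suc[OF assms(1), of m] level_comb_Suc[OF assms(2), of m] by blast
  qed blast
  then show ?thesis using that by blast
qed

text \<open>The graph consists of the pairs of combinations with the same level and coefficients. By
  \<open>norm_unit_comb_le\<close> it is contractive, and two pairs are added at the larger of their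
  levels.\<close>

lemma uhf_extend:
  fixes u :: "nat \<Rightarrow> (nat \<Rightarrow> nat) \<Rightarrow> (nat \<Rightarrow> nat) \<Rightarrow> 'a::cstar_algebra"
    and V :: "nat \<Rightarrow> (nat \<Rightarrow> nat) \<Rightarrow> (nat \<Rightarrow> nat) \<Rightarrow> 'b::complex_banach"
  assumes u: "uhf_units a u" and V: "compatible_units a V"
    and sq: "\<And>n x. (norm (level_comb a V n x))\<^sup>2 \<le> norm (level_comb a V n (gram (multi_index a n) x))"
  obtains f where "clinear f" "\<And>x. norm (f x) \<le> norm x"
    "\<And>n x. f (level_comb a u n x) = level_comb a V n x"
proof -
  have mu: "matrix_units (multi_index a n) (u n)" and comp: "compatible_units a u"
    and dense: "closure (\<Union>n. range (level_comb a u n)) = UNIV" for n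
    using u by (auto simp: uhf_units_def)
  show ?thesis
  proof (rule extend_dense_contraction[of
        "\<lambda>x y. \<exists>n z. x = level_comb a u n z \<and> y = level_comb a V n z"])
    fix x y x' y'
    assume "\<exists>n z. x = level_comb a u n z \<and> y = level_comb a V n z"
      "\<exists>n z. x' = level_comb a u n z \<and> y' = level_comb a V n z"
    then obtain n z m z' where
      "x = level_comb a u n z" "y = level_comb a V n z" "x' = level_comb a u m z'" "y' = level_comb a V m z'"
      by blast
    moreover obtain w where
      "level_comb a u n z = level_comb a u (max n m) w" "level_comb a V n z = level_comb a V (max n m) w"
      using level_comb_lift[OF comp V max.cobounded1] by metis
    moreover obtain w' where
      "level_comb a u m z' = level_comb a u (max n m) w'" "level_comb a V m z' = level_comb a V (max n m) w'"
      using level_comb_lift[OF comp V max.cobounded2] by metis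
    ultimately have "x + x' = level_comb a u (max n m) (\<lambda>j k. w j k + w' j k)"
      "y + y' = level_comb a V (max n m) (\<lambda>j k. w j k + w' j k)"
      by (simp_all add: unit_comb_add)
    then show "\<exists>n z. x + x' = level_comb a u n z \<and> y + y' = level_comb a V n z" by blast
  next
    fix c x y assume "\<exists>n z. x = level_comb a u n z \<and> y = level_comb a V n z"
    then obtain n z where "x = level_comb a u n z" "y = level_comb a V n z" by blast
    then have "c *\<^sub>C x = level_comb a u n (\<lambda>j k. c * z j k)" "c *\<^sub>C y = level_comb a V n (\<lambda>j k. c * z j k)"
      by (simp_all add: unit_comb_scale)
    then show "\<exists>n z. c *\<^sub>C x = level_comb a u n z \<and> c *\<^sub>C y = level_comb a V n z" by blast
  next
    fix x y assume "\<exists>n z. x = level_comb a u n z \<and> y = level_comb a V n z"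
    then show "norm y \<le> norm x"
      using norm_unit_comb_le[OF finite_multi_index mu sq] by auto
  next
    have "{x. \<exists>y n z. x = level_comb a u n z \<and> y = level_comb a V n z} = (\<Union>n. range (level_comb a u n))"
      by auto
    then show "closure {x. \<exists>y n z. x = level_comb a u n z \<and> y = level_comb a V n z} = UNIV"
      using dense by simp
  next
    fix f assume "clinear f" "\<And>x. norm (f x) \<le> norm x"
      "\<And>x y. \<exists>n z. x = level_comb a u n z \<and> y = level_comb a V n z \<Longrightarrow> f x = y"
    then show ?thesis using that by blast
  qed
qed

text \<open>Levels are nested, so both elements can be moved to a common level, where
  \<open>base\<close> applies; closedness then frees one variable after the other.\<close>

lemma uhf_dense_induct2:
  assumes u: "uhf_units a u" and v: "uhf_units b v"
    and closed: "\<And>x. closed {y. P x y}" "\<And>y. closed {x. P x y}"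
    and base: "\<And>n w z. P (level_comb a u n w) (level_comb b v n z)"
  shows "P x y"
proof -
  let ?S = "\<Union>n. range (level_comb a u n)" and ?R = "\<Union>n. range (level_comb b v n)"
  have comp: "compatible_units a u" "compatible_units b v"
    and dense: "closure ?S = UNIV" "closure ?R = UNIV"
    using u v by (auto simp: uhf_units_def)
  have *: "P x y" if x: "x \<in> ?S" and y: "y \<in> ?R" for x y
  proof -
    obtain n w m z where xy: "x = level_comb a u n w" "y = level_comb b v m z"
      using x y by auto
    obtain w' where "x = level_comb a u (max n m) w'"
      unfolding xy using level_comb_lift[OF comp(1,1) max.cobounded1] by metis
    moreover obtain z' where "y = level_comb b v (max n m) z'"
      unfolding xy using level_comb_lift[OF comp(2,2) max.cobounded2] by metis
    ultimately show ?thesis using base by simp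
  qed
  have **: "P x y" if "x \<in> ?S" for x y
    by (rule dense_induct[OF dense(2) closed(1)]) (rule *[OF that])
  show ?thesis
    by (rule dense_induct[OF dense(1) closed(2)]) (rule **)
qed

context
  fixes a :: "nat \<Rightarrow> nat" and u :: "nat \<Rightarrow> (nat \<Rightarrow> nat) \<Rightarrow> (nat \<Rightarrow> nat) \<Rightarrow> 'a::cstar_algebra"
  assumes u: "uhf_units a u"
begin

lemma uhf_mu: "matrix_units (multi_index a n) (u n)"
  and uhf_comp: "compatible_units a u"
  and uhf_dense: "closure (\<Union>n. range (level_comb a u n)) = UNIV"
  using u by (auto simp: uhf_units_def)

lemma uhf_eqI:
  fixes f g :: "'a \<Rightarrow> 'b::complex_banach"
  assumes "clinear f" "clinear g" "continuous_on UNIV f" "continuous_on UNIV g"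
    and "\<And>n j k. j \<in> multi_index a n \<Longrightarrow> k \<in> multi_index a n \<Longrightarrow> f (u n j k) = g (u n j k)"
  shows "f x = g x"
proof (rule dense_eqI[OF uhf_dense assms(3,4)])
  fix x assume "x \<in> (\<Union>n. range (level_comb a u n))"
  then obtain n z where x: "x = level_comb a u n z" by auto
  show "f x = g x"
    unfolding x clinear_unit_comb[OF assms(1)] clinear_unit_comb[OF assms(2)]
    by (rule unit_comb_cong) (rule assms(5))
qed

text \<open>For units the inequality required by \<open>uhf_extend\<close> is the C*-identity, with
  equality, so the exchange of units extends in both directions. The extensions are inverse to each
  other, and the algebraic identities pass from the levels to the limit.\<close>

lemma uhf_star_iso_exists:
  fixes v :: "nat \<Rightarrow> (nat \<Rightarrow> nat) \<Rightarrow> (nat \<Rightarrow> nat) \<Rightarrow> 'b::cstar_algebra"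
  assumes v: "uhf_units a v"
  obtains \<phi> where "star_iso \<phi>" "\<And>n x. \<phi> (level_comb a u n x) = level_comb a v n x"
proof -
  have mv: "matrix_units (multi_index a n) (v n)" and cv: "compatible_units a v"
    and dv: "closure (\<Union>n. range (level_comb a v n)) = UNIV" for n
    using v by (auto simp: uhf_units_def)
  obtain f where f: "clinear f" "\<And>x. norm (f x) \<le> norm x" "\<And>n x. f (level_comb a u n x) = level_comb a v n x"
    using uhf_extend[OF u cv]
    by (metis cstar_identity finite_multi_index mv order_refl unit_comb_gram)
  obtain g where g: "clinear g" "\<And>x. norm (g x) \<le> norm x" "\<And>n x. g (level_comb a v n x) = level_comb a u n x"
    using uhf_extend[OF v uhf_comp]
    by (metis cstar_identity finite_multi_index uhf_mu order_refl unit_comb_gram)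
  have cf: "continuous_on A (\<lambda>x. f (h x))" if "continuous_on A h" for A and h :: "'z::topological_space \<Rightarrow> 'a"
    using f(1,2) that by (rule clinear_contraction_continuous)
  have cg: "continuous_on A (\<lambda>x. g (h x))" if "continuous_on A h" for A and h :: "'z::topological_space \<Rightarrow> 'b"
    using g(1,2) that by (rule clinear_contraction_continuous)
  have gf: "g (f x) = x" for x
    by (rule dense_eqI[OF uhf_dense cg[OF cf[OF continuous_on_id]] continuous_on_id])
       (auto simp: f g)
  have fg: "f (g x) = x" for x
    by (rule dense_eqI[OF dv cf[OF cg[OF continuous_on_id]] continuous_on_id])
       (auto simp: f g)
  have "f (star x) = star (f x)" for x
  proof (rule dense_eqI[OF uhf_dense, where f = "\<lambda>x. f (star x)"])
    fix x assume "x \<in> (\<Union>n. range (level_comb a u n))"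
    then show "f (star x) = star (f x)"
      by (auto simp: f unit_comb_star[OF finite_multi_index uhf_mu] unit_comb_star[OF finite_multi_index mv])
  qed (intro cf continuous_intros)+
  moreover have "f (x * y) = f x * f y" for x y
  proof (rule uhf_dense_induct2[OF u u])
    show "closed {y. f (x * y) = f x * f y}" "closed {x. f (x * y) = f x * f y}" for x y
      by (intro closed_Collect_eq cf continuous_intros)+
  qed (simp add: f unit_comb_mult[OF finite_multi_index uhf_mu] unit_comb_mult[OF finite_multi_index mv])
  moreover have "bij f"
    by (rule o_bij[of g]) (auto simp: gf fg)
  ultimately show ?thesis
    using that f by (auto simp: star_iso_def)
qed

end

section \<open>Existence and uniqueness of product states\<close>

section \<open>Product states\<close>

text \<open>Formulated for any system of units because it is also applied to the products of units
  in a C*-tensor product.\<close>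

definition is_product_state where
  "is_product_state a u T \<omega> \<longleftrightarrow> is_state \<omega> \<and>
     (\<forall>n. \<forall>j\<in>multi_index a n. \<forall>k\<in>multi_index a n. \<omega> (u n j k) = (\<Prod>i<n. T i $$ (k i, j i)))"

lemma is_product_state_unique:
  assumes "uhf_units a u" "is_product_state a u T \<omega>" "is_product_state a u T \<omega>'"
  shows "\<omega> = \<omega>'"
proof
  fix x
  show "\<omega> x = \<omega>' x"
    by (rule uhf_eqI[OF assms(1)])
       (use assms(2,3) state_continuous[OF _ continuous_on_id] in
         \<open>auto simp: is_product_state_def is_state_def\<close>)
qed

text \<open>Each \<open>T i\<close> is a sum of rank-one matrices, so at each level the functional
  is a sum of vector functionals, whose vectors are tensor products of those in the decompositions.
  Their squared lengths add up to 1, so Cauchy-Schwarz yields the inequality required by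
  \<open>uhf_extend\<close>.\<close>

lemma is_product_state_exists:
  fixes u :: "nat \<Rightarrow> (nat \<Rightarrow> nat) \<Rightarrow> (nat \<Rightarrow> nat) \<Rightarrow> 'a::cstar_algebra"
    and W :: "nat \<Rightarrow> nat \<Rightarrow> nat \<Rightarrow> complex"
  assumes u: "uhf_units a u"
    and W: "\<And>i k j. k < a i \<Longrightarrow> j < a i \<Longrightarrow> T i $$ (k, j) = (\<Sum>r<a i. W i r k * cnj (W i r j))"
    and tr: "\<And>i. (\<Sum>r<a i. T i $$ (r, r)) = 1"
  shows "\<exists>\<omega>. is_product_state a u T \<omega>"
proof -
  let ?I = "multi_index a"
  \<comment> \<open>Here \<open>\<tau>\<close> gives the prescribed values on units,
    \<open>w n \<rho>\<close> is the tensor product of the vectors \<open>W i (\<rho> i)\<close>,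
    and \<open>y n x \<rho>\<close> is the matrix \<open>x\<close> applied to
    \<open>w n \<rho>\<close>.\<close>
  define \<tau> where "\<tau> n j k = (\<Prod>i<n. T i $$ (k i, j i))" for n and j k :: "nat \<Rightarrow> nat"
  define w where "w n \<rho> k = (\<Prod>i<n. W i (\<rho> i) (k i))" for n and \<rho> k :: "nat \<Rightarrow> nat"
  define y where "y n x \<rho> j = (\<Sum>k\<in>?I n. x j k * w n \<rho> k)" for n x \<rho> and j :: "nat \<Rightarrow> nat"
  have prod_upd: "(\<Prod>i<n. f i ((j(n := r)) i) ((k(n := s)) i)) = (\<Prod>i<n. f i (j i) (k i))"
    for n r s and j k :: "nat \<Rightarrow> nat" and f :: "nat \<Rightarrow> nat \<Rightarrow> nat \<Rightarrow> complex"
    by (intro prod.cong) auto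
  have \<tau>: "\<tau> n j k = (\<Sum>\<rho>\<in>?I n. w n \<rho> k * cnj (w n \<rho> j))" if "j \<in> ?I n" "k \<in> ?I n" for n j k
  proof -
    have "\<tau> n j k = (\<Prod>i<n. \<Sum>r<a i. W i r (k i) * cnj (W i r (j i)))"
      unfolding \<tau>_def using that by (intro prod.cong refl W) (auto intro: multi_index_less)
    also have "\<dots> = (\<Sum>\<rho>\<in>?I n. w n \<rho> k * cnj (w n \<rho> j))"
      unfolding w_def by (subst sum_multi_index_prod[symmetric]) (simp add: prod.distrib)
    finally show ?thesis .
  qed
  \<comment> \<open>Trace one makes the values invariant under the embeddings X \<mapsto> X
    \<otimes> 1.\<close>
  have comp: "compatible_units a \<tau>"
    unfolding compatible_units_def
  proof (intro allI ballI)
    fix n j k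
    have "(\<Sum>r<a n. \<tau> (Suc n) (j(n := r)) (k(n := r))) = (\<Sum>r<a n. \<tau> n j k * T n $$ (r, r))"
      by (intro sum.cong refl) (simp add: \<tau>_def prod_upd[of "\<lambda>i p q. T i $$ (q, p)"])
    then show "\<tau> n j k = (\<Sum>r<a n. \<tau> (Suc n) (j(n := r)) (k(n := r)))"
      by (simp add: sum_distrib_left[symmetric] tr)
  qed
  have val: "level_comb a \<tau> n x = (\<Sum>\<rho>\<in>?I n. \<Sum>j\<in>?I n. cnj (w n \<rho> j) * y n x \<rho> j)" for n x
  proof -
    have "level_comb a \<tau> n x = (\<Sum>j\<in>?I n. \<Sum>k\<in>?I n. \<Sum>\<rho>\<in>?I n. cnj (w n \<rho> j) * (x j k * w n \<rho> k))"
      unfolding unit_comb_def scaleC_complex_def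
      by (intro sum.cong refl) (simp add: \<tau> sum_distrib_left mult_ac)
    also have "\<dots> = (\<Sum>j\<in>?I n. \<Sum>\<rho>\<in>?I n. \<Sum>k\<in>?I n. cnj (w n \<rho> j) * (x j k * w n \<rho> k))"
      by (intro sum.cong refl sum.swap)
    also have "\<dots> = (\<Sum>\<rho>\<in>?I n. \<Sum>j\<in>?I n. \<Sum>k\<in>?I n. cnj (w n \<rho> j) * (x j k * w n \<rho> k))"
      by (rule sum.swap)
    finally show ?thesis by (simp add: y_def sum_distrib_left)
  qed
  \<comment> \<open>The value at \<open>star X * X\<close> is the total squared length of the
    vectors \<open>y n x \<rho>\<close>. It serves for positivity and as one factor in
    Cauchy-Schwarz.\<close>
  have gram: "level_comb a \<tau> n (gram (?I n) x) = of_real (\<Sum>\<rho>\<in>?I n. \<Sum>i\<in>?I n. (cmod (y n x \<rho> i))\<^sup>2)" for n x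
  proof -
    have "(\<Sum>j\<in>?I n. cnj (w n \<rho> j) * y n (gram (?I n) x) \<rho> j) = (\<Sum>i\<in>?I n. y n x \<rho> i * cnj (y n x \<rho> i))" for \<rho>
    proof -
      have "y n (gram (?I n) x) \<rho> j = (\<Sum>i\<in>?I n. cnj (x i j) * y n x \<rho> i)" for j
        unfolding y_def gram_def sum_distrib_left sum_distrib_right
        by (subst sum.swap) (simp add: mult_ac)
      then have "(\<Sum>j\<in>?I n. cnj (w n \<rho> j) * y n (gram (?I n) x) \<rho> j) =
        (\<Sum>j\<in>?I n. \<Sum>i\<in>?I n. y n x \<rho> i * (cnj (x i j) * cnj (w n \<rho> j)))"
        by (simp add: sum_distrib_left mult_ac)
      also have "\<dots> = (\<Sum>i\<in>?I n. \<Sum>j\<in>?I n. y n x \<rho> i * (cnj (x i j) * cnj (w n \<rho> j)))"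
        by (rule sum.swap)
      also have "\<dots> = (\<Sum>i\<in>?I n. y n x \<rho> i * cnj (y n x \<rho> i))"
        by (simp add: y_def sum_distrib_left)
      finally show ?thesis .
    qed
    then show ?thesis
      unfolding val by (simp add: complex_norm_square del: of_real_power)
  qed
  have w1: "(\<Sum>\<rho>\<in>?I n. \<Sum>j\<in>?I n. (cmod (w n \<rho> j))\<^sup>2) = 1" for n
  proof -
    have "complex_of_real (\<Sum>\<rho>\<in>?I n. \<Sum>j\<in>?I n. (cmod (w n \<rho> j))\<^sup>2) = (\<Sum>j\<in>?I n. \<tau> n j j)"
      by (subst sum.swap) (simp add: \<tau> complex_norm_square[symmetric] cong: sum.cong)
    also have "\<dots> = (\<Prod>i<n. \<Sum>r<a i. T i $$ (r, r))"
      unfolding \<tau>_def by (rule sum_multi_index_prod[of "\<lambda>i r. T i $$ (r, r)"])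
    also have "\<dots> = complex_of_real 1" by (simp add: tr)
    finally show ?thesis by (simp only: of_real_eq_iff)
  qed
  have sq: "(norm (level_comb a \<tau> n x))\<^sup>2 \<le> norm (level_comb a \<tau> n (gram (?I n) x))" for n x
  proof -
    let ?P = "?I n \<times> ?I n"
    have "norm (level_comb a \<tau> n x) \<le> (\<Sum>(\<rho>, j)\<in>?P. cmod (w n \<rho> j) * cmod (y n x \<rho> j))"
      unfolding val sum.cartesian_product
      by (intro order.trans[OF norm_sum] sum_mono) (auto simp: norm_mult)
    then have "(norm (level_comb a \<tau> n x))\<^sup>2 \<le> (\<Sum>(\<rho>, j)\<in>?P. cmod (w n \<rho> j) * cmod (y n x \<rho> j))\<^sup>2"
      by (intro power_mono) auto
    also have "\<dots> \<le> (\<Sum>(\<rho>, j)\<in>?P. (cmod (w n \<rho> j))\<^sup>2) * (\<Sum>(\<rho>, j)\<in>?P. (cmod (y n x \<rho> j))\<^sup>2)"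
      unfolding case_prod_unfold by (rule Cauchy_Schwarz_ineq_sum)
    also have "\<dots> = norm (level_comb a \<tau> n (gram (?I n) x))"
      unfolding gram norm_of_real sum.cartesian_product[symmetric] w1 by (simp add: sum_nonneg)
    finally show ?thesis .
  qed
  obtain \<omega> where \<omega>: "clinear \<omega>" "\<And>x. norm (\<omega> x) \<le> norm x" "\<And>n x. \<omega> (level_comb a u n x) = level_comb a \<tau> n x"
    using uhf_extend[OF u comp sq] by metis
  have unit: "\<omega> (u n j k) = \<tau> n j k" if "j \<in> ?I n" "k \<in> ?I n" for n j k
    using \<omega>(3)[of n "\<lambda>p q. if p = j \<and> q = k then 1 else 0"] that by (simp add: unit_comb_delta)
  have "\<omega> 1 = 1"
  proof -
    \<comment> \<open>Level 0 has a single multi-index, the constant \<open>undefined\<close>, and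
      it labels the unit \<open>1\<close>.\<close>
    have "(1::'a) = u 0 (\<lambda>_. undefined) (\<lambda>_. undefined)"
      using uhf_mu[OF u, of 0] by (simp add: matrix_units_def multi_index_def)
    then show ?thesis
      using unit[of "\<lambda>_. undefined" 0 "\<lambda>_. undefined"] by (simp add: \<tau>_def multi_index_def)
  qed
  moreover have "0 \<le> \<omega> (star x * x)" for x
  proof (rule dense_induct[OF uhf_dense[OF u], where P = "\<lambda>x. 0 \<le> \<omega> (star x * x)"])
    have c: "continuous_on UNIV (\<lambda>x. \<omega> (star x * x))"
      by (intro clinear_contraction_continuous[OF \<omega>(1,2)] continuous_intros)
    have "{x. 0 \<le> \<omega> (star x * x)} = {x. 0 \<le> Re (\<omega> (star x * x))} \<inter> {x. Im (\<omega> (star x * x)) = 0}"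
      by (auto simp: less_eq_complex_def)
    then show "closed {x. 0 \<le> \<omega> (star x * x)}"
      by (auto intro!: closed_Int closed_Collect_le closed_Collect_eq continuous_intros c)
  next
    fix x assume "x \<in> (\<Union>n. range (level_comb a u n))"
    then obtain n z where "x = level_comb a u n z" by auto
    then have "\<omega> (star x * x) = level_comb a \<tau> n (gram (?I n) z)"
      by (simp add: unit_comb_gram[OF finite_multi_index uhf_mu[OF u]] \<omega>)
    then show "0 \<le> \<omega> (star x * x)"
      unfolding gram by (simp add: less_eq_complex_def sum_nonneg)
  qed
  ultimately show ?thesis
    using \<omega>(1) unit by (auto simp: is_product_state_def is_state_def \<tau>_def)
qed

section \<open>C*-tensor products and their matrix units\<close>

section \<open>Tensor products\<close>

context
  fixes t :: "'a::cstar_algebra \<Rightarrow> 'b::cstar_algebra \<Rightarrow> 'd::cstar_algebra"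
  assumes t: "cstar_tensor t"
begin

lemma ct_clinear: "clinear (t x)" "clinear (\<lambda>x. t x y)"
  and ct_mult: "t x y * t x' y' = t (x * x') (y * y')"
  and ct_star: "star (t x y) = t (star x) (star y)"
  and ct_dense: "closure (cspan (range (\<lambda>(x, y). t x y))) = UNIV"
  using t by (auto simp: cstar_tensor_def cbilinear_def)

lemma ct_sum: "t (\<Sum>p\<in>A. f p) (\<Sum>q\<in>B. g q) = (\<Sum>p\<in>A. \<Sum>q\<in>B. t (f p) (g q))"
proof -
  have "t (\<Sum>p\<in>A. f p) (\<Sum>q\<in>B. g q) = (\<Sum>p\<in>A. t (f p) (\<Sum>q\<in>B. g q))"
    by (rule clinear_sum[OF ct_clinear(2)])
  then show ?thesis
    by (simp only: clinear_sum[OF ct_clinear(1)])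
qed

text \<open>The element \<open>t 1 1\<close> acts as a left unit on elementary tensors, hence by
  density everywhere, in particular on \<open>1\<close>.\<close>

lemma ct_one: "t 1 1 = 1"
proof -
  have "t 1 1 * z = z" for z
  proof (rule clinear_eq_on_dense_span[OF _ _ _ _ ct_dense, where f = "\<lambda>z. t 1 1 * z"])
    show "clinear (\<lambda>z. t 1 1 * z)"
      by (simp add: clinear_iff algebra_simps mult_scaleC_right)
  qed (auto simp: clinear_iff ct_mult intro!: continuous_intros)
  from this[of 1] show ?thesis by simp
qed

text \<open>Both \<open>\<lambda>x. t x 1\<close> and \<open>t 1\<close> are unital *-homomorphisms,
  hence contractive, and \<open>t x y\<close> is the product of \<open>t x 1\<close> and
  \<open>t 1 y\<close>.\<close>

lemma ct_norm_le: "norm (t x y) \<le> norm x * norm y"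
proof -
  have "norm (t x 1) \<le> norm x"
    by (rule star_hom_contractive[where f = "\<lambda>x. t x 1"])
       (simp_all add: ct_clinear ct_mult ct_star ct_one)
  moreover have "norm (t 1 y) \<le> norm y"
    by (rule star_hom_contractive) (simp_all add: ct_clinear ct_mult ct_star ct_one)
  moreover have "norm (t x y) \<le> norm (t x 1) * norm (t 1 y)"
    using norm_mult_ineq[of "t x 1" "t 1 y"] by (simp add: ct_mult)
  ultimately show ?thesis
    by (meson mult_mono norm_ge_zero order_trans)
qed

lemma ct_continuous:
  assumes "continuous_on A f" "continuous_on A g"
  shows "continuous_on A (\<lambda>z. t (f z) (g z))"
proof -
  have "bounded_bilinear t"
    by (standard; (intro exI[of _ 1])?)
       (auto simp: scaleR_scaleC ct_norm_le clinear_add[OF ct_clinear(1)] clinear_add[OF ct_clinear(2)]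
         clinear_scale[OF ct_clinear(1)] clinear_scale[OF ct_clinear(2)])
  then show ?thesis using assms by (rule bounded_bilinear.continuous_on)
qed

end

text \<open>The digits of \<open>j\<^sub>i = b\<^sub>i j'\<^sub>i + j''\<^sub>i\<close>: \<open>quo\<close> is \<open>j'\<close>, \<open>rmd\<close> is \<open>j''\<close> and \<open>join\<close> is the inverse.\<close>

definition quo :: "(nat \<Rightarrow> nat) \<Rightarrow> nat \<Rightarrow> (nat \<Rightarrow> nat) \<Rightarrow> nat \<Rightarrow> nat" where
  "quo b n j = restrict (\<lambda>i. j i div b i) {..<n}"

definition rmd :: "(nat \<Rightarrow> nat) \<Rightarrow> nat \<Rightarrow> (nat \<Rightarrow> nat) \<Rightarrow> nat \<Rightarrow> nat" where
  "rmd b n j = restrict (\<lambda>i. j i mod b i) {..<n}"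

definition join :: "(nat \<Rightarrow> nat) \<Rightarrow> nat \<Rightarrow> (nat \<Rightarrow> nat) \<Rightarrow> (nat \<Rightarrow> nat) \<Rightarrow> nat \<Rightarrow> nat" where
  "join b n p q = restrict (\<lambda>i. b i * p i + q i) {..<n}"

text \<open>The images that \<phi> has to give to the units of the algebra for
  \<open>seq_mult a b\<close>.\<close>

definition tensor_units where
  "tensor_units b t u v n j k = t (u n (quo b n j) (quo b n k)) (v n (rmd b n j) (rmd b n k))"

abbreviation (input) seq_mult :: "(nat \<Rightarrow> nat) \<Rightarrow> (nat \<Rightarrow> nat) \<Rightarrow> nat \<Rightarrow> nat" where
  "seq_mult a b \<equiv> \<lambda>n. a n * b n"

lemma digit_less: "p < (a::nat) \<Longrightarrow> q < b \<Longrightarrow> b * p + q < a * b"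
  using mult_le_mono1[of "Suc p" a b] by (simp add: mult.commute)

lemma quo_in: "j \<in> multi_index (seq_mult a b) n \<Longrightarrow> quo b n j \<in> multi_index a n"
  by (auto simp: multi_index_def quo_def intro!: less_mult_imp_div_less)

lemma rmd_in: "j \<in> multi_index (seq_mult a b) n \<Longrightarrow> rmd b n j \<in> multi_index b n"
proof -
  assume j: "j \<in> multi_index (seq_mult a b) n"
  have "j i mod b i < b i" if "i < n" for i
    using multi_index_less[OF j that] by (intro mod_less_divisor) (auto intro: gr0I)
  then show ?thesis
    by (auto simp: multi_index_def rmd_def)
qed

lemma join_in:
  "p \<in> multi_index a n \<Longrightarrow> q \<in> multi_index b n \<Longrightarrow> join b n p q \<in> multi_index (seq_mult a b) n"
  by (auto simp: multi_index_def join_def PiE_def Pi_def intro!: digit_less)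

lemma quo_join: "p \<in> multi_index a n \<Longrightarrow> q \<in> multi_index b n \<Longrightarrow> quo b n (join b n p q) = p"
  by (rule ext) (auto simp: quo_def join_def multi_index_def PiE_def extensional_def Pi_def)

lemma rmd_join: "p \<in> multi_index a n \<Longrightarrow> q \<in> multi_index b n \<Longrightarrow> rmd b n (join b n p q) = q"
  by (rule ext) (auto simp: rmd_def join_def multi_index_def PiE_def extensional_def Pi_def)

lemma join_quo_rmd: "j \<in> multi_index (seq_mult a b) n \<Longrightarrow> join b n (quo b n j) (rmd b n j) = j"
  by (rule ext) (auto simp: quo_def rmd_def join_def multi_index_def PiE_def extensional_def)

lemma quo_rmd_eq_iff:
  "j \<in> multi_index (seq_mult a b) n \<Longrightarrow> k \<in> multi_index (seq_mult a b) n \<Longrightarrow>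
    j = k \<longleftrightarrow> quo b n j = quo b n k \<and> rmd b n j = rmd b n k"
  by (metis join_quo_rmd)

lemma quo_upd: "quo b (Suc n) (j(n := r)) = (quo b n j)(n := r div b n)"
  by (rule ext) (auto simp: quo_def less_Suc_eq)

lemma rmd_upd: "rmd b (Suc n) (j(n := r)) = (rmd b n j)(n := r mod b n)"
  by (rule ext) (auto simp: rmd_def less_Suc_eq)

lemma sum_quo_rmd:
  "(\<Sum>j\<in>multi_index (seq_mult a b) n. f (quo b n j) (rmd b n j)) =
    (\<Sum>p\<in>multi_index a n. \<Sum>q\<in>multi_index b n. f p q)"
  unfolding sum.cartesian_product
  by (rule sum.reindex_bij_witness[where i = "\<lambda>(p, q). join b n p q" and j = "\<lambda>j. (quo b n j, rmd b n j)"])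
     (auto simp: quo_in rmd_in join_in quo_join rmd_join join_quo_rmd)

lemma sum_div_mod:
  "(\<Sum>r<a * b. f (r div b) (r mod b)) = (\<Sum>p<a. \<Sum>q<(b::nat). f p q)"
proof -
  have "r mod b < b" if "r < a * b" for r
    using that by (cases "b = 0") auto
  then show ?thesis
    unfolding sum.cartesian_product
    by (intro sum.reindex_bij_witness[where i = "\<lambda>(p, q). b * p + q" and j = "\<lambda>r. (r div b, r mod b)"])
       (auto simp: less_mult_imp_div_less digit_less)
qed

lemma subspace_level_combs:
  assumes "compatible_units a V"
  shows "complex_vector.subspace (\<Union>n. range (level_comb a V n))"
proof (rule complex_vector.subspaceI)
  show "0 \<in> (\<Union>n. range (level_comb a V n))"
    by (intro UN_I[of 0] image_eqI[of _ _ "\<lambda>_ _. 0"]) (auto simp: unit_comb_def)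
next
  fix x y assume "x \<in> (\<Union>n. range (level_comb a V n))" "y \<in> (\<Union>n. range (level_comb a V n))"
  then obtain n w m z where xy: "x = level_comb a V n w" "y = level_comb a V m z" by auto
  obtain w' where "x = level_comb a V (max n m) w'"
    unfolding xy using level_comb_lift[OF assms assms max.cobounded1] by metis
  moreover obtain z' where "y = level_comb a V (max n m) z'"
    unfolding xy using level_comb_lift[OF assms assms max.cobounded2] by metis
  ultimately have "x + y = level_comb a V (max n m) (\<lambda>j k. w' j k + z' j k)"
    by (simp add: unit_comb_add)
  then show "x + y \<in> (\<Union>n. range (level_comb a V n))" by blast
next
  fix c x assume "x \<in> (\<Union>n. range (level_comb a V n))"
  then obtain n w where "x = level_comb a V n w" by auto
  then have "c *\<^sub>C x = level_comb a V n (\<lambda>j k. c * w j k)"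
    by (simp add: unit_comb_scale)
  then show "c *\<^sub>C x \<in> (\<Union>n. range (level_comb a V n))" by blast
qed

text \<open>The relations hold factor by factor, since splitting the digits is a bijection of
  multi-indices. For density, the tensor of two level combinations is a level combination with
  product coefficients, so the closure of the levels contains every \<open>t x y\<close>, and these
  span a dense subspace.\<close>

lemma uhf_units_tensor:
  fixes t :: "'a::cstar_algebra \<Rightarrow> 'b::cstar_algebra \<Rightarrow> 'd::cstar_algebra"
  assumes t: "cstar_tensor t" and u: "uhf_units a u" and v: "uhf_units b v"
  shows "uhf_units (seq_mult a b) (tensor_units b t u v)"
proof -
  let ?w = "tensor_units b t u v" and ?ab = "seq_mult a b"
  note mu = uhf_mu[OF u] and mv = uhf_mu[OF v]
  note tu = ct_clinear[OF t] ct_mult[OF t] ct_star[OF t]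
  have mw: "matrix_units (multi_index ?ab n) (?w n)" for n
    unfolding matrix_units_def
  proof (intro conjI ballI)
    fix i j k l
    assume "i \<in> multi_index ?ab n" "j \<in> multi_index ?ab n" "k \<in> multi_index ?ab n" "l \<in> multi_index ?ab n"
    \<comment> \<open>If the middle indices differ, then at least one of their two parts differs,
      and a zero factor makes the tensor vanish.\<close>
    then show "?w n i j * ?w n k l = (if j = k then ?w n i l else 0)"
      using clinear_zero[OF tu(1)] clinear_zero[OF tu(2)]
      by (simp add: tensor_units_def tu mu_mult[OF finite_multi_index mu] mu_mult[OF finite_multi_index mv]
          quo_in rmd_in quo_rmd_eq_iff)
  next
    fix i j assume "i \<in> multi_index ?ab n" "j \<in> multi_index ?ab n"
    then show "star (?w n i j) = ?w n j i"
      by (simp add: tensor_units_def tu mu_star[OF finite_multi_index mu] mu_star[OF finite_multi_index mv]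
          quo_in rmd_in)
  next
    have "(\<Sum>i\<in>multi_index ?ab n. ?w n i i) = t (\<Sum>p\<in>multi_index a n. u n p p) (\<Sum>q\<in>multi_index b n. v n q q)"
      unfolding ct_sum[OF t] tensor_units_def
      by (rule sum_quo_rmd)
    then show "(\<Sum>i\<in>multi_index ?ab n. ?w n i i) = 1"
      by (simp add: mu_sum[OF finite_multi_index mu] mu_sum[OF finite_multi_index mv] ct_one[OF t])
  qed
  have comp: "compatible_units ?ab ?w"
    unfolding compatible_units_def
  proof (intro allI ballI)
    fix n j k assume jk: "j \<in> multi_index ?ab n" "k \<in> multi_index ?ab n"
    have "?w n j k = t (\<Sum>p<a n. u (Suc n) ((quo b n j)(n := p)) ((quo b n k)(n := p)))
        (\<Sum>q<b n. v (Suc n) ((rmd b n j)(n := q)) ((rmd b n k)(n := q)))"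
      using uhf_comp[OF u] uhf_comp[OF v] jk
      by (simp add: tensor_units_def compatible_units_def quo_in rmd_in)
    also have "\<dots> = (\<Sum>r<a n * b n. ?w (Suc n) (j(n := r)) (k(n := r)))"
      unfolding ct_sum[OF t] tensor_units_def quo_upd rmd_upd
      by (rule sum_div_mod[symmetric])
    finally show "?w n j k = (\<Sum>r<a n * b n. ?w (Suc n) (j(n := r)) (k(n := r)))" .
  qed
  let ?S = "\<Union>n. range (level_comb ?ab ?w n)"
  have "t x y \<in> closure ?S" for x y
  proof (rule uhf_dense_induct2[OF u v, where P = "\<lambda>x y. t x y \<in> closure ?S"])
    show "closed {y. t x y \<in> closure ?S}" for x
      using closed_vimage[OF closed_closure ct_continuous[OF t continuous_on_const continuous_on_id]]
      by (simp add: vimage_def)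
    show "closed {x. t x y \<in> closure ?S}" for y
      using closed_vimage[OF closed_closure ct_continuous[OF t continuous_on_id continuous_on_const]]
      by (simp add: vimage_def)
    fix n w z
    have "t (level_comb a u n w) (level_comb b v n z) = (\<Sum>p\<in>multi_index a n. \<Sum>q\<in>multi_index b n.
        \<Sum>p'\<in>multi_index a n. \<Sum>q'\<in>multi_index b n. (w p p' * z q q') *\<^sub>C t (u n p p') (v n q q'))"
      unfolding unit_comb_def ct_sum[OF t]
      by (simp add: clinear_scale[OF tu(1)] clinear_scale[OF tu(2)] mult.commute)
    also have "\<dots> = level_comb ?ab ?w n (\<lambda>j k. w (quo b n j) (quo b n k) * z (rmd b n j) (rmd b n k))"
      unfolding unit_comb_def tensor_units_def sum_quo_rmd[where a = a and b = b, symmetric] ..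
    finally show "t (level_comb a u n w) (level_comb b v n z) \<in> closure ?S"
      using closure_subset[of ?S] by auto
  qed
  then have "range (\<lambda>(x, y). t x y) \<subseteq> closure ?S" by auto
  from closure_cspan_subset[OF subspace_level_combs[OF comp] this]
  have "closure ?S = UNIV"
    unfolding ct_dense[OF t] by auto
  then show ?thesis
    using mw comp by (simp add: uhf_units_def)
qed

section \<open>Matrix units under *-homomorphisms, mixed-radix indices, and the units of a UHF
  algebra\<close>

section \<open>Matrices\<close>

lemma mat_unit_carrier [simp]: "mat_unit n i j \<in> carrier_mat n n"
  by (simp add: mat_unit_def)

lemma mat_unit_mult:
  assumes "j < n" "k < n"
  shows "mat_unit n i j * mat_unit n k l = (if j = k then mat_unit n i l else 0\<^sub>m n n)"
  using assms
  by (intro eq_matI)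
     (auto simp: mat_unit_def scalar_prod_def if_distrib[of "\<lambda>x. x * _"] sum.If_cases
       atLeast0LessThan intro!: sum.neutral)

lemma mat_unit_adjoint: "i < n \<Longrightarrow> j < n \<Longrightarrow> mat_adjoint (mat_unit n i j) = mat_unit n j i"
  by (intro eq_matI) (auto simp: mat_unit_def mat_adjoint_def mat_of_rows_def)

lemma mat_unit_sandwich:
  assumes "X \<in> carrier_mat n n" "i < n" "j < n"
  shows "mat_unit n i i * X * mat_unit n j j = X $$ (i, j) \<cdot>\<^sub>m mat_unit n i j"
proof (rule eq_matI)
  fix r s assume "r < dim_row (X $$ (i, j) \<cdot>\<^sub>m mat_unit n i j)" "s < dim_col (X $$ (i, j) \<cdot>\<^sub>m mat_unit n i j)"
  then have rs: "r < n" "s < n" by (auto simp: mat_unit_def)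
  have left: "(mat_unit n i i * X) $$ (r, q) = (if r = i then X $$ (i, q) else 0)" if "q < n" for q
  proof -
    have "(mat_unit n i i * X) $$ (r, q) = (\<Sum>p<n. mat_unit n i i $$ (r, p) * X $$ (p, q))"
      using assms rs that by (simp add: mat_unit_def scalar_prod_def atLeast0LessThan)
    also have "\<dots> = (\<Sum>p<n. if p = i then (if r = i then X $$ (i, q) else 0) else 0)"
      by (intro sum.cong refl) (use rs in \<open>simp add: mat_unit_def\<close>)
    finally show ?thesis using assms by simp
  qed
  have "(mat_unit n i i * X * mat_unit n j j) $$ (r, s) =
      (\<Sum>q<n. (mat_unit n i i * X) $$ (r, q) * mat_unit n j j $$ (q, s))"
    using assms rs
    by (subst index_mult_mat) (auto simp: mat_unit_def scalar_prod_def atLeast0LessThan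
          simp del: index_mult_mat(1))
  also have "\<dots> = (\<Sum>q<n. if q = j then (if r = i \<and> s = j then X $$ (i, q) else 0) else 0)"
    by (intro sum.cong refl) (use rs in \<open>simp add: left, simp add: mat_unit_def\<close>)
  finally have "(mat_unit n i i * X * mat_unit n j j) $$ (r, s) =
      (\<Sum>q<n. if q = j then (if r = i \<and> s = j then X $$ (i, q) else 0) else 0)" .
  then show "(mat_unit n i i * X * mat_unit n j j) $$ (r, s) = (X $$ (i, j) \<cdot>\<^sub>m mat_unit n i j) $$ (r, s)"
    using assms rs by (simp add: mat_unit_def)
qed (use assms in \<open>auto simp: mat_unit_def\<close>)

context
  fixes N :: nat and h :: "complex mat \<Rightarrow> 'a::cstar_algebra"
  assumes h: "mat_star_hom N h"
begin

lemma hom_add: "X \<in> carrier_mat N N \<Longrightarrow> Y \<in> carrier_mat N N \<Longrightarrow> h (X + Y) = h X + h Y"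
  and hom_mult: "X \<in> carrier_mat N N \<Longrightarrow> Y \<in> carrier_mat N N \<Longrightarrow> h (X * Y) = h X * h Y"
  and hom_scale: "X \<in> carrier_mat N N \<Longrightarrow> h (c \<cdot>\<^sub>m X) = c *\<^sub>C h X"
  and hom_adjoint: "X \<in> carrier_mat N N \<Longrightarrow> h (mat_adjoint X) = star (h X)"
  and hom_one: "h (1\<^sub>m N) = 1"
  using h by (auto simp: mat_star_hom_def)

lemma hom_zero: "h (0\<^sub>m N N) = 0"
proof -
  have "h (0 \<cdot>\<^sub>m 0\<^sub>m N N) = 0"
    by (subst hom_scale) auto
  moreover have "(0::complex) \<cdot>\<^sub>m 0\<^sub>m N N = 0\<^sub>m N N"
    by (intro eq_matI) auto
  ultimately show ?thesis by simp
qed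

lemma hom_sum_units: "(\<Sum>i<N. h (mat_unit N i i)) = 1"
proof -
  \<comment> \<open>The diagonal matrix with \<open>k\<close> leading ones; adding one unit at a
    time leads from zero to the identity.\<close>
  let ?D = "\<lambda>k. mat N N (\<lambda>(r, s). if r = s \<and> r < k then 1 else 0) :: complex mat"
  have "k \<le> N \<Longrightarrow> h (?D k) = (\<Sum>i<k. h (mat_unit N i i))" for k
  proof (induction k)
    case 0
    have "h (?D 0) = h (0\<^sub>m N N)"
      by (intro arg_cong[where f = h] eq_matI) auto
    then show ?case by (simp only: hom_zero lessThan_0 sum.empty)
  next
    case (Suc k)
    have "?D (Suc k) = ?D k + mat_unit N k k"
      by (intro eq_matI) (auto simp: mat_unit_def less_Suc_eq)
    then have "h (?D (Suc k)) = h (?D k) + h (mat_unit N k k)"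
      by (simp add: hom_add)
    then show ?case using Suc by simp
  qed
  from this[OF order_refl] have "h (?D N) = (\<Sum>i<N. h (mat_unit N i i))" .
  moreover have "h (?D N) = h (1\<^sub>m N)"
    by (intro arg_cong[where f = h] eq_matI) auto
  ultimately show ?thesis by (simp only: hom_one)
qed

text \<open>Multiplying \<open>h X\<close> on both sides by the sum of the diagonal units, which is
  \<open>1\<close>, carries out the expansion in the target algebra; each term is the image of a
  compression of \<open>X\<close> to one entry.\<close>

lemma hom_expand:
  assumes X: "X \<in> carrier_mat N N"
  shows "h X = (\<Sum>i<N. \<Sum>j<N. X $$ (i, j) *\<^sub>C h (mat_unit N i j))"
proof -
  have "h X = (\<Sum>i<N. h (mat_unit N i i)) * h X * (\<Sum>j<N. h (mat_unit N j j))"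
    by (simp add: hom_sum_units)
  also have "\<dots> = (\<Sum>i<N. \<Sum>j<N. h (mat_unit N i i) * h X * h (mat_unit N j j))"
    by (simp only: sum_distrib_right) (simp only: sum_distrib_left)
  also have "\<dots> = (\<Sum>i<N. \<Sum>j<N. h (mat_unit N i i * X * mat_unit N j j))"
    using X by (simp add: hom_mult mult_carrier_mat[of _ N N])
  also have "\<dots> = (\<Sum>i<N. \<Sum>j<N. X $$ (i, j) *\<^sub>C h (mat_unit N i j))"
    using X by (intro sum.cong refl) (simp add: mat_unit_sandwich hom_scale)
  finally show ?thesis .
qed

end

text \<open>The mixed-radix number with the digits \<open>j 0\<close> to \<open>j (n - 1)\<close>,
  the first being the most significant: the row or column that a multi-index labels in an iterated
  Kronecker product.\<close>

primrec radix_index :: "(nat \<Rightarrow> nat) \<Rightarrow> nat \<Rightarrow> (nat \<Rightarrow> nat) \<Rightarrow> nat" where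
  "radix_index a 0 j = 0"
| "radix_index a (Suc n) j = a n * radix_index a n j + j n"

lemma radix_index_cong: "(\<And>i. i < n \<Longrightarrow> j i = k i) \<Longrightarrow> radix_index a n j = radix_index a n k"
  by (induction n) auto

lemma radix_index_upd: "radix_index a (Suc n) (j(n := r)) = a n * radix_index a n j + r"
  using radix_index_cong[of n "j(n := r)" j a] by simp

lemma uhf_dim_Suc: "uhf_dim a (Suc n) = uhf_dim a n * a n"
  by (simp add: uhf_dim_def)

lemma radix_index_less: "(\<And>i. i < n \<Longrightarrow> j i < a i) \<Longrightarrow> radix_index a n j < uhf_dim a n"
  by (induction n) (auto simp: uhf_dim_Suc digit_less, simp add: uhf_dim_def)

lemma radix_index_inj:
  assumes "radix_index a n j = radix_index a n k" "\<And>i. i < n \<Longrightarrow> j i < a i" "\<And>i. i < n \<Longrightarrow> k i < a i" "i < n"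
  shows "j i = k i"
  using assms
proof (induction n)
  case (Suc n)
  have lt: "j n < a n" "k n < a n" using Suc.prems by auto
  have eq: "a n * radix_index a n j + j n = a n * radix_index a n k + k n"
    using Suc.prems(1) by simp
  have "(a n * radix_index a n j + j n) mod a n = j n" "(a n * radix_index a n k + k n) mod a n = k n"
    "(a n * radix_index a n j + j n) div a n = radix_index a n j"
    "(a n * radix_index a n k + k n) div a n = radix_index a n k"
    using lt by auto
  then have "j n = k n" "radix_index a n j = radix_index a n k"
    unfolding eq by auto
  then show ?case
    using Suc by (cases "i = n") auto
qed simp

lemma sum_digits: "(\<Sum>r<a * b. f r) = (\<Sum>p<a. \<Sum>q<(b::nat). f (b * p + q))"
  by (subst sum_div_mod[symmetric]) simp

lemma sum_radix_index: "(\<Sum>r<uhf_dim a n. f r) = (\<Sum>j\<in>multi_index a n. f (radix_index a n j))"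
proof (induction n arbitrary: f)
  case 0
  show ?case by (simp add: uhf_dim_def multi_index_def)
next
  case (Suc n)
  show ?case
    unfolding uhf_dim_Suc sum_digits Suc sum_multi_index_Suc radix_index_upd ..
qed

lemma kron_carrier: "A \<in> carrier_mat n n \<Longrightarrow> B \<in> carrier_mat m m \<Longrightarrow> kron A B \<in> carrier_mat (n * m) (n * m)"
  by (auto simp: kron_def)

lemma kron_index:
  "A \<in> carrier_mat n n \<Longrightarrow> B \<in> carrier_mat m m \<Longrightarrow> i < n * m \<Longrightarrow> j < n * m \<Longrightarrow>
    kron A B $$ (i, j) = A $$ (i div m, j div m) * B $$ (i mod m, j mod m)"
  by (auto simp: kron_def)

lemma kron_digits:
  assumes "A \<in> carrier_mat n n" "B \<in> carrier_mat m m" "p < n" "q < n" "r < m" "s < m"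
  shows "kron A B $$ (m * p + r, m * q + s) = A $$ (p, q) * B $$ (r, s)"
  using assms by (subst kron_index[OF assms(1,2)]) (auto intro: digit_less)

lemma kron_mat_unit:
  assumes "i < n" "j < n" "k < m" "l < m"
  shows "kron (mat_unit n i j) (mat_unit m k l) = mat_unit (n * m) (m * i + k) (m * j + l)"
proof (rule eq_matI)
  fix r s
  assume "r < dim_row (mat_unit (n * m) (m * i + k) (m * j + l))"
    "s < dim_col (mat_unit (n * m) (m * i + k) (m * j + l))"
  then have rs: "r < n * m" "s < n * m" by (auto simp: mat_unit_def)
  have m: "0 < m" using assms by simp
  have "r = m * i + k \<longleftrightarrow> r div m = i \<and> r mod m = k" "s = m * j + l \<longleftrightarrow> s div m = j \<and> s mod m = l"
    using assms by auto
  then show "kron (mat_unit n i j) (mat_unit m k l) $$ (r, s) =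
      mat_unit (n * m) (m * i + k) (m * j + l) $$ (r, s)"
    using rs m by (auto simp: kron_def mat_unit_def less_mult_imp_div_less)
qed (auto simp: kron_def mat_unit_def)

lemma unit_tensor_eq:
  assumes "\<And>i. i < n \<Longrightarrow> j i < a i" "\<And>i. i < n \<Longrightarrow> k i < a i"
  shows "unit_tensor a n j k = mat_unit (uhf_dim a n) (radix_index a n j) (radix_index a n k)"
  using assms
proof (induction n)
  case 0
  show ?case
    unfolding unit_tensor_def by (auto simp: uhf_dim_def mat_unit_def intro!: eq_matI)
next
  case (Suc n)
  have "unit_tensor a (Suc n) j k = kron (unit_tensor a n j k) (mat_unit (a n) (j n) (k n))"
    by (simp add: unit_tensor_def)
  also have "\<dots> = kron (mat_unit (uhf_dim a n) (radix_index a n j) (radix_index a n k))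
      (mat_unit (a n) (j n) (k n))"
    using Suc by simp
  also have "\<dots> = mat_unit (uhf_dim a (Suc n)) (radix_index a (Suc n) j) (radix_index a (Suc n) k)"
    using Suc.prems by (simp add: kron_mat_unit radix_index_less uhf_dim_Suc)
  finally show ?case .
qed

definition uhf_unit where "uhf_unit a \<iota> n j k = \<iota> n (unit_tensor a n j k)"

text \<open>Bridges two conventions: members of \<open>multi_index a n\<close> are
  \<open>undefined\<close> from position \<open>n\<close> on, whereas \<open>product_state\<close>
  and \<open>uhf_iso\<close> quantify over arbitrary index functions.\<close>

lemma uhf_unit_cong:
  assumes "\<And>i. i < n \<Longrightarrow> j i = j' i" "\<And>i. i < n \<Longrightarrow> k i = k' i"
  shows "uhf_unit a \<iota> n j k = uhf_unit a \<iota> n j' k'"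
proof -
  have cong: "tensor_upto X n = tensor_upto Y n" if "\<And>i. i < n \<Longrightarrow> X i = Y i" for X Y
    using that by (induction n) auto
  show ?thesis
    unfolding uhf_unit_def unit_tensor_def
    by (intro arg_cong[where f = "\<iota> n"] cong) (simp add: assms)
qed

text \<open>The relations are those of matrices, carried over by \<open>\<iota> n\<close>.
  Compatibility comes from expanding the Kronecker product of a unit with the identity in the units
  of the next level, and density from \<open>hom_expand\<close>, by which every
  \<open>\<iota> n X\<close> is a level combination.\<close>

lemma uhf_units_of_algebra:
  fixes \<iota> :: "nat \<Rightarrow> complex mat \<Rightarrow> 'a::cstar_algebra"
  assumes \<iota>: "uhf_algebra a \<iota>"
  shows "uhf_units a (uhf_unit a \<iota>)"
proof -
  let ?u = "uhf_unit a \<iota>" and ?x = "radix_index a"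
  have hom: "mat_star_hom (uhf_dim a n) (\<iota> n)" for n
    using \<iota> by (simp add: uhf_algebra_def)
  have unit: "?u n j k = \<iota> n (mat_unit (uhf_dim a n) (?x n j) (?x n k))"
    if "j \<in> multi_index a n" "k \<in> multi_index a n" for n j k
    using that by (simp add: uhf_unit_def unit_tensor_eq multi_index_less)
  have less: "?x n j < uhf_dim a n" if "j \<in> multi_index a n" for n j
    using that by (simp add: radix_index_less multi_index_less)
  have inj: "?x n j = ?x n k \<longleftrightarrow> j = k" if "j \<in> multi_index a n" "k \<in> multi_index a n" for n j k
  proof
    assume eq: "?x n j = ?x n k"
    show "j = k"
      using that unfolding multi_index_def
      by (rule PiE_ext) (use radix_index_inj[OF eq] that multi_index_less in auto)
  qed simp
  have mu: "matrix_units (multi_index a n) (?u n)" for n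
    unfolding matrix_units_def
  proof (intro conjI ballI)
    fix i j k l
    assume "i \<in> multi_index a n" "j \<in> multi_index a n" "k \<in> multi_index a n" "l \<in> multi_index a n"
    then show "?u n i j * ?u n k l = (if j = k then ?u n i l else 0)"
      by (simp add: unit hom_mult[OF hom, symmetric] mat_unit_mult less inj hom_zero[OF hom])
  next
    fix i j assume "i \<in> multi_index a n" "j \<in> multi_index a n"
    then show "star (?u n i j) = ?u n j i"
      by (simp add: unit hom_adjoint[OF hom, symmetric] mat_unit_adjoint less)
  next
    have "(\<Sum>i\<in>multi_index a n. ?u n i i) = (\<Sum>r<uhf_dim a n. \<iota> n (mat_unit (uhf_dim a n) r r))"
      by (simp add: sum_radix_index unit)
    then show "(\<Sum>i\<in>multi_index a n. ?u n i i) = 1"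
      by (simp add: hom_sum_units[OF hom])
  qed
  have comp: "compatible_units a ?u"
    unfolding compatible_units_def
  proof (intro allI ballI)
    fix n j k assume jk: "j \<in> multi_index a n" "k \<in> multi_index a n"
    let ?D = "uhf_dim a n" and ?e = "\<lambda>r s. \<iota> (Suc n) (mat_unit (uhf_dim a (Suc n)) r s)"
    let ?X = "kron (mat_unit ?D (?x n j) (?x n k)) (1\<^sub>m (a n))"
    have "?u n j k = \<iota> (Suc n) ?X"
      using \<iota> by (simp add: unit[OF jk] uhf_algebra_def uhf_local_def)
    also have "\<dots> = (\<Sum>p<?D. \<Sum>r<a n. \<Sum>q<?D. \<Sum>s<a n.
        ?X $$ (a n * p + r, a n * q + s) *\<^sub>C ?e (a n * p + r) (a n * q + s))"
    proof -
      have "?X \<in> carrier_mat (uhf_dim a (Suc n)) (uhf_dim a (Suc n))"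
        unfolding uhf_dim_Suc by (rule kron_carrier) auto
      from hom_expand[OF hom this] show ?thesis
        unfolding uhf_dim_Suc sum_digits .
    qed
    \<comment> \<open>The matrix unit fixes the leading digits \<open>p\<close> and
      \<open>q\<close>, and the identity factor forces \<open>s = r\<close>; the sums are nested so
      that these conditions can be removed one by one.\<close>
    also have "\<dots> = (\<Sum>p<?D. \<Sum>r<a n. \<Sum>q<?D. \<Sum>s<a n. if s = r then
        if q = ?x n k then if p = ?x n j then ?e (a n * p + r) (a n * q + s) else 0 else 0 else 0)"
      by (intro sum.cong refl, subst kron_digits[of _ ?D _ "a n"]) (auto simp: mat_unit_def)
    also have "\<dots> = (\<Sum>p<?D. \<Sum>r<a n. if p = ?x n j then ?e (a n * p + r) (a n * ?x n k + r) else 0)"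
      by (intro sum.cong refl) (simp add: less[OF jk(2)])
    also have "\<dots> = (\<Sum>p<?D. if p = ?x n j then \<Sum>r<a n. ?e (a n * p + r) (a n * ?x n k + r) else 0)"
      by (intro sum.cong refl) simp
    also have "\<dots> = (\<Sum>r<a n. ?e (a n * ?x n j + r) (a n * ?x n k + r))"
      by (simp add: less[OF jk(1)])
    also have "\<dots> = (\<Sum>r<a n. ?u (Suc n) (j(n := r)) (k(n := r)))"
    proof (intro sum.cong refl)
      fix r assume "r \<in> {..<a n}"
      then have "j(n := r) \<in> multi_index a (Suc n)" "k(n := r) \<in> multi_index a (Suc n)"
        using jk by (auto intro: multi_index_upd)
      then show "?e (a n * ?x n j + r) (a n * ?x n k + r) = ?u (Suc n) (j(n := r)) (k(n := r))"
        by (simp only: unit radix_index_upd)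
    qed
    finally show "?u n j k = (\<Sum>r<a n. ?u (Suc n) (j(n := r)) (k(n := r)))" .
  qed
  have "\<iota> n ` uhf_local a n \<subseteq> range (level_comb a ?u n)" for n
  proof
    fix y assume "y \<in> \<iota> n ` uhf_local a n"
    then obtain X where X: "X \<in> carrier_mat (uhf_dim a n) (uhf_dim a n)" "y = \<iota> n X"
      by (auto simp: uhf_local_def)
    have "y = level_comb a ?u n (\<lambda>j k. X $$ (?x n j, ?x n k))"
      unfolding X(2) hom_expand[OF hom X(1)] sum_radix_index unit_comb_def
      by (intro sum.cong refl) (simp add: unit)
    then show "y \<in> range (level_comb a ?u n)" by blast
  qed
  then have "closure (\<Union>n. \<iota> n ` uhf_local a n) \<subseteq> closure (\<Union>n. range (level_comb a ?u n))"
    by (intro closure_mono UN_mono) auto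
  then have "closure (\<Union>n. range (level_comb a ?u n)) = UNIV"
    using \<iota> by (auto simp: uhf_algebra_def)
  then show ?thesis
    using mu comp by (simp add: uhf_units_def)
qed

section \<open>Positive semidefinite forms, rank-one decompositions and Kronecker products\<close>

section \<open>Positive matrices\<close>

definition psd :: "nat \<Rightarrow> (nat \<Rightarrow> nat \<Rightarrow> complex) \<Rightarrow> bool" where
  "psd n A \<longleftrightarrow> (\<forall>v. 0 \<le> (\<Sum>i<n. \<Sum>j<n. cnj (v i) * A i j * v j))"

text \<open>The form is evaluated at the vector with entry \<open>1\<close> at \<open>p\<close>,
  \<open>c\<close> at \<open>q\<close> and zero elsewhere.\<close>

lemma psd_two:
  assumes A: "psd n A" and pq: "p < n" "q < n" "p \<noteq> q"
  shows "0 \<le> A p p + c * A p q + cnj c * A q p + cnj c * c * A q q"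
proof -
  let ?v = "\<lambda>i. if i = p then 1 else if i = q then c else 0"
  have restr: "(\<Sum>i<n. f i) = f p + f q" if "\<And>i. i \<notin> {p, q} \<Longrightarrow> f i = 0" for f :: "nat \<Rightarrow> complex"
  proof -
    have "(\<Sum>i<n. f i) = (\<Sum>i\<in>{p, q}. f i)"
      using pq that by (intro sum.mono_neutral_right) auto
    then show ?thesis using pq by simp
  qed
  have "0 \<le> (\<Sum>i<n. \<Sum>j<n. cnj (?v i) * A i j * ?v j)"
    using A unfolding psd_def by (rule spec)
  also have "\<dots> = (\<Sum>i<n. cnj (?v i) * A i p + cnj (?v i) * A i q * c)"
    by (intro sum.cong refl, subst restr) (use pq in auto)
  also have "\<dots> = A p p + c * A p q + cnj c * A q p + cnj c * c * A q q"
    by (subst restr) (use pq in \<open>auto simp: algebra_simps\<close>)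
  finally show ?thesis .
qed

lemma psd_diag:
  assumes "psd n A" "p < n"
  shows "0 \<le> A p p"
proof -
  have "0 \<le> (\<Sum>i<n. \<Sum>j<n. cnj (if i = p then 1 else 0) * A i j * (if j = p then 1 else 0))"
    using assms(1) unfolding psd_def by (rule spec)
  also have "\<dots> = (\<Sum>i<n. \<Sum>j<n. if j = p then if i = p then A i j else 0 else 0)"
    by (intro sum.cong refl) auto
  also have "\<dots> = A p p"
    using assms(2) by simp
  finally show ?thesis .
qed

text \<open>For distinct \<open>p\<close> and \<open>q\<close> the expressions of
  \<open>psd_two\<close> at \<open>c = 1\<close> and \<open>c = \<i>\<close> are real, which relates
  the imaginary and the real parts of the two entries.\<close>

lemma psd_hermitian:
  assumes A: "psd n A" and pq: "p < n" "q < n"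
  shows "A q p = cnj (A p q)"
proof (cases "p = q")
  case True
  then show ?thesis
    using psd_diag[OF A pq(1)] by (simp add: less_eq_complex_def complex_eq_iff)
next
  case False
  have "Im (A p p) = 0" "Im (A q q) = 0"
    using psd_diag[OF A] pq by (auto simp: less_eq_complex_def)
  then show ?thesis
    using psd_two[OF A pq False, of 1] psd_two[OF A pq False, of \<i>]
    by (simp add: less_eq_complex_def complex_eq_iff)
qed

lemma psd_zero_diag:
  assumes A: "psd n A" and pq: "p < n" "q < n" and zero: "A q q = 0"
  shows "A p q = 0"
proof (cases "p = q")
  case False
  \<comment> \<open>With \<open>c = - s * cnj (A p q)\<close> in \<open>psd_two\<close> the
    expression is affine in \<open>s\<close>, because \<open>A q q\<close> vanishes.\<close>
  have "0 \<le> Re (A p p) - 2 * s * (cmod (A p q))\<^sup>2" for s :: real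
  proof -
    have "0 \<le> Re (A p p + (- s * cnj (A p q)) * A p q + cnj (- s * cnj (A p q)) * cnj (A p q))"
      using psd_two[OF A pq False, of "- s * cnj (A p q)"] psd_hermitian[OF A pq]
      by (simp add: less_eq_complex_def zero)
    also have "A p p + (- s * cnj (A p q)) * A p q + cnj (- s * cnj (A p q)) * cnj (A p q) =
      A p p - complex_of_real (2 * s) * (A p q * cnj (A p q))"
      by (simp add: algebra_simps)
    also have "A p q * cnj (A p q) = complex_of_real ((cmod (A p q))\<^sup>2)"
      by (rule complex_norm_square[symmetric])
    finally show ?thesis by simp
  qed
  \<comment> \<open>If \<open>A p q\<close> were nonzero, this \<open>s\<close> would turn the
    nonnegative expression into \<open>-1\<close>.\<close>
  from this[of "(Re (A p p) + 1) / (2 * (cmod (A p q))\<^sup>2)"] show ?thesis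
    by (cases "A p q = 0") auto
qed (use zero in simp)

lemma psd_gram:
  assumes "finite S" and A: "\<And>i j. i < n \<Longrightarrow> j < n \<Longrightarrow> A i j = (\<Sum>r\<in>S. W r i * cnj (W r j))"
  shows "psd n A"
  unfolding psd_def
proof
  fix v
  have "(\<Sum>i<n. \<Sum>j<n. cnj (v i) * A i j * v j) =
    (\<Sum>i<n. \<Sum>j<n. \<Sum>r\<in>S. (cnj (v i) * W r i) * cnj (cnj (v j) * W r j))"
    by (intro sum.cong refl) (simp add: A sum_distrib_left sum_distrib_right mult_ac)
  also have "\<dots> = (\<Sum>i<n. \<Sum>r\<in>S. \<Sum>j<n. (cnj (v i) * W r i) * cnj (cnj (v j) * W r j))"
    by (intro sum.cong refl sum.swap)
  also have "\<dots> = (\<Sum>r\<in>S. \<Sum>i<n. \<Sum>j<n. (cnj (v i) * W r i) * cnj (cnj (v j) * W r j))"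
    by (rule sum.swap)
  also have "\<dots> = (\<Sum>r\<in>S. (\<Sum>i<n. cnj (v i) * W r i) * cnj (\<Sum>j<n. cnj (v j) * W r j))"
    by (simp only: cnj_sum sum_product)
  also have "\<dots> = complex_of_real (\<Sum>r\<in>S. (cmod (\<Sum>i<n. cnj (v i) * W r i))\<^sup>2)"
    by (simp only: complex_norm_square of_real_sum)
  also have "0 \<le> \<dots>"
    by (simp add: less_eq_complex_def sum_nonneg del: of_real_sum)
  finally show "0 \<le> (\<Sum>i<n. \<Sum>j<n. cnj (v i) * A i j * v j)" .
qed

text \<open>Cholesky decomposition: each step splits off the last row and column.  If the pivot vanishes then
  so does its column, and the division by zero returns the right value \<open>0\<close>.\<close>

lemma psd_decomp:
  assumes "psd n A"
  shows "\<exists>W. \<forall>i<n. \<forall>j<n. A i j = (\<Sum>r<n. W r i * cnj (W r j))"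
  using assms
proof (induction n arbitrary: A)
  case (Suc n)
  define \<alpha> where "\<alpha> = Re (A n n)"
  have \<alpha>: "A n n = complex_of_real \<alpha>" "0 \<le> \<alpha>"
    using psd_diag[OF Suc.prems, of n] by (auto simp: \<alpha>_def less_eq_complex_def complex_eq_iff)
  have herm: "A n i = cnj (A i n)" if "i \<le> n" for i
    using psd_hermitian[OF Suc.prems, of i n] that by simp
  have zero: "A i n = 0" if "i \<le> n" "\<alpha> = 0" for i
    using psd_zero_diag[OF Suc.prems, of i n] that \<alpha> by simp
  \<comment> \<open>The Schur complement of the last diagonal entry.\<close>
  define B where "B i j = A i j - A i n * A n j / \<alpha>" for i j
  have "psd n B"
    unfolding psd_def
  proof
    fix v
    define \<beta> where "\<beta> = (\<Sum>j<n. A n j * v j)"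
    have \<beta>: "cnj \<beta> = (\<Sum>i<n. cnj (v i) * A i n)"
      by (simp add: \<beta>_def herm mult.commute)
    \<comment> \<open>This last coordinate minimises the form with the other coordinates fixed, and
      the minimum is the form of \<open>B\<close> at \<open>v\<close>.\<close>
    define \<gamma> where "\<gamma> = - \<beta> / \<alpha>"
    have square: "S + cnj \<beta> * \<gamma> + cnj \<gamma> * \<beta> + cnj \<gamma> * \<alpha> * \<gamma> = S - cnj \<beta> * \<beta> / \<alpha>" for S
      by (cases "\<alpha> = 0") (simp_all add: \<gamma>_def field_simps)
    let ?v = "v(n := \<gamma>)" and ?S = "\<Sum>i<n. \<Sum>j<n. cnj (v i) * A i j * v j"
    have "cnj (v i) * B i j * v j = cnj (v i) * A i j * v j - (cnj (v i) * A i n) * (A n j * v j) / \<alpha>" for i j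
      by (simp add: B_def algebra_simps)
    then have "(\<Sum>i<n. \<Sum>j<n. cnj (v i) * B i j * v j) =
      ?S - (\<Sum>i<n. \<Sum>j<n. (cnj (v i) * A i n) * (A n j * v j)) / \<alpha>"
      by (simp only: sum_subtractf sum_divide_distrib)
    also have "(\<Sum>i<n. \<Sum>j<n. (cnj (v i) * A i n) * (A n j * v j)) = cnj \<beta> * \<beta>"
      unfolding \<beta> unfolding \<beta>_def by (rule sum_product[symmetric])
    finally have B: "(\<Sum>i<n. \<Sum>j<n. cnj (v i) * B i j * v j) = ?S - cnj \<beta> * \<beta> / \<alpha>" .
    have "(\<Sum>i<Suc n. \<Sum>j<Suc n. cnj (?v i) * A i j * ?v j) =
      ?S + (\<Sum>i<n. cnj (v i) * A i n) * \<gamma> + cnj \<gamma> * (\<Sum>j<n. A n j * v j) + cnj \<gamma> * A n n * \<gamma>"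
      by (simp add: sum.distrib sum_distrib_left sum_distrib_right mult.assoc)
    also have "\<dots> = ?S - cnj \<beta> * \<beta> / \<alpha>"
      unfolding \<beta>[symmetric] unfolding \<beta>_def[symmetric] \<alpha>(1) by (rule square)
    finally have form: "(\<Sum>i<Suc n. \<Sum>j<Suc n. cnj (?v i) * A i j * ?v j) = ?S - cnj \<beta> * \<beta> / \<alpha>" .
    show "0 \<le> (\<Sum>i<n. \<Sum>j<n. cnj (v i) * B i j * v j)"
      unfolding B form[symmetric] using Suc.prems unfolding psd_def by (rule spec)
  qed
  then obtain W where W: "\<And>i j. i < n \<Longrightarrow> j < n \<Longrightarrow> B i j = (\<Sum>r<n. W r i * cnj (W r j))"
    using Suc.IH by blast
  \<comment> \<open>The vectors for \<open>B\<close>, padded with a zero, and one new vector: the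
    last column of \<open>A\<close> divided by the square root of its pivot.\<close>
  define W' where "W' r i = (if r < n then if i < n then W r i else 0 else A i n / sqrt \<alpha>)" for r i
  have last: "W' n i * cnj (W' n j) = A i n * A n j / \<alpha>" if "j \<le> n" for i j
    using \<alpha>(2) by (simp add: W'_def herm[OF that] of_real_mult[symmetric] del: of_real_mult)
  have "A i j = (\<Sum>r<Suc n. W' r i * cnj (W' r j))" if "i \<le> n" "j \<le> n" for i j
  proof (cases "i < n \<and> j < n")
    case True
    then have "A i j = B i j + A i n * A n j / \<alpha>" by (simp add: B_def)
    then show ?thesis
      using True by (simp add: last W) (simp add: W'_def)
  next
    case False
    then have "(\<Sum>r<n. W' r i * cnj (W' r j)) = 0"
      using that by (intro sum.neutral) (auto simp: W'_def)
    moreover have "A i j = A i n * A n j / \<alpha>"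
      using False that \<alpha> zero[of i] zero[of j] herm[of j] herm[of i]
      by (cases "\<alpha> = 0"; cases "i = n") auto
    ultimately show ?thesis by (simp add: last that)
  qed
  then show ?case
    by (intro exI[of _ W']) auto
qed simp

lemma positive_mat_iff:
  "positive_mat n A \<longleftrightarrow> A \<in> carrier_mat n n \<and> psd n (\<lambda>i j. A $$ (i, j))"
proof (cases "A \<in> carrier_mat n n")
  case True
  have form: "(A *\<^sub>v v) \<bullet>c v = (\<Sum>i<n. \<Sum>j<n. cnj (v $ i) * A $$ (i, j) * v $ j)" if "v \<in> carrier_vec n" for v
    using True that
    by (auto simp: scalar_prod_def atLeast0LessThan sum_distrib_left sum_distrib_right mult_ac intro!: sum.cong)
  have "psd n (\<lambda>i j. A $$ (i, j))" if pos: "\<And>v. v \<in> carrier_vec n \<Longrightarrow> 0 \<le> (A *\<^sub>v v) \<bullet>c v"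
    unfolding psd_def
  proof
    fix v
    have "0 \<le> (\<Sum>i<n. \<Sum>j<n. cnj (vec n v $ i) * A $$ (i, j) * vec n v $ j)"
      using pos[of "vec n v"] form[of "vec n v"] by simp
    then show "0 \<le> (\<Sum>i<n. \<Sum>j<n. cnj (v i) * A $$ (i, j) * v j)" by simp
  qed
  moreover have "0 \<le> (A *\<^sub>v v) \<bullet>c v" if "psd n (\<lambda>i j. A $$ (i, j))" "v \<in> carrier_vec n" for v
    unfolding form[OF that(2)] using that(1) unfolding psd_def by (rule spec[where x = "($) v"])
  ultimately show ?thesis
    using True unfolding positive_mat_def by blast
qed (simp add: positive_mat_def)

text \<open>Kronecker products of the vectors in rank-one decompositions of \<open>A\<close> and
  \<open>B\<close> decompose \<open>kron A B\<close>, which is therefore positive; the trace is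
  multiplicative.\<close>

lemma density_mat_kron:
  assumes A: "A \<in> density_mat n" and B: "B \<in> density_mat m"
  shows "kron A B \<in> density_mat (n * m)"
proof -
  have car: "A \<in> carrier_mat n n" "B \<in> carrier_mat m m"
    and tr: "(\<Sum>i<n. A $$ (i, i)) = 1" "(\<Sum>i<m. B $$ (i, i)) = 1"
    and psd: "psd n (\<lambda>i j. A $$ (i, j))" "psd m (\<lambda>i j. B $$ (i, j))"
    using A B by (auto simp: density_mat_def positive_mat_iff)
  obtain W where W: "\<And>i j. i < n \<Longrightarrow> j < n \<Longrightarrow> A $$ (i, j) = (\<Sum>r<n. W r i * cnj (W r j))"
    using psd_decomp[OF psd(1)] by blast
  obtain Z where Z: "\<And>i j. i < m \<Longrightarrow> j < m \<Longrightarrow> B $$ (i, j) = (\<Sum>r<m. Z r i * cnj (Z r j))"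
    using psd_decomp[OF psd(2)] by blast
  have ind: "kron A B $$ (i, j) = A $$ (i div m, j div m) * B $$ (i mod m, j mod m)"
    if "i < n * m" "j < n * m" for i j
    using kron_index[OF car] that .
  have m: "i div m < n" "i mod m < m" if "i < n * m" for i
    using that by (cases "m = 0"; auto intro: less_mult_imp_div_less)+
  have "psd (n * m) (\<lambda>i j. kron A B $$ (i, j))"
    by (rule psd_gram[of "{..<n} \<times> {..<m}" _ _ "\<lambda>(r, s) i. W r (i div m) * Z s (i mod m)"])
       (auto simp: ind W Z m sum_product sum.cartesian_product case_prod_unfold mult_ac intro!: sum.cong)
  moreover have "(\<Sum>i<n * m. kron A B $$ (i, i)) = 1"
  proof -
    have "(\<Sum>i<n * m. kron A B $$ (i, i)) = (\<Sum>i<n * m. A $$ (i div m, i div m) * B $$ (i mod m, i mod m))"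
      by (simp add: ind)
    also have "\<dots> = (\<Sum>p<n. \<Sum>q<m. A $$ (p, p) * B $$ (q, q))"
      by (rule sum_div_mod)
    also have "\<dots> = 1"
      unfolding sum_product[symmetric] tr by simp
    finally show ?thesis .
  qed
  moreover have "kron A B \<in> carrier_mat (n * m) (n * m)"
    using car by (rule kron_carrier)
  ultimately show ?thesis
    by (simp add: density_mat_def positive_mat_iff)
qed

section \<open>Well-definedness of product states and of \<phi>, and part (i)\<close>

section \<open>The tensor product of product states\<close>

lemma restrict_multi_index:
  "(\<And>i. i < n \<Longrightarrow> j i < a i) \<Longrightarrow> restrict j {..<n} \<in> multi_index a n"
  by (auto simp: multi_index_def)

lemma uhf_unit_restrict: "uhf_unit a \<iota> n (restrict j {..<n}) (restrict k {..<n}) = uhf_unit a \<iota> n j k"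
  by (rule uhf_unit_cong) auto

lemma density_seqs_product_state:
  assumes \<iota>: "uhf_units a u" and T: "T \<in> density_seqs a"
  shows "\<exists>!\<omega>. is_product_state a u T \<omega>"
proof -
  have "\<exists>W. \<forall>k<a i. \<forall>j<a i. T i $$ (k, j) = (\<Sum>r<a i. W r k * cnj (W r j))" for i
    using T by (intro psd_decomp) (auto simp: density_seqs_def density_mat_def positive_mat_iff)
  then obtain W where "\<And>i k j. k < a i \<Longrightarrow> j < a i \<Longrightarrow> T i $$ (k, j) = (\<Sum>r<a i. W i r k * cnj (W i r j))"
    by metis
  moreover have "(\<Sum>r<a i. T i $$ (r, r)) = 1" for i
    using T by (auto simp: density_seqs_def density_mat_def)
  ultimately have "\<exists>\<omega>. is_product_state a u T \<omega>"
    by (rule is_product_state_exists[OF \<iota>])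
  then show ?thesis
    using is_product_state_unique[OF \<iota>] by blast
qed

lemma is_product_state_iff:
  "is_product_state a (uhf_unit a \<iota>) T \<omega> \<longleftrightarrow> is_state \<omega> \<and>
     (\<forall>n j k. (\<forall>i<n. j i < a i \<and> k i < a i) \<longrightarrow>
        \<omega> (\<iota> n (unit_tensor a n j k)) = (\<Prod>i<n. T i $$ (k i, j i)))"
  (is "_ \<longleftrightarrow> _ \<and> ?R")
proof -
  have ?R if all: "\<forall>n. \<forall>j\<in>multi_index a n. \<forall>k\<in>multi_index a n.
      \<omega> (uhf_unit a \<iota> n j k) = (\<Prod>i<n. T i $$ (k i, j i))"
  proof (intro allI impI)
    fix n j k assume jk: "\<forall>i<n. j i < a i \<and> k i < a i"
    have "\<omega> (uhf_unit a \<iota> n (restrict j {..<n}) (restrict k {..<n})) =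
        (\<Prod>i<n. T i $$ (restrict k {..<n} i, restrict j {..<n} i))"
      using jk by (intro all[rule_format] restrict_multi_index) auto
    then show "\<omega> (\<iota> n (unit_tensor a n j k)) = (\<Prod>i<n. T i $$ (k i, j i))"
      unfolding uhf_unit_restrict by (simp add: uhf_unit_def)
  qed
  then show ?thesis
    unfolding is_product_state_def uhf_unit_def using multi_index_less by blast
qed

lemma is_product_state_product_state:
  assumes "uhf_algebra a \<iota>" and "T \<in> density_seqs a"
  shows "is_product_state a (uhf_unit a \<iota>) T (product_state a \<iota> T)"
  using theI'[OF density_seqs_product_state[OF uhf_units_of_algebra[OF assms(1)] assms(2)]]
  unfolding product_state_def is_product_state_iff .

text \<open>The definite description is first rewritten as a condition on multi-indices. Existence
  is then \<open>uhf_star_iso_exists\<close> for the products of units in the tensor product, and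
  uniqueness holds because a continuous linear map is determined by its values on units.\<close>

lemma uhf_iso_props:
  fixes t :: "'a::cstar_algebra \<Rightarrow> 'b::cstar_algebra \<Rightarrow> 'd::cstar_algebra"
  assumes a: "uhf_algebra a \<iota>\<^sub>a" and b: "uhf_algebra b \<iota>\<^sub>b"
    and c: "uhf_algebra (seq_mult a b) \<iota>\<^sub>c" and t: "cstar_tensor t"
  shows "star_iso (uhf_iso a b \<iota>\<^sub>a \<iota>\<^sub>b \<iota>\<^sub>c t)"
    and "j \<in> multi_index (seq_mult a b) n \<Longrightarrow> k \<in> multi_index (seq_mult a b) n \<Longrightarrow>
      uhf_iso a b \<iota>\<^sub>a \<iota>\<^sub>b \<iota>\<^sub>c t (uhf_unit (seq_mult a b) \<iota>\<^sub>c n j k) =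
      tensor_units b t (uhf_unit a \<iota>\<^sub>a) (uhf_unit b \<iota>\<^sub>b) n j k"
proof -
  let ?ab = "seq_mult a b" and ?w = "tensor_units b t (uhf_unit a \<iota>\<^sub>a) (uhf_unit b \<iota>\<^sub>b)"
  let ?P = "\<lambda>\<phi>. star_iso \<phi> \<and> (\<forall>n j' k' j'' k''.
    (\<forall>i<n. j' i < a i \<and> k' i < a i \<and> j'' i < b i \<and> k'' i < b i) \<longrightarrow>
    \<phi> (\<iota>\<^sub>c n (unit_tensor ?ab n (\<lambda>i. b i * j' i + j'' i) (\<lambda>i. b i * k' i + k'' i))) =
    t (\<iota>\<^sub>a n (unit_tensor a n j' k')) (\<iota>\<^sub>b n (unit_tensor b n j'' k'')))"
  let ?Q = "\<lambda>\<phi>. star_iso \<phi> \<and> (\<forall>n. \<forall>j\<in>multi_index ?ab n. \<forall>k\<in>multi_index ?ab n.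
    \<phi> (uhf_unit ?ab \<iota>\<^sub>c n j k) = ?w n j k)"
  note ua = uhf_units_of_algebra[OF a] and ub = uhf_units_of_algebra[OF b] and uc = uhf_units_of_algebra[OF c]
  have PQ: "?P \<phi> = ?Q \<phi>" for \<phi>
  proof (intro conj_cong refl iffI allI ballI impI)
    fix n j k
    assume all: "\<forall>n j' k' j'' k''.
      (\<forall>i<n. j' i < a i \<and> k' i < a i \<and> j'' i < b i \<and> k'' i < b i) \<longrightarrow>
      \<phi> (\<iota>\<^sub>c n (unit_tensor ?ab n (\<lambda>i. b i * j' i + j'' i) (\<lambda>i. b i * k' i + k'' i))) =
      t (\<iota>\<^sub>a n (unit_tensor a n j' k')) (\<iota>\<^sub>b n (unit_tensor b n j'' k''))"
      and jk: "j \<in> multi_index ?ab n" "k \<in> multi_index ?ab n"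
    have "\<phi> (uhf_unit ?ab \<iota>\<^sub>c n (\<lambda>i. b i * quo b n j i + rmd b n j i) (\<lambda>i. b i * quo b n k i + rmd b n k i)) =
        ?w n j k"
      using all[rule_format, of n "quo b n j" "quo b n k" "rmd b n j" "rmd b n k"]
        multi_index_less[OF quo_in] multi_index_less[OF rmd_in] jk
      by (simp add: uhf_unit_def tensor_units_def)
    moreover have "uhf_unit ?ab \<iota>\<^sub>c n (\<lambda>i. b i * quo b n j i + rmd b n j i)
          (\<lambda>i. b i * quo b n k i + rmd b n k i) =
        uhf_unit ?ab \<iota>\<^sub>c n j k"
      by (rule uhf_unit_cong) (auto simp: quo_def rmd_def)
    ultimately show "\<phi> (uhf_unit ?ab \<iota>\<^sub>c n j k) = ?w n j k" by simp
  next
    fix n j' k' j'' k''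
    assume all: "\<forall>n. \<forall>j\<in>multi_index ?ab n. \<forall>k\<in>multi_index ?ab n. \<phi> (uhf_unit ?ab \<iota>\<^sub>c n j k) = ?w n j k"
      and less: "\<forall>i<n. j' i < a i \<and> k' i < a i \<and> j'' i < b i \<and> k'' i < b i"
    let ?r = "\<lambda>j. restrict j {..<n}"
    have in_a: "?r j' \<in> multi_index a n" "?r k' \<in> multi_index a n"
      and in_b: "?r j'' \<in> multi_index b n" "?r k'' \<in> multi_index b n"
      using less by (auto intro!: restrict_multi_index)
    have "\<phi> (uhf_unit ?ab \<iota>\<^sub>c n (join b n (?r j') (?r j'')) (join b n (?r k') (?r k''))) =
        t (uhf_unit a \<iota>\<^sub>a n (?r j') (?r k')) (uhf_unit b \<iota>\<^sub>b n (?r j'') (?r k''))"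
      using all in_a in_b by (simp add: join_in tensor_units_def quo_join rmd_join)
    also have "uhf_unit ?ab \<iota>\<^sub>c n (join b n (?r j') (?r j'')) (join b n (?r k') (?r k'')) =
        uhf_unit ?ab \<iota>\<^sub>c n (\<lambda>i. b i * j' i + j'' i) (\<lambda>i. b i * k' i + k'' i)"
      by (rule uhf_unit_cong) (auto simp: join_def)
    finally show "\<phi> (\<iota>\<^sub>c n (unit_tensor ?ab n (\<lambda>i. b i * j' i + j'' i) (\<lambda>i. b i * k' i + k'' i))) =
        t (\<iota>\<^sub>a n (unit_tensor a n j' k')) (\<iota>\<^sub>b n (unit_tensor b n j'' k''))"
      unfolding uhf_unit_restrict by (simp add: uhf_unit_def)
  qed
  have "\<exists>!\<phi>. ?Q \<phi>"
  proof (rule ex_ex1I)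
    obtain \<phi> where \<phi>: "star_iso \<phi>" "\<And>n x. \<phi> (level_comb ?ab (uhf_unit ?ab \<iota>\<^sub>c) n x) = level_comb ?ab ?w n x"
      using uhf_star_iso_exists[OF uc uhf_units_tensor[OF t ua ub]] by blast
    have "\<phi> (uhf_unit ?ab \<iota>\<^sub>c n j k) = ?w n j k" if "j \<in> multi_index ?ab n" "k \<in> multi_index ?ab n" for n j k
      using \<phi>(2)[of n "\<lambda>p q. if p = j \<and> q = k then 1 else 0"] that by (simp add: unit_comb_delta)
    with \<phi>(1) show "\<exists>\<phi>. ?Q \<phi>" by blast
  next
    fix \<phi> \<psi> assume \<phi>: "?Q \<phi>" and \<psi>: "?Q \<psi>"
    show "\<phi> = \<psi>"
    proof
      fix x show "\<phi> x = \<psi> x"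
        by (rule uhf_eqI[OF uc])
           (use \<phi> \<psi> star_iso_continuous[OF _ continuous_on_id] in \<open>auto simp: star_iso_def\<close>)
    qed
  qed
  from theI'[OF this] have "?Q (uhf_iso a b \<iota>\<^sub>a \<iota>\<^sub>b \<iota>\<^sub>c t)"
    unfolding uhf_iso_def PQ .
  then show "star_iso (uhf_iso a b \<iota>\<^sub>a \<iota>\<^sub>b \<iota>\<^sub>c t)"
    and "j \<in> multi_index ?ab n \<Longrightarrow> k \<in> multi_index ?ab n \<Longrightarrow>
      uhf_iso a b \<iota>\<^sub>a \<iota>\<^sub>b \<iota>\<^sub>c t (uhf_unit ?ab \<iota>\<^sub>c n j k) = ?w n j k"
    by auto
qed

text \<open>On units, the joined digits split an entry of the Kronecker product into the two
  factors; bilinearity extends this to the levels, continuity to the algebras.\<close>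

lemma product_state_tensor:
  fixes t :: "'a::cstar_algebra \<Rightarrow> 'b::cstar_algebra \<Rightarrow> 'd::cstar_algebra"
  assumes t: "cstar_tensor t" and u: "uhf_units a u" and v: "uhf_units b v"
    and T: "T \<in> density_seqs a" and R: "R \<in> density_seqs b"
    and \<omega>: "is_product_state a u T \<omega>" and \<nu>: "is_product_state b v R \<nu>"
    and \<rho>: "is_product_state (seq_mult a b) (tensor_units b t u v) (\<lambda>n. kron (T n) (R n)) \<rho>"
  shows "\<rho> (t x y) = \<omega> x * \<nu> y"
proof (rule uhf_dense_induct2[OF u v, where P = "\<lambda>x y. \<rho> (t x y) = \<omega> x * \<nu> y"])
  have st: "is_state \<omega>" "is_state \<nu>" "is_state \<rho>"
    using \<omega> \<nu> \<rho> by (auto simp: is_product_state_def)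
  show "closed {y. \<rho> (t x y) = \<omega> x * \<nu> y}" "closed {x. \<rho> (t x y) = \<omega> x * \<nu> y}" for x y
    by (intro closed_Collect_eq continuous_intros state_continuous[OF st(1)] state_continuous[OF st(2)]
        state_continuous[OF st(3)] ct_continuous[OF t])+
  fix n w z
  have lin: "clinear \<omega>" "clinear \<nu>" "clinear \<rho>"
    using st by (auto simp: is_state_def)
  have unit: "\<rho> (t (u n p p') (v n q q')) = \<omega> (u n p p') * \<nu> (v n q q')"
    if "p \<in> multi_index a n" "p' \<in> multi_index a n" "q \<in> multi_index b n" "q' \<in> multi_index b n" for p p' q q'
  proof -
    have "kron (T i) (R i) $$ (join b n p' q' i, join b n p q i) = T i $$ (p' i, p i) * R i $$ (q' i, q i)"
      if "i < n" for i
    proof -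
      have "T i \<in> carrier_mat (a i) (a i)" "R i \<in> carrier_mat (b i) (b i)"
        using T R by (auto simp: density_seqs_def density_mat_def positive_mat_def)
      moreover have "p i < a i" "p' i < a i" "q i < b i" "q' i < b i"
        using \<open>i < n\<close> \<open>p \<in> _\<close> \<open>p' \<in> _\<close> \<open>q \<in> _\<close> \<open>q' \<in> _\<close> by (auto simp: multi_index_less)
      ultimately show ?thesis
        using \<open>i < n\<close> by (auto simp: kron_def join_def digit_less)
    qed
    moreover have "\<rho> (tensor_units b t u v n (join b n p q) (join b n p' q')) =
        (\<Prod>i<n. kron (T i) (R i) $$ (join b n p' q' i, join b n p q i))"
      using \<rho> that by (simp add: is_product_state_def join_in)
    ultimately show ?thesis
      using \<omega> \<nu> that
      by (simp add: tensor_units_def quo_join rmd_join is_product_state_def prod.distrib)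
  qed
  have "\<rho> (t (level_comb a u n w) (level_comb b v n z)) =
    (\<Sum>p\<in>multi_index a n. \<Sum>q\<in>multi_index b n. \<Sum>p'\<in>multi_index a n. \<Sum>q'\<in>multi_index b n.
      (w p p' * \<omega> (u n p p')) * (z q q' * \<nu> (v n q q')))"
    unfolding unit_comb_def ct_sum[OF t] clinear_sum[OF lin(3)]
    by (intro sum.cong refl)
       (simp add: clinear_scale[OF ct_clinear(1)[OF t]] clinear_scale[OF ct_clinear(2)[OF t]]
         clinear_scale[OF lin(3)] unit scaleC_complex_def)
  also have "\<dots> = \<omega> (level_comb a u n w) * \<nu> (level_comb b v n z)"
    unfolding unit_comb_def clinear_sum[OF lin(1)] clinear_sum[OF lin(2)] sum_product
    by (intro sum.cong refl)
       (simp add: clinear_scale[OF lin(1)] clinear_scale[OF lin(2)] scaleC_complex_def)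
  finally show "\<rho> (t (level_comb a u n w) (level_comb b v n z)) =
      \<omega> (level_comb a u n w) * \<nu> (level_comb b v n z)" .
qed

lemma state_tensor_eqI:
  assumes t: "cstar_tensor t" and \<rho>: "is_state \<rho>" "\<And>x y. \<rho> (t x y) = \<rho>\<^sub>1 x * \<rho>\<^sub>2 y"
  shows "state_tensor t \<rho>\<^sub>1 \<rho>\<^sub>2 = \<rho>"
  unfolding state_tensor_def
proof (rule the_equality)
  fix \<rho>' assume \<rho>': "is_state \<rho>' \<and> (\<forall>x y. \<rho>' (t x y) = \<rho>\<^sub>1 x * \<rho>\<^sub>2 y)"
  show "\<rho>' = \<rho>"
  proof
    fix z show "\<rho>' z = \<rho> z"
      by (rule clinear_eq_on_dense_span[OF _ _ _ _ ct_dense[OF t]])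
         (use \<rho> \<rho>' state_continuous[OF _ continuous_on_id] in \<open>auto simp: is_state_def\<close>)
  qed
qed (use \<rho> in simp)

text \<open>The product state \<rho> of the tensor product algebra mediates: its values on
  elementary tensors make it the tensor product of the two states, and composed with \<phi> it has
  the values that characterise \<omega>. The second claim supplies the inner products for part
  (ii).\<close>

lemma product_state_tensor_phi:
  fixes t :: "'a::cstar_algebra \<Rightarrow> 'b::cstar_algebra \<Rightarrow> 'd::cstar_algebra"
  assumes a: "uhf_algebra a \<iota>\<^sub>a" and b: "uhf_algebra b \<iota>\<^sub>b"
    and c: "uhf_algebra (seq_mult a b) \<iota>\<^sub>c" and t: "cstar_tensor t"
    and T: "T \<in> density_seqs a" and R: "R \<in> density_seqs b"
  defines "\<phi> \<equiv> uhf_iso a b \<iota>\<^sub>a \<iota>\<^sub>b \<iota>\<^sub>c t"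
    and "\<omega> \<equiv> product_state (seq_mult a b) \<iota>\<^sub>c (\<lambda>n. kron (T n) (R n))"
  shows "state_tensor t (product_state a \<iota>\<^sub>a T) (product_state b \<iota>\<^sub>b R) \<circ> \<phi> = \<omega>"
    and "\<phi> z = t x y \<Longrightarrow> \<omega> z = product_state a \<iota>\<^sub>a T x * product_state b \<iota>\<^sub>b R y"
proof -
  let ?ab = "seq_mult a b" and ?TR = "\<lambda>n. kron (T n) (R n)"
  note ua = uhf_units_of_algebra[OF a] and ub = uhf_units_of_algebra[OF b] and uc = uhf_units_of_algebra[OF c]
  have TR: "?TR \<in> density_seqs ?ab"
    using T R by (simp add: density_seqs_def density_mat_kron)
  obtain \<rho> where \<rho>: "is_product_state ?ab (tensor_units b t (uhf_unit a \<iota>\<^sub>a) (uhf_unit b \<iota>\<^sub>b)) ?TR \<rho>"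
    using density_seqs_product_state[OF uhf_units_tensor[OF t ua ub] TR] by blast
  have val: "\<rho> (t x y) = product_state a \<iota>\<^sub>a T x * product_state b \<iota>\<^sub>b R y" for x y
    by (rule product_state_tensor[OF t ua ub T R _ _ \<rho>])
       (use a b T R in \<open>auto intro: is_product_state_product_state\<close>)
  have "is_product_state ?ab (uhf_unit ?ab \<iota>\<^sub>c) ?TR (\<rho> \<circ> \<phi>)"
    using \<rho> uhf_iso_props[OF a b c t] is_state_comp_star_iso[of \<rho> \<phi>]
    by (simp add: is_product_state_def \<phi>_def)
  then have eq: "\<rho> \<circ> \<phi> = \<omega>"
    unfolding \<omega>_def
    by (rule is_product_state_unique[OF uc]) (rule is_product_state_product_state[OF c TR])
  moreover have "state_tensor t (product_state a \<iota>\<^sub>a T) (product_state b \<iota>\<^sub>b R) = \<rho>"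
    using \<rho> val by (intro state_tensor_eqI[OF t]) (auto simp: is_product_state_def)
  ultimately show "state_tensor t (product_state a \<iota>\<^sub>a T) (product_state b \<iota>\<^sub>b R) \<circ> \<phi> = \<omega>"
    by simp
  show "\<omega> z = product_state a \<iota>\<^sub>a T x * product_state b \<iota>\<^sub>b R y" if "\<phi> z = t x y"
    using that val unfolding eq[symmetric] by simp
qed

section \<open>Tensor products of GNS representations, and part (ii)\<close>

section \<open>The tensor product of GNS representations\<close>

lemma hilbert_tensor_continuous:
  fixes s :: "'h::chilbert_space \<Rightarrow> 'k::chilbert_space \<Rightarrow> 'm::chilbert_space"
  assumes s: "hilbert_tensor s" and "continuous_on A f" "continuous_on A g"
  shows "continuous_on A (\<lambda>z. s (f z) (g z))"
proof -
  have lin: "clinear (s x)" "clinear (\<lambda>x. s x y)" for x y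
    using s by (auto simp: hilbert_tensor_def cbilinear_def)
  have norm: "norm (s x y) = norm x * norm y" for x y
  proof -
    have "complex_of_real ((norm (s x y))\<^sup>2) = complex_of_real ((norm x)\<^sup>2) * complex_of_real ((norm y)\<^sup>2)"
      using s by (simp only: cinner_norm[symmetric] hilbert_tensor_def)
    then have "(norm (s x y))\<^sup>2 = (norm x * norm y)\<^sup>2"
      by (simp only: of_real_mult[symmetric] of_real_eq_iff power_mult_distrib)
    then show ?thesis by (simp add: power2_eq_iff_nonneg)
  qed
  have "bounded_bilinear s"
  proof
    show "\<exists>K. \<forall>x y. norm (s x y) \<le> norm x * norm y * K"
      by (intro exI[of _ 1]) (simp add: norm)
  qed (simp_all add: scaleR_scaleC clinear_add[OF lin(1)] clinear_add[OF lin(2)]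
      clinear_scale[OF lin(1)] clinear_scale[OF lin(2)])
  then show ?thesis using assms(2,3) by (rule bounded_bilinear.continuous_on)
qed

lemma gns_dense_induct:
  assumes "is_gns \<omega> \<pi> \<Omega>" "closed {\<xi>. P \<xi>}" "\<And>x. P (\<pi> x \<Omega>)"
  shows "P \<xi>"
proof (rule dense_induct[OF _ assms(2)])
  show "closure (range (\<lambda>x. \<pi> x \<Omega>)) = UNIV"
    using assms(1) by (simp add: is_gns_def)
  show "P \<zeta>" if "\<zeta> \<in> range (\<lambda>x. \<pi> x \<Omega>)" for \<zeta>
    using that assms(3) by blast
qed

text \<open>Uniqueness in two stages, each by continuity and a dense span: in the vector, for the
  operators of elementary tensors, and then in the algebra element.\<close>

lemma rep_tensor_eqI:
  assumes t: "cstar_tensor t" and s: "hilbert_tensor s"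
    and \<pi>: "is_rep \<pi>" "\<And>x y \<xi> \<eta>. \<pi> (t x y) (s \<xi> \<eta>) = s (\<pi>\<^sub>1 x \<xi>) (\<pi>\<^sub>2 y \<eta>)"
  shows "rep_tensor t s \<pi>\<^sub>1 \<pi>\<^sub>2 = \<pi>"
  unfolding rep_tensor_def
proof (rule the_equality)
  fix \<pi>' assume \<pi>': "is_rep \<pi>' \<and> (\<forall>x y \<xi> \<eta>. \<pi>' (t x y) (s \<xi> \<eta>) = s (\<pi>\<^sub>1 x \<xi>) (\<pi>\<^sub>2 y \<eta>))"
  have dense: "closure (cspan (range (\<lambda>(\<xi>, \<eta>). s \<xi> \<eta>))) = UNIV"
    using s by (simp add: hilbert_tensor_def)
  have elem: "\<pi>' (t x y) \<zeta> = \<pi> (t x y) \<zeta>" for x y \<zeta>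
    by (rule clinear_eq_on_dense_span[OF _ _ _ _ dense])
       (use \<pi> \<pi>' in \<open>auto simp: is_rep_def intro!: rep_continuous_right\<close>)
  have "\<pi>' z \<zeta> = \<pi> z \<zeta>" for z \<zeta>
    by (rule clinear_eq_on_dense_span[OF _ _ _ _ ct_dense[OF t], where f = "\<lambda>z. \<pi>' z \<zeta>"])
       (use \<pi> \<pi>' elem in \<open>auto simp: is_rep_def intro!: rep_continuous_left\<close>)
  then show "\<pi>' = \<pi>" by (intro ext)
qed (use \<pi> in simp)

lemma rep_tensor_gns:
  fixes s :: "'h::chilbert_space \<Rightarrow> 'k::chilbert_space \<Rightarrow> 'm::chilbert_space"
    and t :: "'a::cstar_algebra \<Rightarrow> 'b::cstar_algebra \<Rightarrow> 'd::cstar_algebra"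
    and \<pi> :: "'c::cstar_algebra \<Rightarrow> 'l::chilbert_space \<Rightarrow> 'l"
  assumes t: "cstar_tensor t" and s: "hilbert_tensor s" and \<phi>: "star_iso \<phi>"
    and g1: "is_gns \<omega>\<^sub>1 \<pi>\<^sub>1 \<Omega>\<^sub>1" and g2: "is_gns \<omega>\<^sub>2 \<pi>\<^sub>2 \<Omega>\<^sub>2" and g: "is_gns \<omega> \<pi> \<Omega>"
    and \<omega>: "\<And>x y z. \<phi> z = t x y \<Longrightarrow> \<omega> z = \<omega>\<^sub>1 x * \<omega>\<^sub>2 y"
  shows "unitarily_equivalent (rep_tensor t s \<pi>\<^sub>1 \<pi>\<^sub>2 \<circ> \<phi>) \<pi>"
proof -
  define \<psi> where "\<psi> = inv_into UNIV \<phi>"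
  have bij: "bij \<phi>" and \<phi>_mult: "\<And>x y. \<phi> (x * y) = \<phi> x * \<phi> y" and \<phi>_star: "\<And>x. \<phi> (star x) = star (\<phi> x)"
    and \<phi>_lin: "clinear \<phi>"
    using \<phi> by (auto simp: star_iso_def)
  have \<phi>\<psi>: "\<phi> (\<psi> z) = z" and \<psi>\<phi>: "\<psi> (\<phi> x) = x" for x z
    using bij by (simp_all add: \<psi>_def bij_is_surj surj_f_inv_f bij_is_inj)
  have \<psi>: "star_iso \<psi>"
    unfolding star_iso_def clinear_iff
  proof (intro conjI allI)
    show "bij \<psi>" unfolding \<psi>_def using bij by (rule bij_imp_bij_inv)
  qed (rule injD[OF bij_is_inj[OF bij]],
      simp add: \<phi>\<psi> \<phi>_mult \<phi>_star clinear_add[OF \<phi>_lin] clinear_scale[OF \<phi>_lin])+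
  have reps: "is_rep \<pi>\<^sub>1" "is_rep \<pi>\<^sub>2" "is_rep \<pi>"
    using g1 g2 g by (auto simp: is_gns_def)
  have s_lin: "clinear (s x)" "clinear (\<lambda>x. s x y)"
    and s_inner: "cinner (s \<xi> \<eta>) (s \<xi>' \<eta>') = cinner \<xi> \<xi>' * cinner \<eta> \<eta>'"
    and s_dense: "closure (cspan (range (\<lambda>(\<xi>, \<eta>). s \<xi> \<eta>))) = UNIV" for x y \<xi> \<eta> \<xi>' \<eta>'
    using s by (auto simp: hilbert_tensor_def cbilinear_def)
  note s_cont = hilbert_tensor_continuous[OF s]
  have inner: "cinner (\<sigma> x \<xi>) (\<sigma> y \<xi>) = cinner \<xi> (\<sigma> (star x * y) \<xi>)" if "is_rep \<sigma>"
    for \<sigma> :: "'x::cstar_algebra \<Rightarrow> 'y::chilbert_space \<Rightarrow> 'y" and x y \<xi>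
    using that unfolding is_rep_def by (metis star_star)
  \<comment> \<open>Two families indexed by pairs \<open>(x, y)\<close>, \<open>f\<close> in the
    Hilbert space tensor product and \<open>h\<close> in the space of \<pi>; the hypothesis on
    \<omega> equates their Gram matrices.\<close>
  define f where "f = (\<lambda>(x, y). s (\<pi>\<^sub>1 x \<Omega>\<^sub>1) (\<pi>\<^sub>2 y \<Omega>\<^sub>2))"
  define h where "h = (\<lambda>(x, y). \<pi> (\<psi> (t x y)) \<Omega>)"
  have "cinner (f p) (f q) = cinner (h p) (h q)" for p q
  proof -
    obtain x y x' y' where pq: "p = (x, y)" "q = (x', y')" by fastforce
    have "cinner (h p) (h q) = \<omega> (star (\<psi> (t x y)) * \<psi> (t x' y'))"
      using g by (simp add: pq h_def inner[OF reps(3)] is_gns_def)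
    also have "\<dots> = \<omega>\<^sub>1 (star x * x') * \<omega>\<^sub>2 (star y * y')"
      by (rule \<omega>) (simp add: \<phi>_mult \<phi>_star \<phi>\<psi> ct_star[OF t] ct_mult[OF t])
    also have "\<dots> = cinner (f p) (f q)"
      using g1 g2 by (simp add: pq f_def s_inner inner[OF reps(1)] inner[OF reps(2)] is_gns_def)
    finally show ?thesis ..
  qed
  moreover have f_dense: "closure (cspan (range f)) = UNIV"
  proof -
    \<comment> \<open>Cyclicity of \<open>\<Omega>\<^sub>2\<close> frees the second slot; that of
      \<open>\<Omega>\<^sub>1\<close> will free the first.\<close>
    have f1: "s (\<pi>\<^sub>1 x \<Omega>\<^sub>1) \<eta> \<in> closure (cspan (range f))" for x \<eta>
    proof (rule gns_dense_induct[OF g2])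
      show "closed {\<eta>. s (\<pi>\<^sub>1 x \<Omega>\<^sub>1) \<eta> \<in> closure (cspan (range f))}"
        using closed_vimage[OF closed_closure s_cont[OF continuous_on_const continuous_on_id]]
        by (simp add: vimage_def)
      show "s (\<pi>\<^sub>1 x \<Omega>\<^sub>1) (\<pi>\<^sub>2 y \<Omega>\<^sub>2) \<in> closure (cspan (range f))" for y
        by (rule subsetD[OF closure_subset], rule complex_vector.span_base)
           (auto simp: f_def intro!: image_eqI[of _ _ "(x, y)"])
    qed
    have "s \<xi> \<eta> \<in> closure (cspan (range f))" for \<xi> \<eta>
    proof (rule gns_dense_induct[OF g1])
      show "closed {\<xi>. s \<xi> \<eta> \<in> closure (cspan (range f))}"
        using closed_vimage[OF closed_closure s_cont[OF continuous_on_id continuous_on_const]]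
        by (simp add: vimage_def)
    qed (rule f1)
    then have "range (\<lambda>(\<xi>, \<eta>). s \<xi> \<eta>) \<subseteq> closure (cspan (range f))" by auto
    from closure_cspan_subset[OF complex_vector.subspace_span this] show ?thesis
      unfolding s_dense by auto
  qed
  moreover have "closure (cspan (range h)) = UNIV"
  proof -
    \<comment> \<open>By linearity and continuity the closed span of \<open>h\<close> contains
      \<open>\<pi> (\<psi> z) \<Omega>\<close> for every \<open>z\<close>. As \<open>\<psi>\<close>
      is onto, these are all vectors \<open>\<pi> x \<Omega>\<close>, and cyclicity applies.\<close>
    have lin: "clinear (\<lambda>z. \<pi> (\<psi> z) \<Omega>)"
      using reps(3) \<psi> by (simp add: is_rep_def star_iso_def clinear_iff)
    have closed: "closed {z. \<pi> (\<psi> z) \<Omega> \<in> closure (cspan (range h))}"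
    proof -
      have "continuous_on UNIV (\<lambda>z. \<pi> (\<psi> z) \<Omega>)"
        by (rule continuous_on_compose2[OF rep_continuous_left[OF reps(3)]
              star_iso_continuous[OF \<psi> continuous_on_id]])
           auto
      then show ?thesis
        using closed_vimage[OF closed_closure] by (fastforce simp: vimage_def)
    qed
    have "\<pi> (\<psi> z) \<Omega> \<in> cspan (range h)" if "z \<in> cspan (range (\<lambda>(x, y). t x y))" for z
      using that
    proof (induction rule: complex_vector.span_induct_alt)
      case base
      show ?case by (simp add: clinear_zero[OF lin] complex_vector.span_zero)
    next
      case (step c z z')
      then obtain x y where "z = t x y" by auto
      then have "\<pi> (\<psi> z) \<Omega> \<in> range h"
        by (auto simp: h_def intro!: image_eqI[of _ _ "(x, y)"])
      then show ?case
        using step(2)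
        by (simp add: clinear_add[OF lin] clinear_scale[OF lin] complex_vector.span_add
            complex_vector.span_scale complex_vector.span_base)
    qed
    then have "\<pi> (\<psi> z) \<Omega> \<in> closure (cspan (range h))" if "z \<in> cspan (range (\<lambda>(x, y). t x y))" for z
      using that closure_subset by blast
    then have all: "\<pi> (\<psi> z) \<Omega> \<in> closure (cspan (range h))" for z
      by (rule dense_induct[OF ct_dense[OF t] closed])
    from all[of "\<phi> _"] have "\<pi> x \<Omega> \<in> closure (cspan (range h))" for x
      by (simp add: \<psi>\<phi>)
    then have "\<xi> \<in> closure (cspan (range h))" for \<xi>
      by (rule gns_dense_induct[OF g, where P = "\<lambda>\<xi>. \<xi> \<in> closure (cspan (range h))", rotated]) simp
    then show ?thesis by auto
  qed
  ultimately obtain U where U: "clinear U" "bij U" "\<And>x y. cinner (U x) (U y) = cinner x y" "\<And>p. U (f p) = h p"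
    using unitary_of_gram[of f h] by metis
  define V where "V = inv_into UNIV U"
  have UV: "U (V \<xi>) = \<xi>" and VU: "V (U \<zeta>) = \<zeta>" for \<xi> \<zeta>
    using U(2) by (simp_all add: V_def bij_is_surj surj_f_inv_f bij_is_inj)
  have V_lin: "clinear V"
    unfolding clinear_iff
    by (intro conjI allI; rule injD[OF bij_is_inj[OF U(2)]])
       (simp_all add: UV clinear_add[OF U(1)] clinear_scale[OF U(1)])
  have U_norm: "norm (U \<zeta>) = norm \<zeta>" for \<zeta>
  proof -
    have "complex_of_real ((norm (U \<zeta>))\<^sup>2) = complex_of_real ((norm \<zeta>)\<^sup>2)"
      using U(3)[of \<zeta> \<zeta>] by (simp only: cinner_norm)
    then show ?thesis
      by (simp only: of_real_eq_iff) (simp add: power2_eq_iff_nonneg)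
  qed
  have V_norm: "norm (V \<xi>) = norm \<xi>" for \<xi>
    using U_norm[of "V \<xi>"] by (simp add: UV)
  have V_inner: "cinner (V \<xi>) \<zeta> = cinner \<xi> (U \<zeta>)" for \<xi> \<zeta>
    using U(3)[of "V \<xi>" \<zeta>] by (simp add: UV)
  have V_bl: "bounded_linear V" and U_bl: "bounded_linear U"
    using bounded_clinear[OF V_lin, where K = 1] bounded_clinear[OF U(1), where K = 1] U_norm V_norm
    by simp_all
  \<comment> \<open>The representation \<pi>, transported along \<open>U\<close> to the Hilbert
    space tensor product and along \<open>\<psi>\<close> to the tensor product algebra.\<close>
  define \<sigma> where "\<sigma> z \<zeta> = V (\<pi> (\<psi> z) (U \<zeta>))" for z \<zeta>
  have \<sigma>_rep: "is_rep \<sigma>"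
    unfolding is_rep_def
  proof (intro conjI allI)
    note r = reps(3)[unfolded is_rep_def]
    fix z z' \<xi> \<eta>
    show "clinear (\<sigma> z)"
      using r by (simp add: \<sigma>_def clinear_iff clinear_add[OF V_lin] clinear_scale[OF V_lin]
          clinear_add[OF U(1)] clinear_scale[OF U(1)])
    show "bounded_linear (\<sigma> z)"
      unfolding \<sigma>_def using r
      by (intro bounded_linear_compose[OF V_bl] bounded_linear_compose[OF _ U_bl]) blast
    show "clinear (\<lambda>z. \<sigma> z \<xi>)"
      using r \<psi> by (simp add: \<sigma>_def star_iso_def clinear_iff clinear_add[OF V_lin] clinear_scale[OF V_lin])
    show "\<sigma> (z * z') \<xi> = \<sigma> z (\<sigma> z' \<xi>)"
      using r \<psi> by (simp add: \<sigma>_def star_iso_def UV)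
    show "cinner (\<sigma> (star z) \<xi>) \<eta> = cinner \<xi> (\<sigma> z \<eta>)"
      using r \<psi> V_inner U(3)[of \<xi> "V (\<pi> (\<psi> z) (U \<eta>))"] by (simp add: \<sigma>_def star_iso_def UV)
  qed
  have "\<sigma> (t x y) (s \<xi> \<eta>) = s (\<pi>\<^sub>1 x \<xi>) (\<pi>\<^sub>2 y \<eta>)" for x y \<xi> \<eta>
  proof -
    have cont: "continuous_on A (\<lambda>z. \<sigma> w (k z))" if "continuous_on A k"
      for A w and k :: "'z::topological_space \<Rightarrow> 'm"
      using rep_continuous_right[OF \<sigma>_rep] that by (rule continuous_on_compose2) auto
    \<comment> \<open>On the vectors of \<open>f\<close> the identity is the multiplicativity of
      \<open>\<pi>\<close>, \<open>\<psi>\<close> and \<open>t\<close>, read through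
      \<open>U (f p) = h p\<close>; density then frees one slot after the other.\<close>
    have base: "\<sigma> (t x y) (s (\<pi>\<^sub>1 x' \<Omega>\<^sub>1) (\<pi>\<^sub>2 y' \<Omega>\<^sub>2)) = s (\<pi>\<^sub>1 x (\<pi>\<^sub>1 x' \<Omega>\<^sub>1)) (\<pi>\<^sub>2 y (\<pi>\<^sub>2 y' \<Omega>\<^sub>2))" for x' y'
    proof -
      have "\<psi> (t x y) * \<psi> (t x' y') = \<psi> (t (x * x') (y * y'))"
        using \<psi> by (simp add: star_iso_def ct_mult[OF t, symmetric])
      then have "\<pi> (\<psi> (t x y)) (h (x', y')) = h (x * x', y * y')"
        using reps(3) by (simp add: h_def is_rep_def) metis
      then have "\<sigma> (t x y) (f (x', y')) = f (x * x', y * y')"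
        unfolding \<sigma>_def U(4) by (simp add: U(4)[symmetric] VU)
      then show ?thesis
        using reps by (simp add: f_def is_rep_def)
    qed
    have step: "\<sigma> (t x y) (s (\<pi>\<^sub>1 x' \<Omega>\<^sub>1) \<eta>) = s (\<pi>\<^sub>1 x (\<pi>\<^sub>1 x' \<Omega>\<^sub>1)) (\<pi>\<^sub>2 y \<eta>)" for x' \<eta>
    proof (rule gns_dense_induct[OF g2,
          where P = "\<lambda>\<eta>. \<sigma> (t x y) (s (\<pi>\<^sub>1 x' \<Omega>\<^sub>1) \<eta>) = s (\<pi>\<^sub>1 x (\<pi>\<^sub>1 x' \<Omega>\<^sub>1)) (\<pi>\<^sub>2 y \<eta>)"])
      show "closed {\<eta>. \<sigma> (t x y) (s (\<pi>\<^sub>1 x' \<Omega>\<^sub>1) \<eta>) = s (\<pi>\<^sub>1 x (\<pi>\<^sub>1 x' \<Omega>\<^sub>1)) (\<pi>\<^sub>2 y \<eta>)}"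
        by (intro closed_Collect_eq cont s_cont continuous_on_const continuous_on_id
            rep_continuous_right[OF reps(2)])
    qed (rule base)
    show ?thesis
    proof (rule gns_dense_induct[OF g1, where P = "\<lambda>\<xi>. \<sigma> (t x y) (s \<xi> \<eta>) = s (\<pi>\<^sub>1 x \<xi>) (\<pi>\<^sub>2 y \<eta>)"])
      show "closed {\<xi>. \<sigma> (t x y) (s \<xi> \<eta>) = s (\<pi>\<^sub>1 x \<xi>) (\<pi>\<^sub>2 y \<eta>)}"
        by (intro closed_Collect_eq cont s_cont continuous_on_const continuous_on_id
            rep_continuous_right[OF reps(1)])
    qed (rule step)
  qed
  then have "rep_tensor t s \<pi>\<^sub>1 \<pi>\<^sub>2 = \<sigma>"
    by (rule rep_tensor_eqI[OF t s \<sigma>_rep])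
  \<comment> \<open>As \<open>\<psi>\<close> inverts \<open>\<phi>\<close>, composing
    \<open>\<sigma>\<close> with \<open>\<phi>\<close> leaves the conjugate of \<open>\<pi>\<close>
    by \<open>U\<close>.\<close>
  then show ?thesis
    unfolding unitarily_equivalent_def
    using U by (intro exI[of _ U]) (auto simp: \<sigma>_def UV \<psi>\<phi>)
qed

theorem theorem1p5:
  fixes a b :: "nat \<Rightarrow> nat"
    and \<iota>\<^sub>a :: "nat \<Rightarrow> complex mat \<Rightarrow> 'a::cstar_algebra"
    and \<iota>\<^sub>b :: "nat \<Rightarrow> complex mat \<Rightarrow> 'b::cstar_algebra"
    and \<iota>\<^sub>c :: "nat \<Rightarrow> complex mat \<Rightarrow> 'c::cstar_algebra"
    and t :: "'a \<Rightarrow> 'b \<Rightarrow> 'd::cstar_algebra"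
  assumes "\<forall>n. 2 \<le> a n" and "\<forall>n. 2 \<le> b n"
    and "uhf_algebra a \<iota>\<^sub>a" and "uhf_algebra b \<iota>\<^sub>b"
    and "uhf_algebra (\<lambda>n. a n * b n) \<iota>\<^sub>c"
    and "cstar_tensor t"
  shows
    "(\<forall>T\<in>density_seqs a. \<forall>R\<in>density_seqs b.
        (\<lambda>n. kron (T n) (R n)) \<in> density_seqs (\<lambda>n. a n * b n) \<and>
        state_tensor_phi a b \<iota>\<^sub>a \<iota>\<^sub>b \<iota>\<^sub>c t (product_state a \<iota>\<^sub>a T) (product_state b \<iota>\<^sub>b R) =
          product_state (\<lambda>n. a n * b n) \<iota>\<^sub>c (\<lambda>n. kron (T n) (R n))) \<and>
     (\<forall>T\<in>density_seqs a. \<forall>R\<in>density_seqs b.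
        \<forall>(\<pi>\<^sub>T :: 'a \<Rightarrow> 'h::chilbert_space \<Rightarrow> 'h) \<Omega>\<^sub>T (\<pi>\<^sub>R :: 'b \<Rightarrow> 'k::chilbert_space \<Rightarrow> 'k) \<Omega>\<^sub>R
         (\<pi> :: 'c \<Rightarrow> 'l::chilbert_space \<Rightarrow> 'l) \<Omega>
         (s :: 'h \<Rightarrow> 'k \<Rightarrow> 'm::chilbert_space).
          is_gns (product_state a \<iota>\<^sub>a T) \<pi>\<^sub>T \<Omega>\<^sub>T \<longrightarrow>
          is_gns (product_state b \<iota>\<^sub>b R) \<pi>\<^sub>R \<Omega>\<^sub>R \<longrightarrow>
          is_gns (product_state (\<lambda>n. a n * b n) \<iota>\<^sub>c (\<lambda>n. kron (T n) (R n))) \<pi> \<Omega> \<longrightarrow>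
          hilbert_tensor s \<longrightarrow>
          unitarily_equivalent (rep_tensor_phi a b \<iota>\<^sub>a \<iota>\<^sub>b \<iota>\<^sub>c t s \<pi>\<^sub>T \<pi>\<^sub>R) \<pi>)"
proof (rule conjI; intro ballI allI impI)
  note phi = product_state_tensor_phi[OF assms(3-6)]
  fix T R assume T: "T \<in> density_seqs a" and R: "R \<in> density_seqs b"
  show "(\<lambda>n. kron (T n) (R n)) \<in> density_seqs (\<lambda>n. a n * b n) \<and>
      state_tensor_phi a b \<iota>\<^sub>a \<iota>\<^sub>b \<iota>\<^sub>c t (product_state a \<iota>\<^sub>a T) (product_state b \<iota>\<^sub>b R) =
        product_state (\<lambda>n. a n * b n) \<iota>\<^sub>c (\<lambda>n. kron (T n) (R n))"
    using T R phi(1)[OF T R] by (simp add: density_seqs_def density_mat_kron state_tensor_phi_def)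
  fix \<pi>\<^sub>T :: "'a \<Rightarrow> 'h \<Rightarrow> 'h" and \<Omega>\<^sub>T and \<pi>\<^sub>R :: "'b \<Rightarrow> 'k \<Rightarrow> 'k" and \<Omega>\<^sub>R
    and \<pi> :: "'c \<Rightarrow> 'l \<Rightarrow> 'l" and \<Omega> and s :: "'h \<Rightarrow> 'k \<Rightarrow> 'm"
  assume gns: "is_gns (product_state a \<iota>\<^sub>a T) \<pi>\<^sub>T \<Omega>\<^sub>T" "is_gns (product_state b \<iota>\<^sub>b R) \<pi>\<^sub>R \<Omega>\<^sub>R"
    "is_gns (product_state (\<lambda>n. a n * b n) \<iota>\<^sub>c (\<lambda>n. kron (T n) (R n))) \<pi> \<Omega>" and s: "hilbert_tensor s"
  show "unitarily_equivalent (rep_tensor_phi a b \<iota>\<^sub>a \<iota>\<^sub>b \<iota>\<^sub>c t s \<pi>\<^sub>T \<pi>\<^sub>R) \<pi>"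
    unfolding rep_tensor_phi_def
    by (rule rep_tensor_gns[OF assms(6) s uhf_iso_props(1)[OF assms(3-6)] gns]) (rule phi(2)[OF T R])
qed

end
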